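(* Let $k$ be a field, $K$ a finite separable field extension of $k$ which is also a normal extension of $k$, and $\Lambda$ a $k$-algebra. Let $M$ be a finite-dimensional $K\otimes_k\Lambda$-module, and let $M_1,\ldots,M_r$ be indecomposable finite-dimensional $K\otimes_k\Lambda$-modules. If $M$ and $M_1\oplus\cdots\oplus M_r$ are isomorphic as $\Lambda$-modules, then there exist $\phi_1,\ldots,\phi_r\in G(K/k)$ such that $M$ and $M_1^{\phi_1}\oplus\cdots\oplus M_r^{\phi_r}$ are isomorphic as $K\otimes_k\Lambda$-modules.
   Context: $\Lambda$ is regarded as a subring of $K\otimes_k\Lambda$ via $\lambda\mapsto 1\otimes\lambda$, so every $K\otimes_k\Lambda$-module is also a $\Lambda$-module. The modules $M_i$ are indecomposable as $K\otimes_k\Lambda$-modules. $G(K/k)$ denotes the Galois group of $K$ over $k$, i.e. the group of $k$-automorphisms of $K$. For $\phi\in G(K/k)$ and a $K\otimes_k\Lambda$-module $M$, $M^\phi$ denotes the $K\otimes_k\Lambda$-module that equals $M$ as a $k$-space, with multiplication given by $(x\otimes\lambda)\cdot_{M^\phi}m=(\phi(x)\otimes\lambda)\cdot_M m$. *)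

theory Defs
  imports "HOL-Algebra.Algebraic_Closure" "HOL-Algebra.Free_Abelian_Groups"
begin

text \<open>The library locale \<^locale>\<open>module\<close> requires a commutative ring of scalars. The record
  type and the notion of \<^locale>\<open>submodule\<close> do not, and are reused here.\<close>

locale left_module = R?: ring R + M?: abelian_group M
   for R :: "('r, 'x) ring_scheme" (structure)
    and M :: "('r, 'm, 'y) module_scheme" (structure) +
  assumes smult_closed:
      "\<lbrakk> a \<in> carrier R; x \<in> carrier M \<rbrakk> \<Longrightarrow> a \<odot>\<^bsub>M\<^esub> x \<in> carrier M"
    and smult_l_distr:
      "\<lbrakk> a \<in> carrier R; b \<in> carrier R; x \<in> carrier M \<rbrakk> \<Longrightarrow>
      (a \<oplus> b) \<odot>\<^bsub>M\<^esub> x = a \<odot>\<^bsub>M\<^esub> x \<oplus>\<^bsub>M\<^esub> b \<odot>\<^bsub>M\<^esub> x"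
    and smult_r_distr:
      "\<lbrakk> a \<in> carrier R; x \<in> carrier M; y \<in> carrier M \<rbrakk> \<Longrightarrow>
      a \<odot>\<^bsub>M\<^esub> (x \<oplus>\<^bsub>M\<^esub> y) = a \<odot>\<^bsub>M\<^esub> x \<oplus>\<^bsub>M\<^esub> a \<odot>\<^bsub>M\<^esub> y"
    and smult_assoc1:
      "\<lbrakk> a \<in> carrier R; b \<in> carrier R; x \<in> carrier M \<rbrakk> \<Longrightarrow>
      (a \<otimes> b) \<odot>\<^bsub>M\<^esub> x = a \<odot>\<^bsub>M\<^esub> (b \<odot>\<^bsub>M\<^esub> x)"
    and smult_one:
      "x \<in> carrier M \<Longrightarrow> \<one> \<odot>\<^bsub>M\<^esub> x = x"

lemma left_module_iff_module:
  assumes "cring R"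
  shows "left_module R M \<longleftrightarrow> module R M"
proof
  assume "left_module R M"
  then interpret left_module R M .
  show "module R M"
    by (rule moduleI[OF assms M.abelian_group_axioms])
      (fact smult_closed smult_l_distr smult_r_distr smult_assoc1 smult_one)+
next
  assume "module R M"
  then interpret module R M .
  show "left_module R M"
    by (intro left_module.intro left_module_axioms.intro R.ring_axioms M.abelian_group_axioms)
      (fact smult_closed smult_l_distr smult_r_distr smult_assoc1 smult_one)+
qed

definition module_isomorphic ::
    "('r, 'x) ring_scheme \<Rightarrow> ('r, 'm, 'y) module_scheme \<Rightarrow> ('r, 'n, 'z) module_scheme \<Rightarrow> bool" where
  "module_isomorphic R M N \<longleftrightarrow> (\<exists>f. bij_betw f (carrier M) (carrier N) \<and>
     (\<forall>x\<in>carrier M. \<forall>y\<in>carrier M. f (x \<oplus>\<^bsub>M\<^esub> y) = f x \<oplus>\<^bsub>N\<^esub> f y) \<and>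
     (\<forall>a\<in>carrier R. \<forall>x\<in>carrier M. f (a \<odot>\<^bsub>M\<^esub> x) = a \<odot>\<^bsub>N\<^esub> f x))"

definition indecomposable_module ::
    "('r, 'x) ring_scheme \<Rightarrow> ('r, 'm, 'y) module_scheme \<Rightarrow> bool" where
  "indecomposable_module R M \<longleftrightarrow> carrier M \<noteq> {\<zero>\<^bsub>M\<^esub>} \<and>
     (\<forall>N\<^sub>1 N\<^sub>2. submodule N\<^sub>1 R M \<and> submodule N\<^sub>2 R M \<and>
        N\<^sub>1 \<inter> N\<^sub>2 = {\<zero>\<^bsub>M\<^esub>} \<and> N\<^sub>1 <+>\<^bsub>M\<^esub> N\<^sub>2 = carrier M \<longrightarrow>
        N\<^sub>1 = {\<zero>\<^bsub>M\<^esub>} \<or> N\<^sub>2 = {\<zero>\<^bsub>M\<^esub>})"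

text \<open>The fields \<^const>\<open>monoid.mult\<close> and \<^const>\<open>one\<close> of a module record play no role
  for modules.\<close>

definition direct_sum_module :: "'i set \<Rightarrow> ('i \<Rightarrow> ('r, 'm, 'y) module_scheme) \<Rightarrow> ('r, 'i \<Rightarrow> 'm) module" where
  "direct_sum_module I M =
     \<lparr>carrier = {x \<in> \<Pi>\<^sub>E i\<in>I. carrier (M i). finite {i \<in> I. x i \<noteq> \<zero>\<^bsub>M i\<^esub>}},
      monoid.mult = undefined, one = undefined,
      ring.zero = (\<lambda>i\<in>I. \<zero>\<^bsub>M i\<^esub>), add = (\<lambda>x y. \<lambda>i\<in>I. x i \<oplus>\<^bsub>M i\<^esub> y i),
      module.smult = (\<lambda>a x. \<lambda>i\<in>I. a \<odot>\<^bsub>M i\<^esub> x i)\<rparr>"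

definition restrict_scalars :: "('s \<Rightarrow> 'r) \<Rightarrow> ('r, 'm, 'y) module_scheme \<Rightarrow> ('s, 'm) module" where
  "restrict_scalars h M =
     \<lparr>carrier = carrier M, monoid.mult = monoid.mult M, one = \<one>\<^bsub>M\<^esub>, ring.zero = \<zero>\<^bsub>M\<^esub>, add = add M,
      module.smult = (\<lambda>s. module.smult M (h s))\<rparr>"

lemma left_module_restrict_scalars:
  assumes "left_module R M" and "ring S" and "h \<in> ring_hom S R"
  shows "left_module S (restrict_scalars h M)"
proof -
  interpret left_module R M by fact
  interpret S: ring S by fact
  have ag: "abelian_group (restrict_scalars h M)"
  proof (rule abelian_groupI)
    fix x assume "x \<in> carrier (restrict_scalars h M)"
    then show "\<exists>y\<in>carrier (restrict_scalars h M).
        y \<oplus>\<^bsub>restrict_scalars h M\<^esub> x = \<zero>\<^bsub>restrict_scalars h M\<^esub>"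
      by (intro bexI[of _ "\<ominus>\<^bsub>M\<^esub> x"]) (simp_all add: restrict_scalars_def M.l_neg)
  qed (auto simp: restrict_scalars_def intro: M.a_assoc M.a_comm)
  have h: "h a \<in> carrier R" if "a \<in> carrier S" for a
    using ring_hom_memE(1)[OF assms(3) that] .
  show ?thesis
  proof (rule left_module.intro[OF S.ring_axioms ag], rule left_module_axioms.intro)
    fix a b x assume "a \<in> carrier S" "b \<in> carrier S" "x \<in> carrier (restrict_scalars h M)"
    then show "(a \<oplus>\<^bsub>S\<^esub> b) \<odot>\<^bsub>restrict_scalars h M\<^esub> x =
        a \<odot>\<^bsub>restrict_scalars h M\<^esub> x \<oplus>\<^bsub>restrict_scalars h M\<^esub> b \<odot>\<^bsub>restrict_scalars h M\<^esub> x"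
      and "(a \<otimes>\<^bsub>S\<^esub> b) \<odot>\<^bsub>restrict_scalars h M\<^esub> x =
        a \<odot>\<^bsub>restrict_scalars h M\<^esub> (b \<odot>\<^bsub>restrict_scalars h M\<^esub> x)"
      using smult_l_distr[OF h h, of a b x] smult_assoc1[OF h h, of a b x]
        ring_hom_memE(2,3)[OF assms(3), of a b]
      by (simp_all add: restrict_scalars_def)
  next
    fix x assume "x \<in> carrier (restrict_scalars h M)"
    then show "\<one>\<^bsub>S\<^esub> \<odot>\<^bsub>restrict_scalars h M\<^esub> x = x"
      using smult_one[of x] ring_hom_memE(4)[OF assms(3)] by (simp add: restrict_scalars_def)
  qed (use h in \<open>simp_all add: restrict_scalars_def smult_closed smult_r_distr\<close>)
qed

definition finite_dimensional :: "('r, 'x) ring_scheme \<Rightarrow> ('r, 'm, 'y) module_scheme \<Rightarrow> bool" where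
  "finite_dimensional F V \<longleftrightarrow> (\<exists>B. finite B \<and> B \<subseteq> carrier V \<and>
     (\<forall>v\<in>carrier V. \<exists>a\<in>B \<rightarrow> carrier F. v = (\<Oplus>\<^bsub>V\<^esub>b\<in>B. a b \<odot>\<^bsub>V\<^esub> b)))"


text \<open>The library locale \<^locale>\<open>algebra\<close> is restricted to commutative algebras.\<close>

locale assoc_algebra = module R M + ring M
   for R :: "('r, 'x) ring_scheme" (structure)
    and M :: "('r, 'm, 'y) module_scheme" (structure) +
  assumes smult_mult_left:
      "\<lbrakk> c \<in> carrier R; x \<in> carrier M; y \<in> carrier M \<rbrakk> \<Longrightarrow>
      (c \<odot>\<^bsub>M\<^esub> x) \<otimes>\<^bsub>M\<^esub> y = c \<odot>\<^bsub>M\<^esub> (x \<otimes>\<^bsub>M\<^esub> y)"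
    and smult_mult_right:
      "\<lbrakk> c \<in> carrier R; x \<in> carrier M; y \<in> carrier M \<rbrakk> \<Longrightarrow>
      x \<otimes>\<^bsub>M\<^esub> (c \<odot>\<^bsub>M\<^esub> y) = c \<odot>\<^bsub>M\<^esub> (x \<otimes>\<^bsub>M\<^esub> y)"

text \<open>
  The tensor product \<open>K \<otimes>\<^sub>k A\<close> of an extension \<open>K\<close> of a field \<open>k\<close> (given as a subset of \<open>K\<close>)
  and a \<open>k\<close>-algebra \<open>A\<close> is the free abelian group on \<open>K \<times> A\<close>, multiplied by
  \<open>(a, x) (b, y) = (a b, x y)\<close>, modulo the subgroup of bilinearity relations.
\<close>

definition free_pair_ring ::
    "('a, 'x) ring_scheme \<Rightarrow> ('b, 'y) ring_scheme \<Rightarrow> ('a \<times> 'b \<Rightarrow>\<^sub>0 int) ring" where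
  "free_pair_ring K A =
     \<lparr>carrier = carrier (free_Abelian_group (carrier K \<times> carrier A)),
      monoid.mult = (\<lambda>u v. frag_extend (\<lambda>(a, x). frag_extend (\<lambda>(b, y).
         frag_of (a \<otimes>\<^bsub>K\<^esub> b, x \<otimes>\<^bsub>A\<^esub> y)) v) u),
      one = frag_of (\<one>\<^bsub>K\<^esub>, \<one>\<^bsub>A\<^esub>), ring.zero = 0, add = (+)\<rparr>"

definition tensor_relators ::
    "('a, 'x) ring_scheme \<Rightarrow> 'a set \<Rightarrow> ('a, 'b, 'y) module_scheme \<Rightarrow> ('a \<times> 'b \<Rightarrow>\<^sub>0 int) set" where
  "tensor_relators K k A =
     {frag_of (a \<oplus>\<^bsub>K\<^esub> b, x) - frag_of (a, x) - frag_of (b, x) | a b x.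
        a \<in> carrier K \<and> b \<in> carrier K \<and> x \<in> carrier A} \<union>
     {frag_of (a, x \<oplus>\<^bsub>A\<^esub> y) - frag_of (a, x) - frag_of (a, y) | a x y.
        a \<in> carrier K \<and> x \<in> carrier A \<and> y \<in> carrier A} \<union>
     {frag_of (a \<otimes>\<^bsub>K\<^esub> c, x) - frag_of (a, c \<odot>\<^bsub>A\<^esub> x) | a c x.
        a \<in> carrier K \<and> c \<in> k \<and> x \<in> carrier A}"

definition tensor_relations ::
    "('a, 'x) ring_scheme \<Rightarrow> 'a set \<Rightarrow> ('a, 'b, 'y) module_scheme \<Rightarrow> ('a \<times> 'b \<Rightarrow>\<^sub>0 int) set" where
  "tensor_relations K k A =
     generate (free_Abelian_group (carrier K \<times> carrier A)) (tensor_relators K k A)"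

definition tensor_ring ::
    "('a, 'x) ring_scheme \<Rightarrow> 'a set \<Rightarrow> ('a, 'b, 'y) module_scheme \<Rightarrow> ('a \<times> 'b \<Rightarrow>\<^sub>0 int) set ring" where
  "tensor_ring K k A = free_pair_ring K A Quot tensor_relations K k A"

definition pure_tensor ::
    "('a, 'x) ring_scheme \<Rightarrow> 'a set \<Rightarrow> ('a, 'b, 'y) module_scheme \<Rightarrow> 'a \<Rightarrow> 'b \<Rightarrow> ('a \<times> 'b \<Rightarrow>\<^sub>0 int) set" where
  "pure_tensor K k A a x = tensor_relations K k A +>\<^bsub>free_pair_ring K A\<^esub> frag_of (a, x)"

text \<open>The map \<open>\<phi> \<otimes> id\<close> on \<open>K \<otimes>\<^sub>k A\<close>, for a \<open>k\<close>-linear \<open>\<phi> : K \<rightarrow> K\<close>: all members \<open>u\<close> of a coset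
  have the same image coset, so the union below is that one coset.\<close>

definition tensor_map ::
    "('a, 'x) ring_scheme \<Rightarrow> 'a set \<Rightarrow> ('a, 'b, 'y) module_scheme \<Rightarrow> ('a \<Rightarrow> 'a) \<Rightarrow>
     ('a \<times> 'b \<Rightarrow>\<^sub>0 int) set \<Rightarrow> ('a \<times> 'b \<Rightarrow>\<^sub>0 int) set" where
  "tensor_map K k A \<phi> C =
     (\<Union>u\<in>C. tensor_relations K k A +>\<^bsub>free_pair_ring K A\<^esub>
        frag_extend (\<lambda>(a, x). frag_of (\<phi> a, x)) u)"

definition twist ::
    "('a, 'x) ring_scheme \<Rightarrow> 'a set \<Rightarrow> ('a, 'b, 'y) module_scheme \<Rightarrow> ('a \<Rightarrow> 'a) \<Rightarrow>
     (('a \<times> 'b \<Rightarrow>\<^sub>0 int) set, 'm, 'z) module_scheme \<Rightarrow> (('a \<times> 'b \<Rightarrow>\<^sub>0 int) set, 'm) module" where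
  "twist K k A \<phi> M = restrict_scalars (tensor_map K k A \<phi>) M"

definition as_left_factor_module ::
    "('a, 'x) ring_scheme \<Rightarrow> 'a set \<Rightarrow> ('a, 'b, 'y) module_scheme \<Rightarrow>
     (('a \<times> 'b \<Rightarrow>\<^sub>0 int) set, 'm, 'z) module_scheme \<Rightarrow> ('a, 'm) module" where
  "as_left_factor_module K k A M = restrict_scalars (\<lambda>a. pure_tensor K k A a \<one>\<^bsub>A\<^esub>) M"

definition as_right_factor_module ::
    "('a, 'x) ring_scheme \<Rightarrow> 'a set \<Rightarrow> ('a, 'b, 'y) module_scheme \<Rightarrow>
     (('a \<times> 'b \<Rightarrow>\<^sub>0 int) set, 'm, 'z) module_scheme \<Rightarrow> ('b, 'm) module" where
  "as_right_factor_module K k A M = restrict_scalars (\<lambda>x. pure_tensor K k A \<one>\<^bsub>K\<^esub> x) M"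


definition normal_extension :: "'a ring \<Rightarrow> 'a set \<Rightarrow> bool" where
  "normal_extension K k \<longleftrightarrow> (\<forall>x\<in>carrier K. (ring.algebraic K over k) x) \<and>
     (\<forall>p\<in>carrier (k[X]\<^bsub>K\<^esub>). pirreducible\<^bsub>K\<^esub> k p \<and> (\<exists>x\<in>carrier K. ring.eval K p x = \<zero>\<^bsub>K\<^esub>) \<longrightarrow>
        ring.splitted K p)"

text \<open>The map \<^const>\<open>ring.indexed_const\<close> embeds \<open>K\<close> into its algebraic closure; no minimal
  polynomial over \<open>k\<close> may have a multiple root there.\<close>

definition separable_extension :: "'a ring \<Rightarrow> 'a set \<Rightarrow> bool" where
  "separable_extension K k \<longleftrightarrow> (\<forall>x\<in>carrier K. (ring.algebraic K over k) x \<and>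
     (let L = field.alg_closure K
      in \<forall>y\<in>carrier L. ring.alg_mult L (map (ring.indexed_const K) (ring.Irr K k x)) y \<le> 1))"

definition galois_group :: "'a ring \<Rightarrow> 'a set \<Rightarrow> ('a \<Rightarrow> 'a) set" where
  "galois_group K k = {\<phi> \<in> ring_iso K K. \<forall>c\<in>k. \<phi> c = c}"

end

theory Submission
  imports Defs
begin

text \<open>
  An isomorphism \<open>f : M \<rightarrow> M\<^sub>1 \<oplus> \<dots> \<oplus> M\<^sub>r\<close> of \<open>\<Lambda>\<close>-modules carries the \<open>K\<close>-structure of the right-hand side
  to \<open>M\<close>, so that \<open>E = End\<^sub>\<Lambda>(M)\<close> contains two images \<open>\<alpha>(K)\<close>, \<open>\<beta>(K)\<close> of \<open>K\<close> and orthogonal idempotents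
  \<open>e\<^sub>i\<close> of sum \<open>1\<close> that are primitive in the centralizer of \<open>\<beta>(K)\<close>. What is wanted is a unit \<open>u\<close> of \<open>E\<close>
  with \<open>e\<^sub>i u \<alpha>(a) = e\<^sub>i \<beta>(\<phi>\<^sub>i a) u\<close>.

  Minimal polynomials over \<open>k\<close> split over \<open>K\<close> into distinct linear factors, so \<open>E\<close>, with \<open>K\<close> acting on the
  left by one of the two images and on the right by the other, is spanned by elements \<open>x\<close> with
  \<open>\<beta>(a) x = x \<alpha>(\<psi> a)\<close> for an automorphism \<open>\<psi>\<close>. Decompose both factors of \<open>1 = 1 \<cdot> 1\<close> in this way
  and keep the products that commute with \<open>\<beta>(K)\<close>: by independence of characters they still sum to
  \<open>1\<close>. As the corner of the centralizer at \<open>e\<^sub>1\<close> is local (Fitting), one of them is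
  invertible there, which exhibits a twist of \<open>M\<^sub>1\<close> as a direct summand of \<open>M\<close>. Over \<open>\<Lambda>\<close> this summand
  can be cancelled, and induction on \<open>r\<close> applies to the complements.
\<close>

section \<open>Idempotents, local corners and cancellation\<close>

text \<open>An isomorphism over \<Lambda> ignores \<open>K\<close>, and a module indecomposable over
  K \<otimes> \<Lambda> may decompose over \<Lambda>. Hence two notions of primitivity:
  \<open>e\<^sub>i\<close> is primitive in the centralizer of \<beta>(K), where locality selects a
  summand, but the cancellation takes place in all of \<open>E\<close>, where
  \<open>e\<^sub>i\<close> may split further. Cancellation is therefore proved for arbitrary
  idempotents, by induction on a rank. A \<Lambda>-isomorphism of the complements is all that
  survives one step, and it is all that the induction needs. So that the ring \<open>E\<close> stays
  the same throughout, a representation of \<open>K\<close> may send 1 to an idempotent; complements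
  are reached by multiplying with idempotents instead of changing modules. The decomposition into
  semilinear elements replaces the isomorphism of K \<otimes> K with a product of copies of
  \<open>K\<close> indexed by the Galois group: for the minimal polynomial \<open>p\<close> of
  \<open>a\<close>, the product of the operators x \<mapsto> \<beta>(a) x - x \<alpha>(l) over the
  roots \<open>l\<close> of \<open>p\<close> is evaluation of \<open>p\<close> at \<open>a\<close>,
  hence zero.\<close>

context ring
begin

text \<open>Used with \<open>THEN\<close>: an equation for a product of two factors becomes a
  rewrite rule that still applies when the product is nested to the right inside a longer
  one.\<close>

lemma mult_assoc_eq:
  assumes "a \<otimes> b = c" and "a \<in> carrier R" and "b \<in> carrier R" and "z \<in> carrier R"
  shows "a \<otimes> (b \<otimes> z) = c \<otimes> z"
  using assms m_assoc by metis

text \<open>Sums without negatives or coefficients: the induction rule then adds one element of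
  \<open>Z\<close> at a time, which is the form in which a unit of a local ring is traced to one of
  its summands.\<close>

inductive_set add_span :: "'a set \<Rightarrow> 'a set" for Z where
  zero: "\<zero> \<in> add_span Z"
| step: "\<lbrakk>z \<in> Z; x \<in> add_span Z\<rbrakk> \<Longrightarrow> z \<oplus> x \<in> add_span Z"

lemma add_span_closed:
  assumes "x \<in> add_span Z" and "Z \<subseteq> carrier R"
  shows "x \<in> carrier R"
  using assms by (induction) auto

lemma add_span_base:
  assumes "z \<in> Z" and "Z \<subseteq> carrier R"
  shows "z \<in> add_span Z"
proof -
  have "z \<oplus> \<zero> \<in> add_span Z" by (intro add_span.intros assms)
  then show ?thesis using assms by auto
qed

lemma add_span_mono: "x \<in> add_span Z \<Longrightarrow> Z \<subseteq> Z' \<Longrightarrow> x \<in> add_span Z'"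
  by (induction rule: add_span.induct) (auto intro: add_span.intros)

lemma add_span_add:
  assumes "x \<in> add_span Z" and "y \<in> add_span Z" and "Z \<subseteq> carrier R"
  shows "x \<oplus> y \<in> add_span Z"
  using assms(1)
proof induction
  case zero
  then show ?case using assms add_span_closed by simp
next
  case (step z x)
  have "z \<oplus> x \<oplus> y = z \<oplus> (x \<oplus> y)"
    using step assms add_span_closed by (intro a_assoc) auto
  then show ?case using add_span.step[OF step(1) step(3)] by simp
qed

lemma add_span_trans:
  assumes "x \<in> add_span Z" and "\<And>z. z \<in> Z \<Longrightarrow> z \<in> add_span V" and "V \<subseteq> carrier R"
  shows "x \<in> add_span V"
  using assms(1)
proof induction
  case (step z x)
  then show ?case using assms by (intro add_span_add) auto
qed (rule add_span.zero)

lemma add_span_additive_image: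
  assumes "x \<in> add_span Z" and "Z \<subseteq> carrier R"
    and "h \<zero> = \<zero>" and "\<And>x y. x \<in> carrier R \<Longrightarrow> y \<in> carrier R \<Longrightarrow> h (x \<oplus> y) = h x \<oplus> h y"
  shows "h x \<in> add_span (h ` Z)"
  using assms(1)
proof induction
  case (step z x)
  have "h (z \<oplus> x) = h z \<oplus> h x"
    using step assms add_span_closed by (intro assms(4)) auto
  then show ?case using step by (auto intro: add_span.step)
qed (simp add: assms add_span.zero)

lemma add_span_mult:
  assumes x: "x \<in> add_span U" and y: "y \<in> add_span V"
    and U: "U \<subseteq> carrier R" and V: "V \<subseteq> carrier R"
  shows "x \<otimes> y \<in> add_span {a \<otimes> b | a b. a \<in> U \<and> b \<in> V}" (is "_ \<in> add_span ?Z")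
proof -
  have Z: "?Z \<subseteq> carrier R" using U V by auto
  have yc: "y \<in> carrier R" using add_span_closed[OF y V] .
  have "a \<otimes> y \<in> add_span ?Z" if a: "a \<in> U" for a
  proof -
    have "a \<in> carrier R" using a U by auto
    then have "a \<otimes> y \<in> add_span ((\<lambda>b. a \<otimes> b) ` V)"
      by (intro add_span_additive_image[OF y V]) (auto simp: r_distr)
    then show ?thesis by (rule add_span_mono) (use a in auto)
  qed
  moreover have "x \<otimes> y \<in> add_span ((\<lambda>a. a \<otimes> y) ` U)"
    by (intro add_span_additive_image[OF x U]) (use yc in \<open>auto simp: l_distr\<close>)
  ultimately show ?thesis
    using add_span_trans[OF _ _ Z] by blast
qed

section \<open>Equivalence of idempotents and block matrices\<close>

definition idempotent :: "'a \<Rightarrow> bool" where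
  "idempotent p \<longleftrightarrow> p \<in> carrier R \<and> p \<otimes> p = p"

text \<open>In an endomorphism ring, \<open>x\<close> restricts to an isomorphism from the image of
  \<open>p\<close> onto the image of \<open>q\<close>, with inverse \<open>y\<close>. The equations
  already force \<open>p\<close> and \<open>q\<close> to be idempotent.\<close>

definition idem_iso :: "'a \<Rightarrow> 'a \<Rightarrow> 'a \<Rightarrow> 'a \<Rightarrow> bool" where
  "idem_iso p q x y \<longleftrightarrow> x \<in> carrier R \<and> y \<in> carrier R \<and>
     q \<otimes> x = x \<and> x \<otimes> p = x \<and> p \<otimes> y = y \<and> y \<otimes> q = y \<and> x \<otimes> y = q \<and> y \<otimes> x = p"

lemma idem_iso_carrier:
  assumes "idem_iso p q x y"
  shows "x \<in> carrier R" "y \<in> carrier R" "p \<in> carrier R" "q \<in> carrier R"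
  using assms unfolding idem_iso_def by auto

lemma idem_iso_sym: "idem_iso p q x y \<Longrightarrow> idem_iso q p y x"
  unfolding idem_iso_def by auto

lemma idem_iso_refl: "idempotent p \<Longrightarrow> idem_iso p p p p"
  unfolding idem_iso_def idempotent_def by auto

lemma idem_iso_trans:
  assumes "idem_iso p q x y" and "idem_iso q r z w"
  shows "idem_iso p r (z \<otimes> x) (y \<otimes> w)"
proof -
  note c = idem_iso_carrier[OF assms(1)] idem_iso_carrier[OF assms(2)]
  note E = assms[unfolded idem_iso_def]
  have 1: "q \<otimes> x = x" "x \<otimes> p = x" "p \<otimes> y = y" "y \<otimes> q = y" "x \<otimes> y = q" "y \<otimes> x = p"
    and 2: "r \<otimes> z = z" "z \<otimes> q = z" "q \<otimes> w = w" "w \<otimes> r = w" "z \<otimes> w = r" "w \<otimes> z = q"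
    using E by auto
  note A = 1[THEN mult_assoc_eq] 2[THEN mult_assoc_eq]
  show ?thesis unfolding idem_iso_def
    using c by (simp add: m_assoc 1 2 A)
qed

definition orth :: "'a \<Rightarrow> 'a \<Rightarrow> bool" where
  "orth p q \<longleftrightarrow> p \<otimes> q = \<zero> \<and> q \<otimes> p = \<zero>"

lemma orth_sym: "orth p q \<Longrightarrow> orth q p"
  by (simp add: orth_def)

lemma idempotent_add:
  assumes "idempotent p" and "idempotent q" and "orth p q"
  shows "idempotent (p \<oplus> q)"
  using assms by (simp add: idempotent_def orth_def l_distr r_distr)

text \<open>Each product can be made to pass through \<open>p\<close> and \<open>p'\<close>, or
  through \<open>q\<close> and \<open>q'\<close>, which annihilate each other.\<close>

lemma idem_iso_orth_mult:
  assumes "idem_iso p q x y" and "idem_iso p' q' x' y'" and "orth p p'" and "orth q q'"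
  shows "x \<otimes> p' = \<zero>" "q' \<otimes> x = \<zero>" "x \<otimes> y' = \<zero>" "y \<otimes> x' = \<zero>" "p' \<otimes> y = \<zero>" "y \<otimes> q' = \<zero>"
proof -
  note c = idem_iso_carrier[OF assms(1)] idem_iso_carrier[OF assms(2)]
  have 1: "q \<otimes> x = x" "x \<otimes> p = x" "p \<otimes> y = y" "y \<otimes> q = y"
    and 2: "q' \<otimes> x' = x'" "p' \<otimes> y' = y'"
    using assms by (auto simp: idem_iso_def)
  have o: "p \<otimes> p' = \<zero>" "p' \<otimes> p = \<zero>" "q \<otimes> q' = \<zero>" "q' \<otimes> q = \<zero>"
    using assms by (auto simp: orth_def)
  show xp: "x \<otimes> p' = \<zero>" using m_assoc[of x p p'] c o 1 by simp
  show "q' \<otimes> x = \<zero>" using m_assoc[of q' q x] c o 1 by simp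
  show "p' \<otimes> y = \<zero>" using m_assoc[of p' p y] c o 1 by simp
  show yq: "y \<otimes> q' = \<zero>" using m_assoc[of y q q'] c o 1 by simp
  show "x \<otimes> y' = \<zero>" using m_assoc[of x p' y'] c xp 2 by simp
  show "y \<otimes> x' = \<zero>" using m_assoc[of y q' x'] c yq 2 by simp
qed

lemma idem_iso_add:
  assumes "idem_iso p q x y" and "idem_iso p' q' x' y'" and "orth p p'" and "orth q q'"
  shows "idem_iso (p \<oplus> p') (q \<oplus> q') (x \<oplus> x') (y \<oplus> y')"
proof -
  note c = idem_iso_carrier[OF assms(1)] idem_iso_carrier[OF assms(2)]
  note z = idem_iso_orth_mult[OF assms]
    idem_iso_orth_mult[OF assms(2,1) assms(3,4)[THEN orth_sym]]
  have 1: "q \<otimes> x = x" "x \<otimes> p = x" "p \<otimes> y = y" "y \<otimes> q = y" "x \<otimes> y = q" "y \<otimes> x = p"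
    and 2: "q' \<otimes> x' = x'" "x' \<otimes> p' = x'" "p' \<otimes> y' = y'" "y' \<otimes> q' = y'" "x' \<otimes> y' = q'" "y' \<otimes> x' = p'"
    using assms by (auto simp: idem_iso_def)
  show ?thesis unfolding idem_iso_def
    using c by (simp add: l_distr r_distr 1 2 z)
qed

text \<open>The inverse of the Schur complement of an invertible block is the complementary block of
  the inverse.\<close>

lemma idem_iso_complement:
  assumes p: "idempotent p" and q: "idempotent q" and r: "idempotent r" and s: "idempotent s"
    and pr: "orth p r" and qs: "orth q s"
    and iso: "idem_iso (p \<oplus> r) (q \<oplus> s) x y"
    and block: "idem_iso p q (q \<otimes> (x \<otimes> p)) a"
  shows "\<exists>u v. idem_iso r s u v"
proof -
  have c: "p \<in> carrier R" "q \<in> carrier R" "r \<in> carrier R" "s \<in> carrier R"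
      "x \<in> carrier R" "y \<in> carrier R" "a \<in> carrier R"
    using assms by (auto simp: idempotent_def idem_iso_def)
  have id: "p \<otimes> p = p" "q \<otimes> q = q" "r \<otimes> r = r" "s \<otimes> s = s"
    and o: "p \<otimes> r = \<zero>" "r \<otimes> p = \<zero>" "q \<otimes> s = \<zero>" "s \<otimes> q = \<zero>"
    using assms by (auto simp: idempotent_def orth_def)
  have xy: "x \<otimes> y = q \<oplus> s" "y \<otimes> x = p \<oplus> r" "(q \<oplus> s) \<otimes> x = x" "x \<otimes> (p \<oplus> r) = x"
    "(p \<oplus> r) \<otimes> y = y" "y \<otimes> (q \<oplus> s) = y"
    using iso by (auto simp: idem_iso_def)
  have a: "p \<otimes> a = a" "a \<otimes> q = a" "q \<otimes> (x \<otimes> p) \<otimes> a = q" "a \<otimes> (q \<otimes> (x \<otimes> p)) = p"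
    using block by (auto simp: idem_iso_def)
  \<comment> \<open>With respect to \<open>p \<oplus> r\<close> and \<open>q \<oplus> s\<close>, the
    blocks of \<open>x\<close> are \<open>aa\<close>, \<open>b\<close>, \<open>cc\<close> and
    \<open>d\<close>, while \<open>b'\<close>, \<open>c'\<close> and \<open>d'\<close> are three of
    the blocks of \<open>y\<close>.\<close>
  define d where "d = s \<otimes> (x \<otimes> r)"
  define cc where "cc = s \<otimes> (x \<otimes> p)"
  define b where "b = q \<otimes> (x \<otimes> r)"
  define d' where "d' = r \<otimes> (y \<otimes> s)"
  define aa where "aa = q \<otimes> (x \<otimes> p)"
  define b' where "b' = p \<otimes> (y \<otimes> s)"
  define c' where "c' = r \<otimes> (y \<otimes> q)"
  have carr [simp]: "d \<in> carrier R" "cc \<in> carrier R" "b \<in> carrier R" "d' \<in> carrier R"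
      "aa \<in> carrier R" "b' \<in> carrier R" "c' \<in> carrier R"
    using c by (auto simp: d_def cc_def b_def d'_def aa_def b'_def c'_def)
  note A = id[THEN mult_assoc_eq] o[THEN mult_assoc_eq]
  \<comment> \<open>Block multiplication: inserting \<open>p \<oplus> r\<close> between
    \<open>x\<close> and \<open>y\<close> splits the product into two terms.\<close>
  have split_left: "u \<otimes> (x \<otimes> p) \<otimes> (p \<otimes> (y \<otimes> v)) \<oplus> u \<otimes> (x \<otimes> r) \<otimes> (r \<otimes> (y \<otimes> v)) = u \<otimes> ((q \<oplus> s) \<otimes> v)"
    if "u \<in> carrier R" "v \<in> carrier R" for u v
  proof -
    have "u \<otimes> (x \<otimes> p) \<otimes> (p \<otimes> (y \<otimes> v)) \<oplus> u \<otimes> (x \<otimes> r) \<otimes> (r \<otimes> (y \<otimes> v))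
        = u \<otimes> (x \<otimes> (((p \<oplus> r) \<otimes> y) \<otimes> v))"
      using c that by (simp add: m_assoc A l_distr r_distr)
    also have "\<dots> = u \<otimes> ((q \<oplus> s) \<otimes> v)"
      unfolding xy(5) using c that by (simp add: xy(1)[THEN mult_assoc_eq])
    finally show ?thesis .
  qed
  have split_right: "u \<otimes> (y \<otimes> q) \<otimes> (q \<otimes> (x \<otimes> v)) \<oplus> u \<otimes> (y \<otimes> s) \<otimes> (s \<otimes> (x \<otimes> v)) = u \<otimes> ((p \<oplus> r) \<otimes> v)"
    if "u \<in> carrier R" "v \<in> carrier R" for u v
  proof -
    have "u \<otimes> (y \<otimes> q) \<otimes> (q \<otimes> (x \<otimes> v)) \<oplus> u \<otimes> (y \<otimes> s) \<otimes> (s \<otimes> (x \<otimes> v))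
        = u \<otimes> (y \<otimes> (((q \<oplus> s) \<otimes> x) \<otimes> v))"
      using c that by (simp add: m_assoc A l_distr r_distr)
    also have "\<dots> = u \<otimes> ((p \<oplus> r) \<otimes> v)"
      unfolding xy(3) using c that by (simp add: xy(2)[THEN mult_assoc_eq])
    finally show ?thesis .
  qed
  have 1: "aa \<otimes> b' \<oplus> b \<otimes> d' = \<zero>" "cc \<otimes> b' \<oplus> d \<otimes> d' = s"
    unfolding aa_def b'_def b_def d'_def cc_def d_def
    unfolding split_left[OF c(2,4)] split_left[OF c(4,4)] using c by (simp_all add: l_distr r_distr id o)
  have 2: "c' \<otimes> aa \<oplus> d' \<otimes> cc = \<zero>" "c' \<otimes> b \<oplus> d' \<otimes> d = r"
    unfolding aa_def b_def d'_def cc_def d_def c'_def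
    unfolding split_right[OF c(3,1)] split_right[OF c(3,3)] using c by (simp_all add: l_distr r_distr id o)
  have aaa: "aa \<otimes> a = q" "a \<otimes> aa = p" using a by (auto simp: aa_def)
  \<comment> \<open>The Schur complement of the block \<open>aa\<close> in \<open>x\<close>; its
    inverse will be \<open>d'\<close>.\<close>
  define u where "u = d \<ominus> cc \<otimes> (a \<otimes> b)"
  have bd: "b \<otimes> d' = \<ominus> (aa \<otimes> b')"
    using 1(1) c minus_equality[of "b \<otimes> d'" "aa \<otimes> b'"] by (simp add: a_comm)
  have dc: "d' \<otimes> cc = \<ominus> (c' \<otimes> aa)"
    using 2(1) c minus_equality[of "d' \<otimes> cc" "c' \<otimes> aa"] by (simp add: a_comm)
  have pb': "p \<otimes> b' = b'" unfolding b'_def using c by (simp add: A)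
  have qb: "q \<otimes> b = b" unfolding b_def using c by (simp add: A)
  \<comment> \<open>The off-diagonal block equation turns the correction term into
    \<open>cc \<otimes> b'\<close>, which completes \<open>d \<otimes> d'\<close> to
    \<open>s\<close>.\<close>
  have "u \<otimes> d' = d \<otimes> d' \<oplus> \<ominus> (cc \<otimes> (a \<otimes> (b \<otimes> d')))"
    unfolding u_def a_minus_def using c by (simp add: l_distr m_assoc l_minus)
  also have "cc \<otimes> (a \<otimes> (b \<otimes> d')) = \<ominus> (cc \<otimes> b')"
    unfolding bd using c by (simp add: r_minus aaa[THEN mult_assoc_eq] pb')
  finally have ud: "u \<otimes> d' = s" using 1(2) c by (simp add: a_comm)
  have "d' \<otimes> u = d' \<otimes> d \<oplus> \<ominus> ((d' \<otimes> cc) \<otimes> (a \<otimes> b))"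
    unfolding u_def a_minus_def using c by (simp add: r_distr m_assoc r_minus)
  also have "(d' \<otimes> cc) \<otimes> (a \<otimes> b) = \<ominus> (c' \<otimes> b)"
    unfolding dc using c by (simp add: l_minus m_assoc aaa[THEN mult_assoc_eq] qb)
  finally have du: "d' \<otimes> u = r" using 2(2) c by (simp add: a_comm)
  have "idem_iso r s u d'"
    unfolding idem_iso_def
  proof (intro conjI ud du)
    show "s \<otimes> u = u" "u \<otimes> r = u"
      unfolding u_def a_minus_def d_def cc_def b_def
      using c by (simp_all add: l_distr r_distr r_minus l_minus m_assoc id A)
    show "r \<otimes> d' = d'" "d' \<otimes> s = d'"
      unfolding d'_def using c by (simp_all add: m_assoc id A)
  qed (use c in \<open>auto simp: u_def\<close>)
  then show ?thesis by blast
qed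

section \<open>Corners of centralizers\<close>

definition in_corner :: "'a \<Rightarrow> 'a set \<Rightarrow> 'a \<Rightarrow> bool" where
  "in_corner e S x \<longleftrightarrow> x \<in> carrier R \<and> e \<otimes> x = x \<and> x \<otimes> e = x \<and> (\<forall>s\<in>S. x \<otimes> s = s \<otimes> x)"

definition corner_unit :: "'a \<Rightarrow> 'a set \<Rightarrow> 'a \<Rightarrow> bool" where
  "corner_unit e S x \<longleftrightarrow> (\<exists>z. in_corner e S z \<and> x \<otimes> z = e \<and> z \<otimes> x = e)"

text \<open>Primitivity in the centralizer of \<open>S\<close>, to which \<open>e\<close> itself
  must belong; \<open>S = {}\<close> gives primitivity in the whole ring. Corners are predicates and
  not rings of their own, so that their elements can be multiplied by anything in
  \<open>R\<close>.\<close>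

definition primitive_idempotent :: "'a set \<Rightarrow> 'a \<Rightarrow> bool" where
  "primitive_idempotent S e \<longleftrightarrow> idempotent e \<and> in_corner e S e \<and> e \<noteq> \<zero> \<and>
     (\<forall>h. idempotent h \<and> in_corner e S h \<longrightarrow> h = \<zero> \<or> h = e)"

lemma mult_commute_mult:
  assumes "x \<otimes> s = s \<otimes> x" and "y \<otimes> s = s \<otimes> y"
    and "x \<in> carrier R" and "y \<in> carrier R" and "s \<in> carrier R"
  shows "x \<otimes> y \<otimes> s = s \<otimes> (x \<otimes> y)"
proof -
  have "x \<otimes> y \<otimes> s = x \<otimes> s \<otimes> y" using assms(2-) by (simp add: m_assoc)
  then show ?thesis unfolding assms(1) using assms(3-) by (simp add: m_assoc)
qed

lemma in_corner_carrier: "in_corner e S x \<Longrightarrow> x \<in> carrier R"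
  by (simp add: in_corner_def)

lemma in_corner_mult:
  assumes "in_corner e S x" and "in_corner e S y" and "e \<in> carrier R" and "S \<subseteq> carrier R"
  shows "in_corner e S (x \<otimes> y)"
proof -
  have c: "x \<in> carrier R" "y \<in> carrier R" "e \<otimes> x = x" "y \<otimes> e = y"
    using assms by (auto simp: in_corner_def)
  have "x \<otimes> y \<otimes> s = s \<otimes> (x \<otimes> y)" if s: "s \<in> S" for s
  proof -
    have sc: "s \<in> carrier R" and e: "x \<otimes> s = s \<otimes> x" "y \<otimes> s = s \<otimes> y"
      using s assms by (auto simp: in_corner_def)
    show ?thesis by (rule mult_commute_mult[OF e c(1,2) sc])
  qed
  then show ?thesis
    using c assms(3) by (simp add: in_corner_def m_assoc c(3)[THEN mult_assoc_eq])
qed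

lemma in_corner_add:
  assumes "in_corner e S x" and "in_corner e S y" and "e \<in> carrier R" and "S \<subseteq> carrier R"
  shows "in_corner e S (x \<oplus> y)"
  using assms by (auto simp: in_corner_def l_distr r_distr subset_iff)

lemma corner_unit_mult:
  assumes "in_corner e S x" "in_corner e S y" "corner_unit e S x" "corner_unit e S y"
    and "e \<in> carrier R" and "S \<subseteq> carrier R"
  shows "corner_unit e S (x \<otimes> y)"
proof -
  obtain u v where u: "in_corner e S u" "x \<otimes> u = e" "u \<otimes> x = e"
    and v: "in_corner e S v" "y \<otimes> v = e" "v \<otimes> y = e"
    using assms by (auto simp: corner_unit_def)
  have c: "x \<in> carrier R" "y \<in> carrier R" "u \<in> carrier R" "v \<in> carrier R"
    and e: "e \<otimes> y = y" "e \<otimes> u = u"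
    using assms u v by (auto simp: in_corner_def)
  have "x \<otimes> y \<otimes> (v \<otimes> u) = e"
    using c assms(5) by (simp add: m_assoc v(2)[THEN mult_assoc_eq] e u)
  moreover have "v \<otimes> u \<otimes> (x \<otimes> y) = e"
    using c assms(5) by (simp add: m_assoc u(3)[THEN mult_assoc_eq] e v)
  ultimately show ?thesis
    using in_corner_mult[OF v(1) u(1) assms(5,6)] by (auto simp: corner_unit_def)
qed

end

text \<open>Strong \<open>\<pi>\<close>-regularity, with \<open>y\<close> in the double centralizer of \<open>x\<close>, so that it passes to
  centralizers.\<close>

locale fitting_ring = ring R for R (structure) +
  fixes rank :: "'a \<Rightarrow> nat"
  assumes fitting: "x \<in> carrier R \<Longrightarrow> \<exists>y\<in>carrier R. \<exists>n. x [^] Suc n = x [^] Suc (Suc n) \<otimes> y \<and>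
      (\<forall>z\<in>carrier R. z \<otimes> x = x \<otimes> z \<longrightarrow> z \<otimes> y = y \<otimes> z)"
    and rank_less: "\<lbrakk>idempotent p; idempotent q; q \<otimes> p = p; p \<otimes> q = p; p \<noteq> q\<rbrakk> \<Longrightarrow> rank p < rank q"
begin

text \<open>Fitting's dichotomy. Strong regularity attaches to \<open>x\<close> the idempotent
  \<open>(x \<otimes> y) [^] Suc n\<close>, which by the double centralizer condition lies in the
  same corner. Primitivity leaves only zero, making \<open>x\<close> nilpotent, or \<open>e\<close>,
  making it invertible.\<close>

lemma corner_nilpotent_or_unit:
  assumes e: "primitive_idempotent S e" and S: "S \<subseteq> carrier R" and x: "in_corner e S x"
  shows "(\<exists>n. x [^] (n::nat) = \<zero>) \<or> corner_unit e S x"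
proof -
  have xc: "x \<in> carrier R" and ec: "e \<in> carrier R" and ex: "e \<otimes> x = x" "x \<otimes> e = x" and ee: "e \<otimes> e = e"
    using e x by (auto simp: in_corner_def primitive_idempotent_def idempotent_def)
  have Sx: "s \<otimes> x = x \<otimes> s" "s \<otimes> e = e \<otimes> s" "s \<in> carrier R" if "s \<in> S" for s
    using e x S that by (auto simp: in_corner_def primitive_idempotent_def)
  obtain y n where yc: "y \<in> carrier R" and y: "x [^] Suc n = x [^] Suc (Suc n) \<otimes> y"
    and comm: "\<And>z. z \<in> carrier R \<Longrightarrow> z \<otimes> x = x \<otimes> z \<Longrightarrow> z \<otimes> y = y \<otimes> z"
    using fitting[OF xc] by blast
  have xy: "x \<otimes> y = y \<otimes> x" and ey: "e \<otimes> y = y \<otimes> e"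
    using comm xc ec ex by auto
  define w where "w = x \<otimes> y"
  have wc: "w \<in> carrier R" using xc yc by (simp add: w_def)
  have ew: "e \<otimes> w = w" unfolding w_def using ex(1)[THEN mult_assoc_eq] xc yc ec by simp
  have we: "w \<otimes> e = w"
    using ex(2)[THEN mult_assoc_eq, of y] xc yc ec by (simp add: w_def m_assoc ey[symmetric])
  have wx: "w \<otimes> x = x \<otimes> w"
    unfolding w_def by (simp add: m_assoc xc yc) (simp add: xy)
  have wy: "w \<otimes> y = y \<otimes> w"
    unfolding w_def by (simp add: m_assoc[symmetric] xc yc) (simp add: xy)
  have Sw: "s \<otimes> w = w \<otimes> s" if "s \<in> S" for s
  proof -
    have sx: "s \<otimes> x = x \<otimes> s" and sy: "s \<otimes> y = y \<otimes> s" and sc: "s \<in> carrier R"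
      using Sx[OF that] comm[of s] by auto
    show ?thesis unfolding w_def by (rule mult_commute_mult[symmetric]) (use sx sy sc xc yc in auto)
  qed
  \<comment> \<open>The exponent \<open>Suc n\<close> makes \<open>f\<close> a multiple of
    \<open>x [^] Suc n\<close>, which absorbs all powers of \<open>w\<close>; this is why
    \<open>f\<close> is idempotent.\<close>
  define f where "f = w [^] Suc n"
  have fc: "f \<in> carrier R" using wc by (simp add: f_def)
  have xw: "x [^] Suc n \<otimes> w = x [^] Suc n"
    unfolding w_def using m_assoc[of "x [^] Suc n" x y] xc yc y by simp
  have xwk: "x [^] Suc n \<otimes> w [^] k = x [^] Suc n" for k :: nat
  proof (induction k)
    case (Suc k)
    have "x [^] Suc n \<otimes> w [^] Suc k = x [^] Suc n \<otimes> w [^] k \<otimes> w"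
      using xc wc by (simp add: m_assoc)
    then show ?case using Suc xw by simp
  qed (use xc in simp)
  have f_eq: "f = x [^] Suc n \<otimes> y [^] Suc n"
    unfolding f_def w_def by (rule pow_mult_distrib[OF xy xc yc])
  have fx: "f \<otimes> x [^] Suc n = x [^] Suc n \<otimes> f"
    unfolding f_def
    using group_commutes_pow[OF group_commutes_pow[OF wx wc xc, symmetric], of "Suc n" "Suc n"] wc xc by simp
  have ff: "f \<otimes> f = f"
  proof -
    have "f \<otimes> f = f \<otimes> x [^] Suc n \<otimes> y [^] Suc n"
      using fc xc yc m_assoc[of f "x [^] Suc n" "y [^] Suc n"] f_eq by simp
    also have "f \<otimes> x [^] Suc n = x [^] Suc n" unfolding fx unfolding f_def by (rule xwk)
    finally show ?thesis using f_eq by simp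
  qed
  have ewn: "e \<otimes> w [^] k = w [^] k \<otimes> e" for k :: nat
    using group_commutes_pow[of w e k] ew we wc ec by simp
  have fe: "e \<otimes> f = f" "f \<otimes> e = f"
  proof -
    show "f \<otimes> e = f" unfolding f_def using wc ec we by (simp add: m_assoc)
    then show "e \<otimes> f = f" using ewn[of "Suc n"] by (simp add: f_def)
  qed
  have "f \<otimes> s = s \<otimes> f" if "s \<in> S" for s
    unfolding f_def by (rule group_commutes_pow) (use Sw Sx wc that in auto)
  then have corner_f: "in_corner e S f"
    using fc fe by (simp add: in_corner_def)
  have "f = \<zero> \<or> f = e"
    using e ff fc corner_f by (auto simp: primitive_idempotent_def idempotent_def)
  then show ?thesis
  proof
    assume "f = \<zero>"
    then have "x [^] Suc n = \<zero>" using xwk[of "Suc n"] xc by (simp add: f_def)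
    then show ?thesis by blast
  next
    assume f: "f = e"
    \<comment> \<open>Since \<open>e = w [^] Suc n\<close> is \<open>x\<close> times
      \<open>y \<otimes> w [^] n\<close>, the second factor inverts \<open>x\<close> once it is cut
      down to the corner by \<open>e\<close>.\<close>
    define z where "z = e \<otimes> (y \<otimes> w [^] n)"
    have zc: "z \<in> carrier R" using ec yc wc by (simp add: z_def)
    have ynw: "y \<otimes> w [^] n = w [^] n \<otimes> y" using group_commutes_pow[of w y n] wy wc yc by simp
    have xnw: "x \<otimes> w [^] n = w [^] n \<otimes> x" using group_commutes_pow[of w x n] wx wc xc by simp
    have yw: "y \<otimes> x \<otimes> w [^] n = e"
      using f f_def xy wc xc yc w_def nat_pow_Suc2 by simp
    have "z \<otimes> x = e \<otimes> (y \<otimes> x \<otimes> w [^] n)"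
      unfolding z_def using ec yc wc xc xnw by (simp add: m_assoc)
    then have zx: "z \<otimes> x = e" using yw ee by simp
    have "x \<otimes> z = (x \<otimes> e) \<otimes> (y \<otimes> w [^] n)"
      unfolding z_def using ec yc wc xc by (simp add: m_assoc)
    also have "\<dots> = y \<otimes> x \<otimes> w [^] n" unfolding ex using xy xc yc wc by (simp add: m_assoc[symmetric])
    finally have xz: "x \<otimes> z = e" using yw by simp
    have ez: "e \<otimes> z = z" unfolding z_def using ec yc wc ee[THEN mult_assoc_eq] by simp
    have ze: "z \<otimes> e = z"
    proof -
      have "z \<otimes> e = e \<otimes> (y \<otimes> (w [^] n \<otimes> e))" unfolding z_def using ec yc wc by (simp add: m_assoc)
      also have "\<dots> = e \<otimes> (y \<otimes> e \<otimes> w [^] n)" using ewn[of n] ec yc wc by (simp add: m_assoc)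
      also have "\<dots> = e \<otimes> (e \<otimes> (y \<otimes> w [^] n))" using ey[symmetric] ec yc wc by (simp add: m_assoc)
      also have "\<dots> = z" using ez by (simp add: z_def)
      finally show ?thesis .
    qed
    have "z \<otimes> s = s \<otimes> z" if s: "s \<in> S" for s
    proof -
      have 1: "y \<otimes> s = s \<otimes> y" using comm[of s] Sx[OF s] by simp
      have 2: "w [^] n \<otimes> s = s \<otimes> w [^] n"
        using group_commutes_pow[of w s n] Sw[OF s] wc Sx[OF s] by simp
      have 3: "e \<otimes> s = s \<otimes> e" using Sx[OF s] by simp
      have sc: "s \<in> carrier R" using Sx[OF s] by simp
      have "z \<otimes> s = e \<otimes> (y \<otimes> (w [^] n \<otimes> s))" unfolding z_def using ec yc wc sc by (simp add: m_assoc)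
      also have "\<dots> = e \<otimes> ((y \<otimes> s) \<otimes> w [^] n)" unfolding 2 using ec yc wc sc by (simp add: m_assoc)
      also have "\<dots> = (e \<otimes> s) \<otimes> (y \<otimes> w [^] n)" unfolding 1 using ec yc wc sc by (simp add: m_assoc)
      also have "\<dots> = s \<otimes> z" unfolding 3 z_def using ec yc wc sc by (simp add: m_assoc)
      finally show ?thesis .
    qed
    then have "in_corner e S z" using zc ez ze by (simp add: in_corner_def)
    then show ?thesis using zx xz by (auto simp: corner_unit_def)
  qed
qed

text \<open>By the dichotomy, failure would make both summands nilpotent. The last nonzero
  \<open>e \<otimes> y [^] j\<close> would be killed by \<open>y\<close>, hence fixed by
  \<open>x\<close>, contradicting the nilpotency of \<open>x\<close>.\<close>

lemma corner_local:
  assumes e: "primitive_idempotent S e" and S: "S \<subseteq> carrier R"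
    and x: "in_corner e S x" and y: "in_corner e S y" and xy: "x \<oplus> y = e"
  shows "corner_unit e S x \<or> corner_unit e S y"
proof (rule ccontr)
  assume "\<not> ?thesis"
  then obtain n m :: nat where n: "x [^] n = \<zero>" and m: "y [^] m = \<zero>"
    using corner_nilpotent_or_unit[OF e S] x y by blast
  have c: "x \<in> carrier R" "y \<in> carrier R" "e \<in> carrier R" and e0: "e \<noteq> \<zero>" "e \<otimes> e = e"
    and ey: "e \<otimes> y = y" "y \<otimes> e = y"
    using e x y by (auto simp: primitive_idempotent_def idempotent_def in_corner_def)
  have "e \<otimes> y [^] j \<noteq> \<zero>" for j :: nat
  proof (induction j)
    case (Suc j)
    define v where "v = e \<otimes> y [^] j"
    have vc: "v \<in> carrier R" "e \<otimes> v = v" using c e0(2)[THEN mult_assoc_eq] by (auto simp: v_def)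
    show ?case
    proof
      assume "e \<otimes> y [^] Suc j = \<zero>"
      have "y \<otimes> v = y \<otimes> e \<otimes> y [^] j" using c by (simp add: v_def m_assoc)
      also have "\<dots> = e \<otimes> y \<otimes> y [^] j" by (simp add: ey)
      also have "\<dots> = \<zero>" using \<open>e \<otimes> y [^] Suc j = \<zero>\<close> c nat_pow_Suc2[of y j] by (simp add: m_assoc)
      finally have yv: "y \<otimes> v = \<zero>" .
      have "(x \<oplus> y) \<otimes> v = x \<otimes> v" using c vc yv by (simp add: l_distr)
      then have xv: "x \<otimes> v = v" using vc xy by simp
      have "x [^] i \<otimes> v = v" for i :: nat
        by (induction i) (use c vc xv in \<open>simp_all add: m_assoc\<close>)
      then have "v = \<zero>" using n vc by (metis l_null)
      then show False using Suc by (simp add: v_def)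
    qed
  qed (use c e0 in simp)
  then show False using m c by (metis r_null)
qed

text \<open>Dividing by the unit \<open>x \<oplus> y\<close> reduces this to summands of
  \<open>e\<close>; multiplying back by the unit preserves invertibility.\<close>

lemma corner_unit_summand:
  assumes e: "primitive_idempotent S e" and S: "S \<subseteq> carrier R"
    and x: "in_corner e S x" and y: "in_corner e S y" and u: "corner_unit e S (x \<oplus> y)"
  shows "corner_unit e S x \<or> corner_unit e S y"
proof -
  have c: "x \<in> carrier R" "y \<in> carrier R" "e \<in> carrier R"
    using e x y by (auto simp: primitive_idempotent_def in_corner_def)
  obtain z where z: "in_corner e S z" "(x \<oplus> y) \<otimes> z = e" "z \<otimes> (x \<oplus> y) = e"
    using u by (auto simp: corner_unit_def)
  have zc: "z \<in> carrier R" using z by (simp add: in_corner_def)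
  have xyc: "in_corner e S (x \<oplus> y)" by (rule in_corner_add[OF x y c(3) S])
  have transfer: "corner_unit e S t" if t: "in_corner e S t" "corner_unit e S (z \<otimes> t)" for t
  proof -
    have tc: "t \<in> carrier R" "e \<otimes> t = t" using t by (simp_all add: in_corner_def)
    have "(x \<oplus> y) \<otimes> (z \<otimes> t) = t"
      using z(2)[THEN mult_assoc_eq, of t] c zc tc by simp
    moreover have "corner_unit e S ((x \<oplus> y) \<otimes> (z \<otimes> t))"
      by (rule corner_unit_mult[OF xyc in_corner_mult[OF z(1) t(1) c(3) S] u t(2) c(3) S])
    ultimately show ?thesis by simp
  qed
  have "z \<otimes> x \<oplus> z \<otimes> y = e" using z zc c by (simp add: r_distr)
  then have "corner_unit e S (z \<otimes> x) \<or> corner_unit e S (z \<otimes> y)"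
    using corner_local[OF e S in_corner_mult[OF z(1) x c(3) S] in_corner_mult[OF z(1) y c(3) S]] by blast
  then show ?thesis using transfer x y by blast
qed

lemma corner_unit_add_span:
  assumes e: "primitive_idempotent S e" and S: "S \<subseteq> carrier R"
    and Z: "\<And>z. z \<in> Z \<Longrightarrow> in_corner e S z"
    and x: "x \<in> add_span Z" and u: "corner_unit e S x"
  shows "\<exists>z\<in>Z. corner_unit e S z"
proof -
  have ec: "e \<in> carrier R" and e0: "e \<noteq> \<zero>"
    using e by (auto simp: primitive_idempotent_def in_corner_def)
  have sp: "in_corner e S y" if "y \<in> add_span Z" for y
    using that
  proof induction
    case zero
    then show ?case using S ec by (auto simp: in_corner_def subset_iff)
  next
    case (step z x)
    then show ?case using Z in_corner_add[OF _ _ ec S] by blast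
  qed
  show ?thesis
    using x u
  proof induction
    case zero
    then obtain z where "in_corner e S z" "\<zero> \<otimes> z = e" by (auto simp: corner_unit_def)
    then show ?case using e0 in_corner_carrier by simp
  next
    case (step z x)
    then show ?case using corner_unit_summand[OF e S Z sp] by blast
  qed
qed

end

section \<open>Splitting idempotents and cancelling equivalent ones\<close>

context ring
begin

lemma idempotent_split:
  assumes p: "idempotent p" and h: "idempotent h" and hp: "in_corner p {} h"
  shows "idempotent (p \<ominus> h)" "in_corner p {} (p \<ominus> h)" "orth h (p \<ominus> h)" "h \<oplus> (p \<ominus> h) = p"
proof -
  have c: "p \<in> carrier R" "h \<in> carrier R" "p \<otimes> p = p" "h \<otimes> h = h" "p \<otimes> h = h" "h \<otimes> p = h"
    using assms by (auto simp: idempotent_def in_corner_def)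
  show "in_corner p {} (p \<ominus> h)"
    using c by (simp add: in_corner_def a_minus_def l_distr r_distr l_minus r_minus)
  show "orth h (p \<ominus> h)"
    using c by (simp add: orth_def a_minus_def l_distr r_distr l_minus r_minus r_neg)
  show "h \<oplus> (p \<ominus> h) = p"
    using c by (simp add: a_minus_def a_lcomm[of h p] r_neg)
  show "idempotent (p \<ominus> h)"
    using c by (simp add: idempotent_def a_minus_def l_distr r_distr l_minus r_minus r_neg)
qed

lemma orth_corner:
  assumes "orth p r" and "in_corner p {} h" and "p \<in> carrier R" and "r \<in> carrier R"
  shows "orth h r"
proof -
  have c: "h \<in> carrier R" "p \<otimes> h = h" "h \<otimes> p = h" and o: "p \<otimes> r = \<zero>" "r \<otimes> p = \<zero>"
    using assms by (auto simp: orth_def in_corner_def)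
  have "h \<otimes> r = h \<otimes> (p \<otimes> r)" using c(3)[THEN mult_assoc_eq] c assms by simp
  moreover have "r \<otimes> h = r \<otimes> p \<otimes> h" using c assms by (simp add: m_assoc)
  ultimately show ?thesis using o c by (simp add: orth_def)
qed

lemma orth_add:
  assumes "orth p q" and "orth p r" and "p \<in> carrier R" and "q \<in> carrier R" and "r \<in> carrier R"
  shows "orth p (q \<oplus> r)"
  using assms by (simp add: orth_def l_distr r_distr)

text \<open>Conjugation by the equivalence, used to split \<open>q\<close> in the same way as
  \<open>p\<close>.\<close>

lemma idem_iso_corner:
  assumes iso: "idem_iso p q u v" and h: "idempotent h" and hp: "in_corner p {} h"
  shows "idem_iso h (u \<otimes> h \<otimes> v) (u \<otimes> h) (h \<otimes> v)"
    and "idempotent (u \<otimes> h \<otimes> v)" and "in_corner q {} (u \<otimes> h \<otimes> v)"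
proof -
  note c = idem_iso_carrier[OF iso]
  have e: "q \<otimes> u = u" "u \<otimes> p = u" "p \<otimes> v = v" "v \<otimes> q = v" "u \<otimes> v = q" "v \<otimes> u = p"
    using iso by (auto simp: idem_iso_def)
  have hc: "h \<in> carrier R" "h \<otimes> h = h" "p \<otimes> h = h" "h \<otimes> p = h"
    using h hp by (auto simp: idempotent_def in_corner_def)
  note A = e[THEN mult_assoc_eq] hc(2-4)[THEN mult_assoc_eq]
  show "idem_iso h (u \<otimes> h \<otimes> v) (u \<otimes> h) (h \<otimes> v)"
    unfolding idem_iso_def using c hc by (simp add: m_assoc e A)
  show "idempotent (u \<otimes> h \<otimes> v)"
    unfolding idempotent_def using c hc by (simp add: m_assoc e A)
  show "in_corner q {} (u \<otimes> h \<otimes> v)"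
    unfolding in_corner_def using c hc by (simp add: m_assoc e A)
qed

end

context fitting_ring
begin

text \<open>A left inverse anywhere in \<open>R\<close> suffices: multiplication by \<open>l\<close>
  on the left lowers the power of \<open>t\<close> by one, so no power can vanish and the dichotomy
  applies.\<close>

lemma corner_left_inverse_unit:
  assumes e: "primitive_idempotent S e" and S: "S \<subseteq> carrier R"
    and t: "in_corner e S t" and l: "l \<in> carrier R" and lt: "l \<otimes> t = e"
  shows "corner_unit e S t"
proof (rule ccontr)
  assume "\<not> ?thesis"
  then obtain n :: nat where n: "t [^] n = \<zero>"
    using corner_nilpotent_or_unit[OF e S t] by blast
  have c: "t \<in> carrier R" "e \<in> carrier R" "e \<noteq> \<zero>" "e \<otimes> t = t"
    using e t by (auto simp: primitive_idempotent_def idempotent_def in_corner_def)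
  have "e \<otimes> t [^] j \<noteq> \<zero>" for j :: nat
  proof (induction j)
    case (Suc j)
    have "l \<otimes> (e \<otimes> t [^] Suc j) = l \<otimes> (e \<otimes> t \<otimes> t [^] j)"
      using c nat_pow_Suc2[of t j] c(4)[THEN mult_assoc_eq] by (simp add: m_assoc)
    also have "\<dots> = e \<otimes> t [^] j"
      using c l lt[THEN mult_assoc_eq] by simp
    finally show ?case using Suc l by auto
  qed (use c in simp)
  then show False using n c by (metis r_null)
qed

text \<open>If \<open>p\<close> splits properly, its two parts have smaller rank and are cancelled
  one after the other. If \<open>p\<close> is primitive, its corner is local and an exchange
  argument applies.\<close>

lemma idem_iso_cancel:
  assumes "idempotent p" "idempotent q" "idempotent r" "idempotent s" "orth p r" "orth q s"
    and "idem_iso p q u v" and "idem_iso (p \<oplus> r) (q \<oplus> s) x y"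
  shows "\<exists>x' y'. idem_iso r s x' y'"
  using assms
proof (induction "rank p" arbitrary: p q r s u v x y rule: less_induct)
  case less
  note id = less.prems(1-4) and pr = less.prems(5) and qs = less.prems(6)
    and uv = less.prems(7) and xy = less.prems(8)
  have c: "p \<in> carrier R" "q \<in> carrier R" "r \<in> carrier R" "s \<in> carrier R"
      "u \<in> carrier R" "v \<in> carrier R" "x \<in> carrier R" "y \<in> carrier R"
    using id idem_iso_carrier[OF uv] idem_iso_carrier[OF xy] by (auto simp: idempotent_def)
  have e: "q \<otimes> u = u" "u \<otimes> p = u" "p \<otimes> v = v" "v \<otimes> q = v" "u \<otimes> v = q" "v \<otimes> u = p"
    using uv by (auto simp: idem_iso_def)
  have i: "p \<otimes> p = p" "q \<otimes> q = q" "s \<otimes> s = s"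
    using id by (auto simp: idempotent_def)
  consider "p = \<zero>" | h where "idempotent h" "in_corner p {} h" "h \<noteq> \<zero>" "h \<noteq> p" | "primitive_idempotent {} p"
  proof -
    have "in_corner p {} p" using c i by (simp add: in_corner_def)
    then show ?thesis using id(1) that unfolding primitive_idempotent_def by blast
  qed
  then show ?case
  proof cases
    case 1
    then have "u = \<zero>" using e(2) c by simp
    then have "q = \<zero>" using e(5) c by simp
    then show ?thesis using xy 1 c by auto
  next
    case (2 h)
    define q' where "q' = u \<otimes> h \<otimes> v"
    define h2 where "h2 = p \<ominus> h"
    define q2 where "q2 = q \<ominus> q'"
    note H = idempotent_split[OF id(1) 2(1,2), folded h2_def]
    note I = idem_iso_corner[OF uv 2(1,2), folded q'_def]
    note Q = idempotent_split[OF id(2) I(2,3), folded q2_def]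
    have hc: "h \<in> carrier R" "h2 \<in> carrier R" "q' \<in> carrier R" "q2 \<in> carrier R"
      using 2 H I Q by (auto simp: idempotent_def)
    have "u \<otimes> h2 \<otimes> v = q2"
      unfolding h2_def q2_def q'_def a_minus_def
      using c hc e by (simp add: l_distr r_distr l_minus r_minus)
    then have I2: "idem_iso h2 q2 (u \<otimes> h2) (h2 \<otimes> v)"
      using idem_iso_corner(1)[OF uv H(1,2)] by simp
    have h0: "rank h < rank p"
      using 2 id by (intro rank_less) (auto simp: in_corner_def)
    have "h2 \<noteq> p"
    proof
      assume "h2 = p"
      then have "h \<otimes> p = \<zero>" using H(3) by (simp add: orth_def)
      then show False using 2 by (simp add: in_corner_def)
    qed
    then have h20: "rank h2 < rank p"
      using H id by (intro rank_less) (auto simp: in_corner_def)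
    have o: "orth h r" "orth h2 r" "orth q' s" "orth q2 s"
      using orth_corner pr qs c 2 H I Q by blast+
    \<comment> \<open>Regrouping makes \<open>h2 \<oplus> r\<close> the complement of
      \<open>h\<close>; in the equivalence obtained by cancelling \<open>h\<close>, the part
      \<open>h2\<close> is cancelled next.\<close>
    have "\<exists>x' y'. idem_iso (h2 \<oplus> r) (q2 \<oplus> s) x' y'"
    proof (rule less.hyps[OF h0 2(1) I(2) _ _ _ _ I(1)])
      show "idempotent (h2 \<oplus> r)" "idempotent (q2 \<oplus> s)"
        using idempotent_add H Q o id by auto
      show "orth h (h2 \<oplus> r)" "orth q' (q2 \<oplus> s)"
        using orth_add H Q o hc c by auto
      show "idem_iso (h \<oplus> (h2 \<oplus> r)) (q' \<oplus> (q2 \<oplus> s)) x y"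
        using xy hc c H(4) Q(4) by (simp add: a_assoc[symmetric])
    qed
    then show ?thesis
      using less.hyps[OF h20 H(1) Q(1) id(3,4) o(2,4) I2] by blast
  next
    case 3
    define a where "a = q \<otimes> (x \<otimes> p)"
    define d where "d = s \<otimes> (x \<otimes> p)"
    define a' where "a' = p \<otimes> (y \<otimes> q)"
    define d' where "d' = p \<otimes> (y \<otimes> s)"
    have ac: "a \<in> carrier R" "d \<in> carrier R" "a' \<in> carrier R" "d' \<in> carrier R"
      using c by (auto simp: a_def d_def a'_def d'_def)
    note A = i[THEN mult_assoc_eq]
    have sides: "q \<otimes> a = a" "a \<otimes> p = a" "p \<otimes> a' = a'" "a' \<otimes> q = a'"
        "s \<otimes> d = d" "d \<otimes> p = d" "p \<otimes> d' = d'" "d' \<otimes> s = d'"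
      using c by (simp_all add: a_def d_def a'_def d'_def m_assoc A i)
    note S = sides[THEN mult_assoc_eq]
    \<comment> \<open>The block of \<open>y \<otimes> x = p \<oplus> r\<close> from \<open>p\<close>
      to \<open>p\<close>, computed by passing through \<open>q \<oplus> s\<close>.\<close>
    have "a' \<otimes> a \<oplus> d' \<otimes> d = p"
    proof -
      have "a' \<otimes> a \<oplus> d' \<otimes> d = p \<otimes> (y \<otimes> ((q \<oplus> s) \<otimes> x \<otimes> p))"
        using c by (simp add: a_def d_def a'_def d'_def m_assoc A l_distr r_distr)
      also have "(q \<oplus> s) \<otimes> x = x" using xy by (simp add: idem_iso_def)
      also have "p \<otimes> (y \<otimes> (x \<otimes> p)) = p \<otimes> ((p \<oplus> r) \<otimes> p)"
        using xy c by (simp add: idem_iso_def mult_assoc_eq[of y x "p \<oplus> r" p])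
      also have "\<dots> = p" using c i pr by (simp add: orth_def l_distr r_distr)
      finally show ?thesis .
    qed
    moreover have "in_corner p {} (a' \<otimes> a)" "in_corner p {} (d' \<otimes> d)"
      using ac c by (simp_all add: in_corner_def m_assoc sides S)
    txt \<open>If \<open>a' a\<close> is invertible, the block \<open>a\<close> has a Schur complement; otherwise \<open>d\<close> identifies \<open>p\<close>
      with a summand \<open>s'\<close> of \<open>s\<close>, which exchanges places with \<open>q\<close>.\<close>
    ultimately have "corner_unit p {} (a' \<otimes> a) \<or> corner_unit p {} (d' \<otimes> d)"
      using corner_local[OF 3] by blast
    then show ?thesis
    proof
      assume "corner_unit p {} (a' \<otimes> a)"
      then obtain z where z: "z \<in> carrier R" "z \<otimes> (a' \<otimes> a) = p"
        by (auto simp: corner_unit_def in_corner_def)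
      \<comment> \<open>The block \<open>a\<close> goes from \<open>p\<close> to \<open>q\<close>;
        composed with \<open>v\<close> it returns to the local corner at \<open>p\<close>, where a
        left inverse makes it invertible.\<close>
      have t: "in_corner p {} (v \<otimes> a)"
        using ac c e[THEN mult_assoc_eq] by (simp add: in_corner_def m_assoc sides S)
      have "z \<otimes> (a' \<otimes> u) \<otimes> (v \<otimes> a) = p"
        using ac c z e[THEN mult_assoc_eq] by (simp add: m_assoc sides S)
      then have "corner_unit p {} (v \<otimes> a)"
        using corner_left_inverse_unit[OF 3 _ t, of "z \<otimes> (a' \<otimes> u)"] z(1) ac c by simp
      then obtain w where w: "w \<in> carrier R" "p \<otimes> w = w" "w \<otimes> p = w"
          "v \<otimes> a \<otimes> w = p" "w \<otimes> (v \<otimes> a) = p"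
        by (auto simp: corner_unit_def in_corner_def)
      have "a \<otimes> (w \<otimes> v) = q"
      proof -
        have "a \<otimes> (w \<otimes> v) = u \<otimes> v \<otimes> a \<otimes> w \<otimes> v"
          using ac c w by (simp add: m_assoc sides e)
        also have "\<dots> = u \<otimes> (v \<otimes> a \<otimes> w) \<otimes> v"
          using ac c w(1) by (simp add: m_assoc)
        also have "\<dots> = q" unfolding w(4) using e by simp
        finally show ?thesis .
      qed
      then have "idem_iso p q a (w \<otimes> v)"
        unfolding idem_iso_def using ac c w w(2)[THEN mult_assoc_eq]
        by (simp add: m_assoc sides e)
      then show ?thesis
        using idem_iso_complement[OF id pr qs xy] unfolding a_def by blast
    next
      assume "corner_unit p {} (d' \<otimes> d)"
      then obtain z where z: "z \<in> carrier R" "p \<otimes> z = z" "z \<otimes> p = z" "z \<otimes> (d' \<otimes> d) = p"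
        by (auto simp: corner_unit_def in_corner_def)
      \<comment> \<open>\<open>f\<close> is a left inverse of \<open>d\<close>, so
        \<open>d \<otimes> f\<close> is an idempotent below \<open>s\<close> that is equivalent to
        \<open>p\<close>.\<close>
      define f where "f = z \<otimes> d'"
      define s' where "s' = d \<otimes> f"
      define s2 where "s2 = s \<ominus> s'"
      have fc: "f \<in> carrier R" "s' \<in> carrier R" using z ac by (auto simp: f_def s'_def)
      have f: "p \<otimes> f = f" "f \<otimes> s = f" "f \<otimes> d = p"
        using z ac c z(2)[THEN mult_assoc_eq] by (simp_all add: f_def m_assoc sides)
      have ps': "idem_iso p s' d f"
        unfolding idem_iso_def s'_def using fc ac c
        by (simp add: m_assoc sides f f[THEN mult_assoc_eq] sides[THEN mult_assoc_eq])
      have s': "idempotent s'" "in_corner s {} s'"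
        unfolding idempotent_def in_corner_def s'_def using fc ac c
        by (simp_all add: m_assoc sides f f[THEN mult_assoc_eq] sides[THEN mult_assoc_eq])
      note T = idempotent_split[OF id(4) s', folded s2_def]
      have s2c: "s2 \<in> carrier R" using T by (simp add: idempotent_def)
      have o: "orth s' q" "orth s2 q"
        using orth_corner[OF orth_sym[OF qs]] s' T c by blast+
      \<comment> \<open>With \<open>s'\<close> in place of \<open>q\<close>, the block of
        \<open>x\<close> at \<open>p\<close> is \<open>d\<close> itself, hence invertible, and the
        Schur complement is available again.\<close>
      have blk: "s' \<otimes> (x \<otimes> p) = d"
      proof -
        have "s' \<otimes> (x \<otimes> p) = d \<otimes> (f \<otimes> s) \<otimes> (x \<otimes> p)"
          by (simp add: s'_def f)
        also have "\<dots> = d \<otimes> (f \<otimes> d)"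
          using fc ac c by (simp add: m_assoc d_def)
        finally show ?thesis using f sides by simp
      qed
      have "\<exists>x' y'. idem_iso r (q \<oplus> s2) x' y'"
      proof (rule idem_iso_complement[OF id(1) s'(1) id(3) _ pr])
        show "idempotent (q \<oplus> s2)" using idempotent_add[OF id(2) T(1)] o orth_sym by blast
        show "orth s' (q \<oplus> s2)" using orth_add[OF o(1) T(3)] fc c s2c by blast
        have "s' \<oplus> (q \<oplus> s2) = q \<oplus> s"
          using T(4) fc c s2c by (simp add: a_lcomm)
        then show "idem_iso (p \<oplus> r) (s' \<oplus> (q \<oplus> s2)) x y" using xy by simp
        show "idem_iso p s' (s' \<otimes> (x \<otimes> p)) f" using ps' blk by simp
      qed
      \<comment> \<open>Both \<open>q\<close> and \<open>s'\<close> are equivalent to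
        \<open>p\<close>; exchanging them turns the complement \<open>q \<oplus> s2\<close> of
        \<open>s'\<close> into \<open>s\<close>.\<close>
      moreover have "idem_iso (q \<oplus> s2) (s' \<oplus> s2) (d \<otimes> v \<oplus> s2) (u \<otimes> f \<oplus> s2)"
        by (intro idem_iso_add idem_iso_trans[OF idem_iso_sym[OF uv] ps'] idem_iso_refl T orth_sym[OF o(2)])
      ultimately show ?thesis
        using idem_iso_trans T(4) by metis
    qed
  qed
qed

end

section \<open>Minimal polynomials and automorphisms\<close>

text \<open>A product of factors \<open>X - l\<close>, as a coefficient list. Folding over a list
  fixes an order of the factors, so that the same recursion can be run with operators in their
  place.\<close>

definition (in ring) linear_prod :: "'a list \<Rightarrow> 'a list" where
  "linear_prod ls = foldr (\<lambda>l q. poly_mult [\<one>, \<ominus> l] q) ls [\<one>]"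

lemma (in ring) linear_prod_simps:
  "linear_prod [] = [\<one>]" "linear_prod (l # ls) = poly_mult [\<one>, \<ominus> l] (linear_prod ls)"
  by (simp_all add: linear_prod_def)

lemma (in domain) monic_linear_closed: "a \<in> carrier R \<Longrightarrow> [\<one>, \<ominus> a] \<in> carrier (poly_ring R)"
  unfolding sym[OF univ_poly_carrier] polynomial_def by auto

lemma (in field) linear_prod_closed:
  assumes "set ls \<subseteq> carrier R"
  shows "linear_prod ls \<in> carrier (poly_ring R) \<and> linear_prod ls \<noteq> [] \<and> roots (linear_prod ls) = mset ls"
  using assms
proof (induction ls)
  case Nil
  have "[\<one>] \<in> carrier (poly_ring R)"
    unfolding sym[OF univ_poly_carrier] polynomial_def by auto
  then show ?case by (simp add: linear_prod_simps degree_zero_imp_empty_roots)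
next
  case (Cons a ls)
  interpret UP: domain "poly_ring R"
    using univ_poly_is_domain[OF carrier_is_subring] .
  have a: "a \<in> carrier R" and IH: "linear_prod ls \<in> carrier (poly_ring R)" "linear_prod ls \<noteq> []"
    "roots (linear_prod ls) = mset ls"
    using Cons by auto
  have eq: "linear_prod (a # ls) = [\<one>, \<ominus> a] \<otimes>\<^bsub>poly_ring R\<^esub> linear_prod ls"
    by (simp only: linear_prod_simps univ_poly_mult)
  have "linear_prod (a # ls) \<noteq> []"
    using UP.integral[of "[\<one>, \<ominus> a]" "linear_prod ls"] monic_linear_closed[OF a] IH
    unfolding eq univ_poly_zero by auto
  then show ?case
    unfolding eq using poly_mult_degree_one_monic_imp_same_roots[OF a IH(1,2)] IH monic_linear_closed[OF a]
    by (simp add: UP.m_closed)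
qed

text \<open>Roots are divided off one at a time. Each factor \<open>X - a\<close> is monic, so the
  quotient stays monic, and in degree zero only the constant 1 is left.\<close>

lemma (in field) splitted_imp_linear_prod:
  assumes "p \<in> carrier (poly_ring R)" and "p \<noteq> []" and "lead_coeff p = \<one>" and "splitted p"
  shows "\<exists>ls. set ls \<subseteq> carrier R \<and> p = linear_prod ls"
  using assms
proof (induction "degree p" arbitrary: p)
  case 0
  then have "p = [\<one>]" by (cases p) auto
  then show ?case by (intro exI[of _ "[]"]) (simp add: linear_prod_simps)
next
  case (Suc n)
  interpret UP: domain "poly_ring R"
    using univ_poly_is_domain[OF carrier_is_subring] .
  have "roots p \<noteq> {#}" using Suc by (auto simp: splitted_def)
  then obtain a where "a \<in># roots p" by blast
  then have root: "is_root p a" using roots_mem_iff_is_root Suc by blast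
  then have a: "a \<in> carrier R" by (simp add: is_root_def)
  obtain q where q: "q \<in> carrier (poly_ring R)" and p: "p = [\<one>, \<ominus> a] \<otimes>\<^bsub>poly_ring R\<^esub> q"
    using is_root_imp_pdivides[OF Suc(3) root] unfolding pdivides_def by auto
  have q0: "q \<noteq> []"
    using p Suc(4) UP.r_null monic_linear_closed[OF a] unfolding sym[OF univ_poly_zero[of R "carrier R"]] by metis
  have roots: "roots p = add_mset a (roots q)"
    unfolding p by (rule poly_mult_degree_one_monic_imp_same_roots[OF a q q0])
  have poly: "polynomial (carrier R) [\<one>, \<ominus> a]" "polynomial (carrier R) q"
    using monic_linear_closed[OF a] q by (simp_all add: univ_poly_carrier)
  have pm: "p = poly_mult [\<one>, \<ominus> a] q" using p by (simp add: univ_poly_mult)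
  have deg: "degree q = n"
    using poly_mult_degree_eq[OF carrier_is_subring poly] q0 Suc(2)
    unfolding pm[symmetric] by (simp split: if_splits)
  have "lead_coeff p = \<one> \<otimes> lead_coeff q"
    using poly_mult_lead_coeff[OF carrier_is_subring poly] q0 unfolding pm[symmetric] by simp
  moreover have "lead_coeff q \<in> carrier R"
    using q q0 by (cases q) (auto simp: sym[OF univ_poly_carrier] polynomial_def)
  ultimately have "lead_coeff q = \<one>" using Suc by simp
  moreover have "splitted q" using Suc(2,6) roots deg by (simp add: splitted_def)
  ultimately obtain ls where "set ls \<subseteq> carrier R" "q = linear_prod ls"
    using Suc(1)[OF _ q q0] deg by auto
  then show ?case
    using a pm by (intro exI[of _ "a # ls"]) (simp add: linear_prod_simps)
qed

lemma map_linear_prod: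
  assumes "field K" and "field L" and "h \<in> ring_hom K L" and "set ls \<subseteq> carrier K"
  shows "map h (ring.linear_prod K ls) = ring.linear_prod L (map h ls)"
  using assms(4)
proof (induction ls)
  interpret K: field K by fact
  interpret L: field L by fact
  interpret h: ring_hom_ring K L h using assms by (intro ring_hom_ringI2 K.ring_axioms L.ring_axioms)
  {
    case Nil
    show ?case by (simp add: K.linear_prod_simps L.linear_prod_simps)
  next
    case (Cons a ls)
    let ?q = "K.linear_prod ls"
    have a: "a \<in> carrier K" using Cons by simp
    have q: "?q \<in> carrier (poly_ring K)" using K.linear_prod_closed Cons by simp
    then have qs: "set ?q \<subseteq> carrier K" by (auto simp: sym[OF univ_poly_carrier] polynomial_def)
    have "K.linear_prod (a # ls) \<in> carrier (poly_ring K)" using K.linear_prod_closed[of "a # ls"] Cons by simp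
    then have pol: "K.linear_prod (a # ls) \<noteq> [] \<Longrightarrow> hd (K.linear_prod (a # ls)) \<noteq> \<zero>\<^bsub>K\<^esub>"
      and ps: "set (K.linear_prod (a # ls)) \<subseteq> carrier K"
      by (auto simp: sym[OF univ_poly_carrier] polynomial_def)
    \<comment> \<open>A homomorphism of fields kills no nonzero leading coefficient, so the
      normalization in \<open>poly_mult_hom'\<close> changes nothing.\<close>
    have inj: "h x \<noteq> \<zero>\<^bsub>L\<^esub>" if "x \<in> carrier K" "x \<noteq> \<zero>\<^bsub>K\<^esub>" for x
      using that h.hom_zero K.field_Units L.one_not_zero
      by (metis K.Units_r_inv_ex DiffI L.l_null h.hom_closed h.hom_mult h.hom_one singletonD)
    have "L.normalize (map h (K.linear_prod (a # ls))) = map h (K.linear_prod (a # ls))"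
      using pol ps inj by (cases "K.linear_prod (a # ls)") auto
    then have "map h (K.linear_prod (a # ls)) = L.poly_mult (map h [\<one>\<^bsub>K\<^esub>, \<ominus>\<^bsub>K\<^esub> a]) (map h ?q)"
      unfolding K.linear_prod_simps using h.poly_mult_hom'[OF _ qs, of "[\<one>\<^bsub>K\<^esub>, \<ominus>\<^bsub>K\<^esub> a]"] a by simp
    also have "map h [\<one>\<^bsub>K\<^esub>, \<ominus>\<^bsub>K\<^esub> a] = [\<one>\<^bsub>L\<^esub>, \<ominus>\<^bsub>L\<^esub> h a]" using a by simp
    finally show ?case using Cons by (simp add: L.linear_prod_simps del: L.poly_mult.simps)
  }
qed

lemma not_distinct_count_neq_1: "\<not> distinct xs \<Longrightarrow> \<exists>y\<in>set xs. count (mset xs) y \<noteq> 1"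
  by (auto simp: distinct_count_atmost_1 split: if_splits)

text \<open>Normality splits the minimal polynomial of \<open>a\<close> over \<open>K\<close>
  itself. Separability bounds root multiplicities only in the algebraic closure, so the
  factorization is mapped there, where a repeated factor would become a multiple root.\<close>

lemma normal_separable_linear_prod:
  fixes K :: "'a ring"
  assumes "field K" and k: "subfield k K" and sep: "separable_extension K k" and nor: "normal_extension K k"
    and a: "a \<in> carrier K"
  shows "\<exists>ls. distinct ls \<and> set ls \<subseteq> carrier K \<and> set (ring.linear_prod K ls) \<subseteq> k \<and>
    ring.eval K (ring.linear_prod K ls) a = \<zero>\<^bsub>K\<^esub>"
proof -
  interpret K: field K by fact
  define L where "L = K.alg_closure"
  let ?h = "K.indexed_const :: 'a \<Rightarrow> ('a list \<times> nat) multiset \<Rightarrow> 'a"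
  have Lf: "algebraic_closure L (?h ` carrier K)" and hom: "?h \<in> ring_hom K L"
    using K.alg_closureE by (simp_all add: L_def)
  interpret L: algebraic_closure L "?h ` carrier K" by (rule Lf)
  have alg: "(K.algebraic over k) a" using sep a by (simp add: separable_extension_def)
  let ?p = "K.Irr k a"
  note I = K.IrrE[OF k a alg]
  have "K.splitted ?p" using nor I a unfolding normal_extension_def by blast
  moreover have pc: "?p \<in> carrier (poly_ring K)" using I(1) K.carrier_polynomial_shell[OF subfieldE(1)[OF k]] by blast
  moreover have p0: "?p \<noteq> []" using I(2) K.pirreducibleE(1)[OF subfieldE(1)[OF k] I(1)] by blast
  ultimately obtain ls where ls: "set ls \<subseteq> carrier K" "?p = K.linear_prod ls"
    using K.splitted_imp_linear_prod I(3) by blast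
  have "map ?h ?p = L.linear_prod (map ?h ls)"
    unfolding ls(2) by (rule map_linear_prod[OF \<open>field K\<close> L.field_axioms hom ls(1)])
  have hls: "set (map ?h ls) \<subseteq> carrier L" using ls(1) ring_hom_memE(1)[OF hom] by auto
  have "distinct (map ?h ls)"
  proof (rule ccontr)
    assume "\<not> distinct (map ?h ls)"
    then obtain y where y: "y \<in> set (map ?h ls)" "count (mset (map ?h ls)) y \<noteq> 1"
      by (rule bexE[OF not_distinct_count_neq_1])
    have "L.alg_mult (map ?h ?p) y = count (mset (map ?h ls)) y"
      unfolding \<open>map ?h ?p = _\<close> using L.linear_prod_closed[OF hls] L.alg_mult_eq_count_roots by metis
    moreover have "L.alg_mult (map ?h ?p) y \<le> 1"
      using sep a y(1) hls unfolding separable_extension_def Let_def L_def by blast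
    moreover have "count (mset (map ?h ls)) y > 0" using y(1) by simp
    ultimately show False using y(2) by linarith
  qed
  then have "distinct ls" by (simp add: distinct_map)
  moreover have "set ?p \<subseteq> k" using I(1) by (auto simp add: sym[OF univ_poly_carrier] polynomial_def)
  ultimately show ?thesis using ls I(4) by auto
qed

text \<open>Only surjectivity is at stake. Given \<open>y\<close>, the injective map
  \<open>h\<close> permutes the finitely many roots in \<open>K\<close> of the minimal polynomial of
  \<open>y\<close>, because it fixes the coefficients.\<close>

lemma algebraic_endomorphism_in_galois_group:
  assumes "field K" and k: "subfield k K" and alg: "\<And>x. x \<in> carrier K \<Longrightarrow> (ring.algebraic K over k) x"
    and h: "h \<in> ring_hom K K" and fx: "\<And>c. c \<in> k \<Longrightarrow> h c = c"
  shows "h \<in> galois_group K k"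
proof -
  interpret K: field K by fact
  interpret h: ring_hom_ring K K h using h by (intro ring_hom_ringI2 K.ring_axioms)
  have "h \<one>\<^bsub>K\<^esub> \<in> h ` carrier K" using imageI[OF K.one_closed, of h] .
  then have "h ` carrier K \<noteq> {\<zero>\<^bsub>K\<^esub>}" unfolding h.hom_one using K.one_not_zero by blast
  then have inj: "inj_on h (carrier K)"
    by (rule ring_hom_ring.non_trivial_field_hom_imp_inj[OF h.ring_hom_ring_axioms \<open>field K\<close>])
  have surj: "y \<in> h ` carrier K" if y: "y \<in> carrier K" for y
  proof -
    let ?p = "K.Irr k y"
    note I = K.IrrE[OF k y alg[OF y]]
    have pc: "?p \<in> carrier (poly_ring K)" using I(1) K.carrier_polynomial_shell[OF subfieldE(1)[OF k]] by blast
    have p0: "?p \<noteq> []" using I(2) K.pirreducibleE(1)[OF subfieldE(1)[OF k] I(1)] by blast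
    have pk: "set ?p \<subseteq> k" using I(1) by (auto simp add: sym[OF univ_poly_carrier] polynomial_def)
    then have ps: "set ?p \<subseteq> carrier K" using subfieldE(3)[OF k] by blast
    have mp: "map h ?p = ?p" using pk fx by (intro map_idI) auto
    let ?S = "{x. K.is_root ?p x}"
    have S: "?S \<subseteq> carrier K" "finite ?S"
      using K.finite_number_of_roots[OF pc] by (auto simp: K.is_root_def)
    have "h x \<in> ?S" if "x \<in> ?S" for x
      using that h.eval_hom'[of x ?p] ps mp by (auto simp: K.is_root_def)
    then have "h ` ?S = ?S"
      using endo_inj_surj[OF S(2), of h] inj_on_subset[OF inj S(1)] by blast
    moreover have "y \<in> ?S" using y p0 I(4) by (simp add: K.is_root_def)
    ultimately show ?thesis using S(1) by blast
  qed
  have "bij_betw h (carrier K) (carrier K)"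
    using inj surj h.hom_closed by (auto simp: bij_betw_def)
  then show ?thesis using h fx by (simp add: galois_group_def ring_iso_def)
qed

section \<open>Semilinear elements\<close>

lemma (in ring) diff_eq_swap:
  assumes "p \<oplus> \<ominus> q = r \<oplus> \<ominus> s"
    and "p \<in> carrier R" "q \<in> carrier R" "r \<in> carrier R" "s \<in> carrier R"
  shows "p \<oplus> \<ominus> r = q \<oplus> \<ominus> s"
proof -
  have "p = q \<oplus> (p \<oplus> \<ominus> q)" using assms(2-) by (simp add: a_lcomm r_neg)
  also have "\<dots> = r \<oplus> (q \<oplus> \<ominus> s)" unfolding assms(1) using assms(2-) by (simp add: a_lcomm)
  finally have "p \<oplus> \<ominus> r = r \<oplus> (q \<oplus> \<ominus> s) \<oplus> \<ominus> r" by simp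
  also have "\<dots> = q \<oplus> \<ominus> s" 
    using assms(2-) a_comm[of r "q \<oplus> \<ominus> s"] a_assoc[of "q \<oplus> \<ominus> s" r "\<ominus> r"] by (simp add: r_neg)
  finally show ?thesis .
qed

text \<open>\<open>\<eta>\<close> is the central action of the base field on \<open>R\<close>; all
  representations of \<open>K\<close> are made to agree with it on \<open>k\<close>, so that they
  can be compared.\<close>

locale field_reps = ring R + K: field K for R (structure) and K :: "'k ring" +
  fixes k :: "'k set" and \<eta> :: "'k \<Rightarrow> 'a"
  assumes k: "subfield k K"
    and eta_closed: "c \<in> k \<Longrightarrow> \<eta> c \<in> carrier R"
    and eta_commute: "\<lbrakk>c \<in> k; x \<in> carrier R\<rbrakk> \<Longrightarrow> \<eta> c \<otimes> x = x \<otimes> \<eta> c"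
begin

text \<open>The value at 1 is merely an idempotent: a representation may live on a direct summand,
  as it does once another summand has been split off.\<close>

definition rep :: "('k \<Rightarrow> 'a) \<Rightarrow> bool" where
  "rep \<alpha> \<longleftrightarrow> \<alpha> \<in> carrier K \<rightarrow> carrier R \<and>
     (\<forall>a\<in>carrier K. \<forall>b\<in>carrier K. \<alpha> (a \<oplus>\<^bsub>K\<^esub> b) = \<alpha> a \<oplus> \<alpha> b \<and> \<alpha> (a \<otimes>\<^bsub>K\<^esub> b) = \<alpha> a \<otimes> \<alpha> b) \<and>
     (\<forall>c\<in>k. \<alpha> c = \<eta> c \<otimes> \<alpha> \<one>\<^bsub>K\<^esub>)"

text \<open>A bimodule over \<open>K\<close>, acting through \<open>\<alpha>\<close> on the left and
  through \<open>\<beta>\<close> on the right. By \<open>base_scalar\<close> both actions agree on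
  \<open>k\<close>, so this is a module over K \<otimes> K.\<close>

definition between :: "('k \<Rightarrow> 'a) \<Rightarrow> ('k \<Rightarrow> 'a) \<Rightarrow> 'a set" where
  "between \<alpha> \<beta> = {x \<in> carrier R. \<alpha> \<one>\<^bsub>K\<^esub> \<otimes> x = x \<and> x \<otimes> \<beta> \<one>\<^bsub>K\<^esub> = x}"

definition semi :: "('k \<Rightarrow> 'a) \<Rightarrow> ('k \<Rightarrow> 'a) \<Rightarrow> ('k \<Rightarrow> 'k) \<Rightarrow> 'a set" where
  "semi \<alpha> \<beta> \<psi> = {x \<in> between \<alpha> \<beta>. \<forall>a\<in>carrier K. \<alpha> a \<otimes> x = x \<otimes> \<beta> (\<psi> a)}"

lemma rep_closed: "rep \<alpha> \<Longrightarrow> a \<in> carrier K \<Longrightarrow> \<alpha> a \<in> carrier R"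
  by (auto simp: rep_def)

lemma rep_add: "rep \<alpha> \<Longrightarrow> a \<in> carrier K \<Longrightarrow> b \<in> carrier K \<Longrightarrow> \<alpha> (a \<oplus>\<^bsub>K\<^esub> b) = \<alpha> a \<oplus> \<alpha> b"
  by (auto simp: rep_def)

lemma rep_mult: "rep \<alpha> \<Longrightarrow> a \<in> carrier K \<Longrightarrow> b \<in> carrier K \<Longrightarrow> \<alpha> (a \<otimes>\<^bsub>K\<^esub> b) = \<alpha> a \<otimes> \<alpha> b"
  by (auto simp: rep_def)

lemma rep_zero:
  assumes "rep \<alpha>"
  shows "\<alpha> \<zero>\<^bsub>K\<^esub> = \<zero>"
proof -
  have "\<alpha> \<zero>\<^bsub>K\<^esub> \<oplus> \<alpha> \<zero>\<^bsub>K\<^esub> = \<alpha> \<zero>\<^bsub>K\<^esub>"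
    using rep_add[OF assms, of "\<zero>\<^bsub>K\<^esub>" "\<zero>\<^bsub>K\<^esub>"] by simp
  then show ?thesis using rep_closed[OF assms] by (metis K.zero_closed add.l_cancel_one)
qed

lemma rep_minus:
  assumes "rep \<alpha>" and "a \<in> carrier K"
  shows "\<alpha> (\<ominus>\<^bsub>K\<^esub> a) = \<ominus> \<alpha> a"
proof -
  have "\<alpha> (\<ominus>\<^bsub>K\<^esub> a) \<oplus> \<alpha> a = \<zero>"
    using rep_add[OF assms(1), of "\<ominus>\<^bsub>K\<^esub> a" a] assms(2) rep_zero[OF assms(1)] by (simp add: K.l_neg)
  then show ?thesis using minus_equality[of "\<alpha> (\<ominus>\<^bsub>K\<^esub> a)" "\<alpha> a"] assms rep_closed[OF assms(1)] by simp
qed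

lemma rep_one:
  assumes "rep \<alpha>" and "a \<in> carrier K"
  shows "\<alpha> \<one>\<^bsub>K\<^esub> \<otimes> \<alpha> a = \<alpha> a" "\<alpha> a \<otimes> \<alpha> \<one>\<^bsub>K\<^esub> = \<alpha> a"
  using rep_mult[OF assms(1), of "\<one>\<^bsub>K\<^esub>" a] rep_mult[OF assms(1), of a "\<one>\<^bsub>K\<^esub>"] assms by auto

lemma rep_commute:
  assumes "rep \<alpha>" and "a \<in> carrier K" and "b \<in> carrier K"
  shows "\<alpha> a \<otimes> \<alpha> b = \<alpha> b \<otimes> \<alpha> a"
  using rep_mult[OF assms] rep_mult[OF assms(1,3,2)] K.m_comm[OF assms(2,3)] by simp

lemma between_closed: "x \<in> between \<alpha> \<beta> \<Longrightarrow> x \<in> carrier R"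
  by (simp add: between_def)

lemma semi_closed: "x \<in> semi \<alpha> \<beta> \<psi> \<Longrightarrow> x \<in> carrier R"
  by (simp add: semi_def between_def)

lemma semi_subset: "(\<Union>\<psi>\<in>G. semi \<alpha> \<beta> \<psi>) \<subseteq> carrier R"
  by (auto intro: semi_closed)

lemma between_mult:
  assumes "rep \<alpha>" "rep \<beta>" "x \<in> between \<alpha> \<beta>" "a \<in> carrier K"
  shows "\<alpha> a \<otimes> x \<in> between \<alpha> \<beta>" "x \<otimes> \<beta> a \<in> between \<alpha> \<beta>"
proof -
  have e: "\<alpha> \<one>\<^bsub>K\<^esub> \<otimes> x = x" "x \<otimes> \<beta> \<one>\<^bsub>K\<^esub> = x" and x: "x \<in> carrier R"
    using assms by (auto simp: between_def)
  note r = rep_one[OF assms(1,4)] rep_one[OF assms(2,4)]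
  note c = rep_closed[OF assms(1)] rep_closed[OF assms(2)]
  show "\<alpha> a \<otimes> x \<in> between \<alpha> \<beta>" "x \<otimes> \<beta> a \<in> between \<alpha> \<beta>"
    unfolding between_def using x c assms(4)
    by (simp_all add: m_assoc e r e[THEN mult_assoc_eq] r[THEN mult_assoc_eq])
qed

lemma between_add: "rep \<alpha> \<Longrightarrow> rep \<beta> \<Longrightarrow> x \<in> between \<alpha> \<beta> \<Longrightarrow> y \<in> between \<alpha> \<beta> \<Longrightarrow> x \<oplus> y \<in> between \<alpha> \<beta>"
  using rep_closed[of \<alpha>] rep_closed[of \<beta>] by (auto simp: between_def l_distr r_distr)

lemma between_minus: "rep \<alpha> \<Longrightarrow> rep \<beta> \<Longrightarrow> x \<in> between \<alpha> \<beta> \<Longrightarrow> \<ominus> x \<in> between \<alpha> \<beta>"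
  using rep_closed[of \<alpha>] rep_closed[of \<beta>] by (auto simp: between_def l_minus r_minus)

lemma zero_between: "rep \<alpha> \<Longrightarrow> rep \<beta> \<Longrightarrow> \<zero> \<in> between \<alpha> \<beta>"
  using rep_closed[of \<alpha>] rep_closed[of \<beta>] by (auto simp: between_def)

text \<open>Both sides are multiplication by the central element \<open>\<eta> c\<close>.\<close>

lemma base_scalar:
  assumes "rep \<alpha>" "rep \<beta>" "x \<in> between \<alpha> \<beta>" "c \<in> k"
  shows "\<alpha> c \<otimes> x = x \<otimes> \<beta> c"
proof -
  have c: "\<alpha> \<one>\<^bsub>K\<^esub> \<in> carrier R" "\<beta> \<one>\<^bsub>K\<^esub> \<in> carrier R" "\<eta> c \<in> carrier R" "x \<in> carrier R"
    using assms rep_closed eta_closed between_closed by auto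
  have "\<alpha> c \<otimes> x = \<eta> c \<otimes> (\<alpha> \<one>\<^bsub>K\<^esub> \<otimes> x)"
    using assms c by (simp add: rep_def m_assoc)
  also have "\<dots> = x \<otimes> \<eta> c" using assms c eta_commute by (simp add: between_def)
  also have "\<dots> = x \<otimes> \<beta> \<one>\<^bsub>K\<^esub> \<otimes> \<eta> c" using assms by (simp add: between_def)
  also have "\<dots> = x \<otimes> (\<eta> c \<otimes> \<beta> \<one>\<^bsub>K\<^esub>)" using assms c eta_commute by (simp add: m_assoc)
  also have "\<dots> = x \<otimes> \<beta> c" using assms by (simp add: rep_def)
  finally show ?thesis .
qed

lemma rep_cancel:
  assumes "rep \<beta>" and "x \<in> carrier R" "x \<otimes> \<beta> \<one>\<^bsub>K\<^esub> = x"
    and b: "b \<in> carrier K" "b \<noteq> \<zero>\<^bsub>K\<^esub>" and "x \<otimes> \<beta> b = \<zero>"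
  shows "x = \<zero>"
proof -
  have "b \<in> Units K" using b K.field_Units by blast
  then obtain b' where b': "b' \<in> carrier K" "b \<otimes>\<^bsub>K\<^esub> b' = \<one>\<^bsub>K\<^esub>" using K.Units_r_inv_ex by blast
  have "x = x \<otimes> (\<beta> b \<otimes> \<beta> b')" using rep_mult[OF assms(1) b(1) b'(1)] b' assms by simp
  also have "\<dots> = x \<otimes> \<beta> b \<otimes> \<beta> b'" using rep_closed[OF assms(1)] b b' assms(2) by (simp add: m_assoc)
  also have "\<dots> = \<zero>" unfolding assms(6) using rep_closed[OF assms(1)] b' by simp
  finally show ?thesis .
qed

text \<open>Its kernel consists of the eigenvectors of \<open>A\<close> with eigenvalue
  \<open>l\<close>, where eigenvalues act from the right.\<close>

definition eig_diff :: "('k \<Rightarrow> 'a) \<Rightarrow> 'a \<Rightarrow> 'k \<Rightarrow> 'a \<Rightarrow> 'a" where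
  "eig_diff \<beta> A l x = A \<otimes> x \<ominus> x \<otimes> \<beta> l"

text \<open>For an eigenvector \<open>z\<close> with eigenvalue \<open>m \<noteq> l\<close>, the equation \<open>A y - y \<beta>(l) = z\<close> is solved by
  \<open>y = z \<beta>((m - l)\<^sup>-\<^sup>1)\<close>; this drives the induction on the number of factors.\<close>

lemma eigenvector_decomposition:
  assumes \<beta>: "rep \<beta>" and A: "A \<in> carrier R"
    and W: "W \<subseteq> carrier R" "\<And>x. x \<in> W \<Longrightarrow> x \<otimes> \<beta> \<one>\<^bsub>K\<^esub> = x" "\<zero> \<in> W"
    and W_add: "\<And>x y. x \<in> W \<Longrightarrow> y \<in> W \<Longrightarrow> x \<oplus> y \<in> W" and W_minus: "\<And>x. x \<in> W \<Longrightarrow> \<ominus> x \<in> W"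
    and W_A: "\<And>x. x \<in> W \<Longrightarrow> A \<otimes> x \<in> W"
    and W_mult: "\<And>x l. x \<in> W \<Longrightarrow> l \<in> carrier K \<Longrightarrow> x \<otimes> \<beta> l \<in> W"
    and ls: "distinct ls" "set ls \<subseteq> carrier K"
    and x: "x \<in> W" "foldr (eig_diff \<beta> A) ls x = \<zero>"
  shows "x \<in> add_span {w \<in> W. \<exists>l\<in>set ls. A \<otimes> w = w \<otimes> \<beta> l}"
  using ls x
\<comment> \<open>\<open>foldr\<close> applies the last entry first, so splitting the list at its
  end leaves the induction hypothesis for \<open>eig_diff \<beta> A l x\<close>.\<close>
proof (induction ls arbitrary: x rule: rev_induct)
  case Nil
  then show ?case by (simp add: add_span.zero)
next
  case (snoc l ls)
  let ?Z = "\<lambda>ls. {w \<in> W. \<exists>l\<in>set ls. A \<otimes> w = w \<otimes> \<beta> l}"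
  have l: "l \<in> carrier K" "l \<notin> set ls" and ls: "set ls \<subseteq> carrier K" "distinct ls" using snoc by auto
  have Z: "?Z ls \<subseteq> carrier R" "?Z (ls @ [l]) \<subseteq> carrier R" using W by auto
  have bc: "\<beta> l \<in> carrier R" if "l \<in> carrier K" for l using rep_closed[OF \<beta> that] .
  have "eig_diff \<beta> A l x \<in> W"
    unfolding eig_diff_def a_minus_def using snoc l W_add W_minus W_A W_mult by auto
  then have D: "eig_diff \<beta> A l x \<in> add_span (?Z ls)"
    using snoc ls by simp
  \<comment> \<open>On sums of eigenvectors with eigenvalues in \<open>ls\<close>, the operator for
    \<open>l\<close> can be inverted: \<open>l\<close> is not in \<open>ls\<close>, so each summand
    is divided by its nonzero eigenvalue difference.\<close>
  have "\<exists>y \<in> add_span (?Z ls). y \<in> W \<and> eig_diff \<beta> A l y = x'" if "x' \<in> add_span (?Z ls)" for x'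
    using that
  proof induction
    case zero
    show ?case
      by (intro bexI[of _ \<zero>]) (use W A bc l in \<open>auto simp: eig_diff_def a_minus_def intro: add_span.zero\<close>)
  next
    case (step z x')
    then obtain y where y: "y \<in> add_span (?Z ls)" "y \<in> W" "eig_diff \<beta> A l y = x'" by blast
    obtain m where m: "m \<in> set ls" "A \<otimes> z = z \<otimes> \<beta> m" and z: "z \<in> W" using step by blast
    have mc: "m \<in> carrier K" and zc: "z \<in> carrier R" and yc: "y \<in> carrier R" using m ls z y W by auto
    have d: "m \<ominus>\<^bsub>K\<^esub> l \<in> carrier K" "m \<ominus>\<^bsub>K\<^esub> l \<noteq> \<zero>\<^bsub>K\<^esub>"
      using mc l m by (auto simp: K.r_right_minus_eq)
    then have "m \<ominus>\<^bsub>K\<^esub> l \<in> Units K" using K.field_Units by blast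
    then obtain t where t: "t \<in> carrier K" "t \<otimes>\<^bsub>K\<^esub> (m \<ominus>\<^bsub>K\<^esub> l) = \<one>\<^bsub>K\<^esub>" using K.Units_l_inv_ex by blast
    define z' where "z' = z \<otimes> \<beta> t"
    have z'W: "z' \<in> W" using z t W_mult by (simp add: z'_def)
    then have z'c: "z' \<in> carrier R" using W by auto
    have Az': "A \<otimes> z' = z' \<otimes> \<beta> m"
    proof -
      have "A \<otimes> z' = z \<otimes> (\<beta> m \<otimes> \<beta> t)"
        using m(2)[THEN mult_assoc_eq] A zc bc t mc m(2) by (simp add: z'_def m_assoc[symmetric])
      then show ?thesis using rep_commute[OF \<beta> mc t(1)] zc bc mc t by (simp add: z'_def m_assoc)
    qed
    have "eig_diff \<beta> A l z' = z' \<otimes> \<beta> (m \<ominus>\<^bsub>K\<^esub> l)"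
      unfolding eig_diff_def Az' a_minus_def
      using rep_add[OF \<beta>, of m "\<ominus>\<^bsub>K\<^esub> l"] rep_minus[OF \<beta>, of l] mc l bc z'c
      by (simp add: a_minus_def r_distr r_minus)
    also have "\<dots> = z \<otimes> \<beta> (t \<otimes>\<^bsub>K\<^esub> (m \<ominus>\<^bsub>K\<^esub> l))"
      using zc bc t d rep_mult[OF \<beta> t(1) d(1)] by (simp add: z'_def m_assoc)
    also have "\<dots> = z" using t z W by simp
    finally have ez: "eig_diff \<beta> A l z' = z" .
    have "eig_diff \<beta> A l (z' \<oplus> y) = z \<oplus> x'"
      unfolding ez[symmetric] y(3)[symmetric] eig_diff_def a_minus_def
      using A z'c yc bc l by (simp add: l_distr r_distr minus_add a_ac)
    moreover have "z' \<oplus> y \<in> add_span (?Z ls)"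
      using z'W Az' m y by (intro add_span.step) auto
    ultimately show ?case using W_add[OF z'W y(2)] by blast
  qed
  then obtain y where y: "y \<in> add_span (?Z ls)" "y \<in> W" "eig_diff \<beta> A l y = eig_diff \<beta> A l x"
    using D by blast
  have xc: "x \<in> carrier R" and yc: "y \<in> carrier R" using W snoc y by auto
  \<comment> \<open>Subtracting the preimage \<open>y\<close> leaves an element that the operator
    for \<open>l\<close> kills, that is, an eigenvector with eigenvalue \<open>l\<close>.\<close>
  define u where "u = x \<oplus> \<ominus> y"
  have uW: "u \<in> W" using W_add W_minus snoc y by (simp add: u_def)
  have uc: "u \<in> carrier R" using uW W by auto
  have "A \<otimes> x \<ominus> x \<otimes> \<beta> l = A \<otimes> y \<ominus> y \<otimes> \<beta> l" using y(3) by (simp add: eig_diff_def)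
  then have "A \<otimes> x \<oplus> \<ominus> (A \<otimes> y) = x \<otimes> \<beta> l \<oplus> \<ominus> (y \<otimes> \<beta> l)"
    unfolding a_minus_def by (rule diff_eq_swap) (use A xc yc bc[OF l(1)] in simp_all)
  then have "A \<otimes> u = u \<otimes> \<beta> l"
    unfolding u_def using A xc yc bc[OF l(1)] by (simp add: l_distr r_distr l_minus r_minus)
  then have "u \<in> add_span (?Z (ls @ [l]))" using uW Z by (intro add_span_base) auto
  moreover have "y \<in> add_span (?Z (ls @ [l]))" using y(1) by (rule add_span_mono) auto
  ultimately have "u \<oplus> y \<in> add_span (?Z (ls @ [l]))" using add_span_add Z by blast
  moreover have "u \<oplus> y = x" unfolding u_def using xc yc by (simp add: a_assoc l_neg)
  ultimately show ?case by simp
qed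

end

section \<open>Polynomials in a left multiplication with coefficients acting from the right\<close>

context field_reps
begin

text \<open>Coefficient functions with an explicit cut-off, in place of lists, make addition and
  shifting of polynomials pointwise.\<close>

primrec left_right_eval :: "('k \<Rightarrow> 'a) \<Rightarrow> 'a \<Rightarrow> 'a \<Rightarrow> (nat \<Rightarrow> 'k) \<Rightarrow> nat \<Rightarrow> 'a" where
  "left_right_eval \<beta> A x c 0 = \<zero>"
| "left_right_eval \<beta> A x c (Suc n) = left_right_eval \<beta> A x c n \<oplus> A [^] n \<otimes> x \<otimes> \<beta> (c n)"

context
  fixes \<beta> A x
  assumes \<beta>: "rep \<beta>" and A: "A \<in> carrier R" and x: "x \<in> carrier R"
begin

lemma left_right_eval_closed: "range c \<subseteq> carrier K \<Longrightarrow> left_right_eval \<beta> A x c n \<in> carrier R"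
  using A x rep_closed[OF \<beta>] by (induction n) (auto simp: image_subset_iff)

lemma left_right_eval_add:
  assumes "range c \<subseteq> carrier K" and "range d \<subseteq> carrier K"
  shows "left_right_eval \<beta> A x (\<lambda>i. c i \<oplus>\<^bsub>K\<^esub> d i) n = left_right_eval \<beta> A x c n \<oplus> left_right_eval \<beta> A x d n"
proof (induction n)
  case (Suc n)
  have "c n \<in> carrier K" "d n \<in> carrier K" using assms by auto
  then show ?case
    using Suc A x left_right_eval_closed assms rep_closed[OF \<beta>] rep_add[OF \<beta>]
    by (simp add: r_distr a_ac)
qed simp

lemma left_right_eval_mult:
  assumes "range c \<subseteq> carrier K" and "l \<in> carrier K"
  shows "left_right_eval \<beta> A x (\<lambda>i. l \<otimes>\<^bsub>K\<^esub> c i) n = left_right_eval \<beta> A x c n \<otimes> \<beta> l"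
proof (induction n)
  case (Suc n)
  have "c n \<in> carrier K" using assms by auto
  then have "\<beta> (l \<otimes>\<^bsub>K\<^esub> c n) = \<beta> (c n) \<otimes> \<beta> l" "\<beta> (c n) \<in> carrier R" "\<beta> l \<in> carrier R"
    using assms rep_mult[OF \<beta>] rep_closed[OF \<beta>] rep_commute[OF \<beta>] by auto
  then show ?case
    using Suc A x left_right_eval_closed[OF assms(1)]
    by (simp add: l_distr m_assoc)
qed (use assms rep_closed[OF \<beta>] in simp)

text \<open>The shifted coefficients are those of the polynomial multiplied by
  \<open>X\<close>.\<close>

lemma left_right_eval_shift:
  assumes "range c \<subseteq> carrier K"
  shows "left_right_eval \<beta> A x (\<lambda>i. case i of 0 \<Rightarrow> \<zero>\<^bsub>K\<^esub> | Suc j \<Rightarrow> c j) (Suc n) = A \<otimes> left_right_eval \<beta> A x c n"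
proof (induction n)
  case 0
  then show ?case using A x rep_zero[OF \<beta>] by simp
next
  case (Suc n)
  have "c n \<in> carrier K" using assms by auto
  then have c: "\<beta> (c n) \<in> carrier R" by (rule rep_closed[OF \<beta>])
  have "left_right_eval \<beta> A x (\<lambda>i. case i of 0 \<Rightarrow> \<zero>\<^bsub>K\<^esub> | Suc j \<Rightarrow> c j) (Suc (Suc n))
      = A \<otimes> left_right_eval \<beta> A x c n \<oplus> A [^] Suc n \<otimes> x \<otimes> \<beta> (c n)"
    unfolding Suc[symmetric] by simp
  also have "A [^] Suc n \<otimes> x \<otimes> \<beta> (c n) = A \<otimes> (A [^] n \<otimes> x \<otimes> \<beta> (c n))"
    unfolding nat_pow_Suc2[OF A] using A x c by (simp add: m_assoc)
  finally show ?case
    using A x c left_right_eval_closed[OF assms] by (simp add: r_distr)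
qed

lemma left_right_eval_stable:
  assumes "\<And>i. i \<ge> n \<Longrightarrow> c i = \<zero>\<^bsub>K\<^esub>" and "range c \<subseteq> carrier K"
  shows "left_right_eval \<beta> A x c (n + m) = left_right_eval \<beta> A x c n"
  by (induction m) (use assms rep_zero[OF \<beta>] A x left_right_eval_closed[OF assms(2)] in auto)

lemma left_right_eval_cong:
  assumes "\<And>i. i < n \<Longrightarrow> c i = d i"
  shows "left_right_eval \<beta> A x c n = left_right_eval \<beta> A x d n"
  using assms by (induction n) auto

end

lemma linear_mult_coeff:
  assumes "l \<in> carrier K" and "set q \<subseteq> carrier K"
  shows "K.coeff (K.poly_mult [\<one>\<^bsub>K\<^esub>, \<ominus>\<^bsub>K\<^esub> l] q)
    = (\<lambda>i. (case i of 0 \<Rightarrow> \<zero>\<^bsub>K\<^esub> | Suc j \<Rightarrow> K.coeff q j) \<oplus>\<^bsub>K\<^esub> (\<ominus>\<^bsub>K\<^esub> l) \<otimes>\<^bsub>K\<^esub> K.coeff q i)"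
proof
  fix i
  let ?p = "[\<one>\<^bsub>K\<^esub>, \<ominus>\<^bsub>K\<^esub> l]"
  have p: "set ?p \<subseteq> carrier K" using assms by simp
  have qc: "K.coeff q j \<in> carrier K" for j using assms by simp
  have pc: "K.coeff ?p j \<in> carrier K" for j using K.coeff_in_carrier[OF p] .
  have "K.coeff (K.poly_mult ?p q) i = (\<Oplus>\<^bsub>K\<^esub>j\<in>{..i}. K.coeff ?p j \<otimes>\<^bsub>K\<^esub> K.coeff q (i - j))"
    using K.poly_mult_coeff[OF p assms(2)] by simp
  also have "\<dots> = (case i of 0 \<Rightarrow> \<zero>\<^bsub>K\<^esub> | Suc j \<Rightarrow> K.coeff q j) \<oplus>\<^bsub>K\<^esub> (\<ominus>\<^bsub>K\<^esub> l) \<otimes>\<^bsub>K\<^esub> K.coeff q i"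
  proof (cases i)
    case 0
    then show ?thesis using qc assms by simp
  next
    case (Suc j)
    let ?f = "\<lambda>j. K.coeff ?p j \<otimes>\<^bsub>K\<^esub> K.coeff q (i - j)"
    have f: "?f \<in> A \<rightarrow> carrier K" for A using pc qc by auto
    \<comment> \<open>The linear factor has coefficients only in degrees 0 and 1, so the convolution
      reduces to two terms.\<close>
    have sub: "{0, Suc 0} \<subseteq> {..i}" using Suc by auto
    have "(\<Oplus>\<^bsub>K\<^esub>j\<in>{..i}. ?f j) = (\<Oplus>\<^bsub>K\<^esub>j\<in>{0, Suc 0}. ?f j)"
      by (rule K.add.finprod_mono_neutral_cong_left[symmetric]) (use sub f qc in auto)
    also have "\<dots> = (\<ominus>\<^bsub>K\<^esub> l) \<otimes>\<^bsub>K\<^esub> K.coeff q i \<oplus>\<^bsub>K\<^esub> K.coeff q j"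
      using qc assms Suc by simp
    finally show ?thesis using Suc qc assms by (simp add: K.a_comm)
  qed
  finally show "K.coeff (K.poly_mult ?p q) i
    = (case i of 0 \<Rightarrow> \<zero>\<^bsub>K\<^esub> | Suc j \<Rightarrow> K.coeff q j) \<oplus>\<^bsub>K\<^esub> (\<ominus>\<^bsub>K\<^esub> l) \<otimes>\<^bsub>K\<^esub> K.coeff q i" .
qed

lemma linear_prod_set: "set ls \<subseteq> carrier K \<Longrightarrow> set (K.linear_prod ls) \<subseteq> carrier K"
  using K.linear_prod_closed[of ls] by (auto simp: sym[OF univ_poly_carrier] polynomial_def)

lemma linear_prod_length: "set ls \<subseteq> carrier K \<Longrightarrow> i \<ge> Suc (length ls) \<Longrightarrow> K.coeff (K.linear_prod ls) i = \<zero>\<^bsub>K\<^esub>"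
proof (induction ls arbitrary: i)
  case Nil
  then show ?case by (simp add: K.linear_prod_simps)
next
  case (Cons l ls)
  have "K.coeff (K.linear_prod (l # ls)) i = (case i of 0 \<Rightarrow> \<zero>\<^bsub>K\<^esub> | Suc j \<Rightarrow> K.coeff (K.linear_prod ls) j)
    \<oplus>\<^bsub>K\<^esub> (\<ominus>\<^bsub>K\<^esub> l) \<otimes>\<^bsub>K\<^esub> K.coeff (K.linear_prod ls) i"
    unfolding K.linear_prod_simps using linear_mult_coeff[of l "K.linear_prod ls"] linear_prod_set[of ls] Cons by simp
  then show ?case using Cons by (cases i) auto
qed

text \<open>Left multiplication by \<open>A\<close> commutes with the right multiplications, so
  applying the operators in turn amounts to evaluating the product of the linear factors.\<close>

lemma foldr_eig_diff:
  assumes \<beta>: "rep \<beta>" and A: "A \<in> carrier R" and x: "x \<in> carrier R" "x \<otimes> \<beta> \<one>\<^bsub>K\<^esub> = x"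
    and ls: "set ls \<subseteq> carrier K"
  shows "foldr (eig_diff \<beta> A) ls x = left_right_eval \<beta> A x (K.coeff (K.linear_prod ls)) (Suc (length ls))"
  using ls
proof (induction ls)
  case Nil
  then show ?case using x by (simp add: K.linear_prod_simps)
next
  case (Cons l ls)
  let ?c = "K.coeff (K.linear_prod ls)" and ?n = "Suc (length ls)"
  have l: "l \<in> carrier K" and ls: "set ls \<subseteq> carrier K" using Cons by auto
  have c: "range ?c \<subseteq> carrier K" using K.coeff_in_carrier[OF linear_prod_set[OF ls]] by auto
  have s: "range (\<lambda>i. case i of 0 \<Rightarrow> \<zero>\<^bsub>K\<^esub> | Suc j \<Rightarrow> ?c j) \<subseteq> carrier K"
    using c by (auto simp: image_subset_iff split: nat.splits)
  have m: "range (\<lambda>i. (\<ominus>\<^bsub>K\<^esub> l) \<otimes>\<^bsub>K\<^esub> ?c i) \<subseteq> carrier K" using c l by auto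
  have F: "left_right_eval \<beta> A x ?c ?n \<in> carrier R" by (rule left_right_eval_closed[OF \<beta> A x(1) c])
  have zero: "?c i = \<zero>\<^bsub>K\<^esub>" if "i \<ge> ?n" for i by (rule linear_prod_length[OF ls that])
  \<comment> \<open>The product for \<open>l # ls\<close> has one coefficient more than that for
    \<open>ls\<close>; the evaluation of the latter is padded with a zero term to the same
    length.\<close>
  have st: "left_right_eval \<beta> A x ?c (Suc ?n) = left_right_eval \<beta> A x ?c ?n"
    using left_right_eval_stable[where n = ?n and m = 1, OF \<beta> A x(1) zero c] by simp
  have "left_right_eval \<beta> A x (K.coeff (K.linear_prod (l # ls))) (Suc ?n)
    = A \<otimes> left_right_eval \<beta> A x ?c ?n \<oplus> left_right_eval \<beta> A x ?c ?n \<otimes> \<beta> (\<ominus>\<^bsub>K\<^esub> l)"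
    unfolding K.linear_prod_simps linear_mult_coeff[OF l linear_prod_set[OF ls]]
      left_right_eval_add[OF \<beta> A x(1) s m] left_right_eval_shift[OF \<beta> A x(1) c]
      left_right_eval_mult[OF \<beta> A x(1) c K.a_inv_closed[OF l]] st ..
  also have "\<dots> = eig_diff \<beta> A l (left_right_eval \<beta> A x ?c ?n)"
    unfolding eig_diff_def a_minus_def rep_minus[OF \<beta> l] using F rep_closed[OF \<beta> l] by (simp add: r_minus)
  finally show ?case using Cons ls by simp
qed

text \<open>Coefficients from \<open>k\<close> can be moved across \<open>x\<close> by
  \<open>base_scalar\<close>, which turns the evaluation into the ordinary one inside
  \<open>\<alpha>\<close>. It vanishes when \<open>a\<close> is a root of \<open>p\<close>.\<close>

lemma left_right_eval_base_field:
  assumes \<alpha>: "rep \<alpha>" and \<beta>: "rep \<beta>" and x: "x \<in> between \<alpha> \<beta>" and a: "a \<in> carrier K" and p: "set p \<subseteq> k"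
  shows "left_right_eval \<beta> (\<alpha> a) x (K.coeff p) (length p) = \<alpha> (K.eval p a) \<otimes> x"
  using p
proof (induction p)
  case Nil
  then show ?case using rep_zero[OF \<alpha>] between_closed[OF x] by simp
next
  case (Cons c p)
  have kK: "k \<subseteq> carrier K" using subfieldE(3)[OF k] .
  have c: "c \<in> k" "c \<in> carrier K" and p: "set p \<subseteq> carrier K" using Cons kK by auto
  have ac: "\<alpha> b \<in> carrier R" if "b \<in> carrier K" for b using rep_closed[OF \<alpha> that] .
  have xc: "x \<in> carrier R" "\<alpha> \<one>\<^bsub>K\<^esub> \<otimes> x = x" using x by (auto simp: between_def)
  have pow: "\<alpha> a [^] n \<otimes> x = \<alpha> (a [^]\<^bsub>K\<^esub> n) \<otimes> x" for n :: nat
  proof (induction n)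
    case (Suc n)
    have "\<alpha> a [^] Suc n \<otimes> x = \<alpha> a \<otimes> (\<alpha> a [^] n \<otimes> x)"
      unfolding nat_pow_Suc2[OF ac[OF a]] using xc ac[OF a] by (simp add: m_assoc)
    also have "\<dots> = \<alpha> (a \<otimes>\<^bsub>K\<^esub> a [^]\<^bsub>K\<^esub> n) \<otimes> x"
      unfolding Suc using rep_mult[OF \<alpha> a, of "a [^]\<^bsub>K\<^esub> n"] a ac xc by (simp add: m_assoc)
    finally show ?case using a by (simp only: K.nat_pow_Suc2)
  qed (use xc in simp)
  have "left_right_eval \<beta> (\<alpha> a) x (K.coeff (c # p)) (length p) = left_right_eval \<beta> (\<alpha> a) x (K.coeff p) (length p)"
    by (rule left_right_eval_cong[OF \<beta> ac[OF a] xc(1)]) auto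
  also have "\<dots> = \<alpha> (K.eval p a) \<otimes> x" using Cons by simp
  finally have 1: "left_right_eval \<beta> (\<alpha> a) x (K.coeff (c # p)) (length p) = \<alpha> (K.eval p a) \<otimes> x" .
  have "\<alpha> a [^] length p \<otimes> x \<otimes> \<beta> c = \<alpha> (a [^]\<^bsub>K\<^esub> length p) \<otimes> (\<alpha> c \<otimes> x)"
    using pow[of "length p"] base_scalar[OF \<alpha> \<beta> x c(1)] xc ac a rep_closed[OF \<beta> c(2)] by (simp add: m_assoc)
  also have "\<dots> = \<alpha> (c \<otimes>\<^bsub>K\<^esub> a [^]\<^bsub>K\<^esub> length p) \<otimes> x"
    using rep_mult[OF \<alpha>, of "a [^]\<^bsub>K\<^esub> length p" c] K.m_comm[of c "a [^]\<^bsub>K\<^esub> length p"] c a ac xc by (simp add: m_assoc)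
  finally have 2: "\<alpha> a [^] length p \<otimes> x \<otimes> \<beta> c = \<alpha> (c \<otimes>\<^bsub>K\<^esub> a [^]\<^bsub>K\<^esub> length p) \<otimes> x" .
  have ec: "K.eval p a \<in> carrier K" using K.eval_in_carrier[OF p a] .
  have "left_right_eval \<beta> (\<alpha> a) x (K.coeff (c # p)) (length (c # p))
    = \<alpha> (K.eval p a) \<otimes> x \<oplus> \<alpha> (c \<otimes>\<^bsub>K\<^esub> a [^]\<^bsub>K\<^esub> length p) \<otimes> x"
    using 1 2 by simp
  also have "\<dots> = \<alpha> (K.eval (c # p) a) \<otimes> x"
    using rep_add[OF \<alpha>, of "c \<otimes>\<^bsub>K\<^esub> a [^]\<^bsub>K\<^esub> length p" "K.eval p a"] ec c a ac xc
    by (simp add: l_distr a_comm)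
  finally show ?case .
qed

end

section \<open>Decomposition into semilinear elements\<close>

locale galois_reps = field_reps R K k \<eta> for R (structure) and K :: "'k ring" and k and \<eta> +
  assumes separable: "separable_extension K k" and normal: "normal_extension K k"
    and finite_extension: "ring.finite_dimension K k (carrier K)"
begin

lemma base_subset: "k \<subseteq> carrier K"
  using subfieldE(3)[OF k] .

text \<open>A polynomial over \<open>k\<close> with root \<open>a\<close> annihilates
  \<open>x\<close> by \<open>left_right_eval_base_field\<close>, and its factorization makes this a
  product of operators \<open>eig_diff\<close>. \<open>W\<close> is general so that the eigenspaces
  of one element can be decomposed again for the next.\<close>

lemma eigenvectors_span:
  assumes \<alpha>: "rep \<alpha>" and \<beta>: "rep \<beta>" and a: "a \<in> carrier K"
    and W: "W \<subseteq> between \<alpha> \<beta>" "\<zero> \<in> W"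
    and W_add: "\<And>x y. x \<in> W \<Longrightarrow> y \<in> W \<Longrightarrow> x \<oplus> y \<in> W" and W_minus: "\<And>x. x \<in> W \<Longrightarrow> \<ominus> x \<in> W"
    and W_A: "\<And>x. x \<in> W \<Longrightarrow> \<alpha> a \<otimes> x \<in> W"
    and W_mult: "\<And>x l. x \<in> W \<Longrightarrow> l \<in> carrier K \<Longrightarrow> x \<otimes> \<beta> l \<in> W"
    and x: "x \<in> W"
  shows "x \<in> add_span {w \<in> W. \<exists>l\<in>carrier K. \<alpha> a \<otimes> w = w \<otimes> \<beta> l}"
proof -
  obtain ls where ls: "distinct ls" "set ls \<subseteq> carrier K" "set (K.linear_prod ls) \<subseteq> k"
      "K.eval (K.linear_prod ls) a = \<zero>\<^bsub>K\<^esub>"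
    using normal_separable_linear_prod[OF K.field_axioms k separable normal a] by blast
  let ?p = "K.linear_prod ls"
  have xb: "x \<in> between \<alpha> \<beta>" and xc: "x \<in> carrier R" "x \<otimes> \<beta> \<one>\<^bsub>K\<^esub> = x"
    using W x by (auto simp: between_def)
  have A: "\<alpha> a \<in> carrier R" by (rule rep_closed[OF \<alpha> a])
  have c: "range (K.coeff ?p) \<subseteq> carrier K"
    using K.coeff_in_carrier[OF linear_prod_set[OF ls(2)]] by auto
  have zero: "K.coeff ?p i = \<zero>\<^bsub>K\<^esub>" if "i \<ge> Suc (length ls)" for i
    by (rule linear_prod_length[OF ls(2) that])
  \<comment> \<open>One evaluation is cut off at \<open>Suc (length ls)\<close>, the other at
    \<open>length ?p\<close>; both agree with the one at the sum of the bounds, as all further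
    coefficients are zero.\<close>
  note stable = left_right_eval_stable[OF \<beta> A xc(1) _ c]
  have "left_right_eval \<beta> (\<alpha> a) x (K.coeff ?p) (Suc (length ls))
      = left_right_eval \<beta> (\<alpha> a) x (K.coeff ?p) (Suc (length ls) + length ?p)"
    by (rule stable[OF zero, symmetric])
  also have "\<dots> = left_right_eval \<beta> (\<alpha> a) x (K.coeff ?p) (length ?p)"
    unfolding add.commute[of "Suc (length ls)"] by (rule stable[OF K.coeff_length])
  also have "\<dots> = \<zero>"
    unfolding left_right_eval_base_field[OF \<alpha> \<beta> xb a ls(3)] ls(4) rep_zero[OF \<alpha>] using xc by simp
  finally have "foldr (eig_diff \<beta> (\<alpha> a)) ls x = \<zero>"
    unfolding foldr_eig_diff[OF \<beta> A xc ls(2)] .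
  then have "x \<in> add_span {w \<in> W. \<exists>l\<in>set ls. \<alpha> a \<otimes> w = w \<otimes> \<beta> l}"
    using W by (intro eigenvector_decomposition[OF \<beta> A _ _ W(2) W_add W_minus W_A W_mult ls(1,2) x])
      (auto simp: between_def)
  then show ?thesis by (rule add_span_mono) (use ls(2) in auto)
qed

text \<open>The elements of \<alpha>(K) commute with each other, so a joint eigenspace for
  \<open>as\<close> is preserved by \<open>\<alpha> a\<close> and can be decomposed once
  more.\<close>

lemma simultaneous_eigenvectors_span:
  assumes \<alpha>: "rep \<alpha>" and \<beta>: "rep \<beta>" and x: "x \<in> between \<alpha> \<beta>" and as: "set as \<subseteq> carrier K"
  shows "x \<in> add_span {w \<in> between \<alpha> \<beta>. \<forall>a\<in>set as. \<exists>l\<in>carrier K. \<alpha> a \<otimes> w = w \<otimes> \<beta> l}"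
  using as
proof (induction as)
  case Nil
  then show ?case by (simp add: add_span_base[OF x] between_closed subset_iff)
next
  case (Cons a as)
  let ?Z = "\<lambda>as. {w \<in> between \<alpha> \<beta>. \<forall>a\<in>set as. \<exists>l\<in>carrier K. \<alpha> a \<otimes> w = w \<otimes> \<beta> l}"
  have a: "a \<in> carrier K" and as: "set as \<subseteq> carrier K" using Cons by auto
  have Z: "?Z bs \<subseteq> carrier R" for bs using between_closed by auto
  have c: "\<alpha> b \<in> carrier R" "\<beta> b \<in> carrier R" if "b \<in> carrier K" for b
    using rep_closed \<alpha> \<beta> that by auto
  have "x \<in> add_span (?Z as)" using Cons by simp
  moreover have "w \<in> add_span (?Z (a # as))" if w: "w \<in> ?Z as" for w
  proof -
    obtain m where m: "\<And>b. b \<in> set as \<Longrightarrow> m b \<in> carrier K \<and> \<alpha> b \<otimes> w = w \<otimes> \<beta> (m b)"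
      using w by (auto) metis
    \<comment> \<open>The eigenvalues are fixed to those of \<open>w\<close>, because the set of all
      joint eigenvectors is not closed under addition.\<close>
    let ?W = "{w \<in> between \<alpha> \<beta>. \<forall>b\<in>set as. \<alpha> b \<otimes> w = w \<otimes> \<beta> (m b)}"
    have "w \<in> add_span {w \<in> ?W. \<exists>l\<in>carrier K. \<alpha> a \<otimes> w = w \<otimes> \<beta> l}"
    proof (rule eigenvectors_span[OF \<alpha> \<beta> a])
      show "?W \<subseteq> between \<alpha> \<beta>" by auto
      show "\<zero> \<in> ?W" using zero_between[OF \<alpha> \<beta>] c m as by (auto simp: subset_iff)
      show "u \<oplus> v \<in> ?W" if "u \<in> ?W" "v \<in> ?W" for u v
        using that between_add[OF \<alpha> \<beta>] c m as between_closed by (auto simp: subset_iff l_distr r_distr)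
      show "\<ominus> u \<in> ?W" if "u \<in> ?W" for u
        using that between_minus[OF \<alpha> \<beta>] c m as between_closed by (auto simp: subset_iff l_minus r_minus)
      show "\<alpha> a \<otimes> u \<in> ?W" if u: "u \<in> ?W" for u
      proof -
        have uc: "u \<in> carrier R" using u between_closed by auto
        have "\<alpha> b \<otimes> (\<alpha> a \<otimes> u) = \<alpha> a \<otimes> u \<otimes> \<beta> (m b)" if b: "b \<in> set as" for b
        proof -
          have bc: "b \<in> carrier K" using b as by auto
          have "\<alpha> b \<otimes> (\<alpha> a \<otimes> u) = \<alpha> a \<otimes> (\<alpha> b \<otimes> u)"
            using m_assoc[of "\<alpha> b" "\<alpha> a" u] m_assoc[of "\<alpha> a" "\<alpha> b" u] rep_commute[OF \<alpha> a bc] c a bc uc by simp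
          then show ?thesis using u b m[OF b] c a uc by (simp add: m_assoc)
        qed
        then show ?thesis using u between_mult[OF \<alpha> \<beta> _ a] by auto
      qed
      show "u \<otimes> \<beta> l \<in> ?W" if u: "u \<in> ?W" and l: "l \<in> carrier K" for u l
      proof -
        have uc: "u \<in> carrier R" using u between_closed by auto
        have "\<alpha> b \<otimes> (u \<otimes> \<beta> l) = u \<otimes> \<beta> l \<otimes> \<beta> (m b)" if b: "b \<in> set as" for b
        proof -
          have bc: "b \<in> carrier K" using b as by auto
          have "\<alpha> b \<otimes> (u \<otimes> \<beta> l) = u \<otimes> \<beta> (m b) \<otimes> \<beta> l"
            using u b m_assoc[of "\<alpha> b" u "\<beta> l"] c bc l uc by simp
          then show ?thesis using rep_commute[OF \<beta> l, of "m b"] m[OF b] c l uc by (simp add: m_assoc)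
        qed
        then show ?thesis using u between_mult[OF \<alpha> \<beta> _ l] by auto
      qed
      show "w \<in> ?W" using w m by auto
    qed
    then show ?thesis by (rule add_span_mono) (use m in auto)
  qed
  ultimately show ?case by (rule add_span_trans[OF _ _ Z])
qed

text \<open>Eigenvalues add up, and scalars from \<open>k\<close> act alike from both sides; so the
  elements of \<open>K\<close> that have \<open>w\<close> as an eigenvector form a
  \<open>k\<close>-subspace.\<close>

lemma eigenvector_Span:
  assumes \<alpha>: "rep \<alpha>" and \<beta>: "rep \<beta>" and w: "w \<in> between \<alpha> \<beta>"
    and as: "set as \<subseteq> carrier K" and eig: "\<And>a. a \<in> set as \<Longrightarrow> \<exists>l\<in>carrier K. \<alpha> a \<otimes> w = w \<otimes> \<beta> l"
    and a: "a \<in> K.Span k as"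
  shows "\<exists>l\<in>carrier K. \<alpha> a \<otimes> w = w \<otimes> \<beta> l"
  using as eig a
proof (induction as arbitrary: a)
  case Nil
  then have "a = \<zero>\<^bsub>K\<^esub>" by simp
  then show ?case
    by (intro bexI[of _ "\<zero>\<^bsub>K\<^esub>"]) (use rep_zero[OF \<alpha>] rep_zero[OF \<beta>] between_closed[OF w] in auto)
next
  case (Cons b as)
  obtain c v where c: "c \<in> k" and v: "v \<in> K.Span k as" and a: "a = c \<otimes>\<^bsub>K\<^esub> b \<oplus>\<^bsub>K\<^esub> v"
    using Cons(4) by (auto simp: K.line_extension_mem_iff)
  have vc: "v \<in> carrier K" using K.Span_in_carrier[OF base_subset, of as] v Cons by auto
  have cc: "c \<in> carrier K" and b: "b \<in> carrier K" using c base_subset Cons by auto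
  obtain l where l: "l \<in> carrier K" "\<alpha> b \<otimes> w = w \<otimes> \<beta> l" using Cons(3)[of b] by auto
  obtain l' where l': "l' \<in> carrier K" "\<alpha> v \<otimes> w = w \<otimes> \<beta> l'" 
    using Cons(1)[OF _ Cons(3) v] Cons(2) by (metis list.set_intros(2) set_subset_Cons subset_trans)
  have wc: "w \<in> carrier R" using between_closed[OF w] .
  note r = rep_closed[OF \<alpha>] rep_closed[OF \<beta>]
  have "\<alpha> (c \<otimes>\<^bsub>K\<^esub> b) \<otimes> w = \<alpha> c \<otimes> w \<otimes> \<beta> l"
    using rep_mult[OF \<alpha> cc b] l r cc b wc by (simp add: m_assoc)
  also have "\<dots> = w \<otimes> \<beta> (c \<otimes>\<^bsub>K\<^esub> l)"
    using base_scalar[OF \<alpha> \<beta> w c] rep_mult[OF \<beta> cc l(1)] r cc l wc by (simp add: m_assoc)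
  finally have "\<alpha> a \<otimes> w = w \<otimes> \<beta> (c \<otimes>\<^bsub>K\<^esub> l \<oplus>\<^bsub>K\<^esub> l')"
    unfolding a using rep_add[OF \<alpha>, of "c \<otimes>\<^bsub>K\<^esub> b" v] rep_add[OF \<beta>, of "c \<otimes>\<^bsub>K\<^esub> l" l'] r cc b vc l l' wc
    by (simp add: l_distr r_distr)
  then show ?case using cc l l' by blast
qed

lemma rep_inj:
  assumes \<beta>: "rep \<beta>" and w: "w \<in> carrier R" "w \<otimes> \<beta> \<one>\<^bsub>K\<^esub> = w" "w \<noteq> \<zero>"
    and bc: "b \<in> carrier K" "c \<in> carrier K" "w \<otimes> \<beta> b = w \<otimes> \<beta> c"
  shows "b = c"
proof (rule ccontr)
  note r = rep_closed[OF \<beta>]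
  assume "b \<noteq> c"
  then have d: "b \<ominus>\<^bsub>K\<^esub> c \<noteq> \<zero>\<^bsub>K\<^esub>" using bc by (simp add: K.r_right_minus_eq)
  have "w \<otimes> \<beta> (b \<ominus>\<^bsub>K\<^esub> c) = w \<otimes> \<beta> b \<oplus> \<ominus> (w \<otimes> \<beta> c)"
    unfolding a_minus_def using rep_add[OF \<beta>, of b "\<ominus>\<^bsub>K\<^esub> c"] rep_minus[OF \<beta>, of c] bc r w
    by (simp add: r_distr r_minus)
  also have "\<dots> = \<zero>" using bc r w by (simp add: r_neg)
  finally show False using rep_cancel[OF \<beta> w(1,2) _ d] bc w by simp
qed

text \<open>As \<open>w\<close> is nonzero, \<open>rep_inj\<close> makes an eigenvalue unique. The
  eigenvalues therefore inherit additivity and multiplicativity from \<open>\<alpha>\<close>, and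
  \<open>base_scalar\<close> shows that they fix \<open>k\<close>.\<close>

lemma eigencharacter_in_galois_group:
  assumes \<alpha>: "rep \<alpha>" and \<beta>: "rep \<beta>" and w: "w \<in> between \<alpha> \<beta>" "w \<noteq> \<zero>"
    and m: "\<And>a. a \<in> carrier K \<Longrightarrow> m a \<in> carrier K \<and> \<alpha> a \<otimes> w = w \<otimes> \<beta> (m a)"
  shows "m \<in> galois_group K k"
proof -
  have wc: "w \<in> carrier R" "w \<otimes> \<beta> \<one>\<^bsub>K\<^esub> = w" "\<alpha> \<one>\<^bsub>K\<^esub> \<otimes> w = w" using w by (auto simp: between_def)
  note r = rep_closed[OF \<alpha>] rep_closed[OF \<beta>]
  note inj = rep_inj[OF \<beta> wc(1,2) w(2)]
  have mc: "m a \<in> carrier K" "\<alpha> a \<otimes> w = w \<otimes> \<beta> (m a)" if "a \<in> carrier K" for a using m that by auto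
  have "m \<in> ring_hom K K"
  proof (rule ring_hom_memI)
    fix a b assume ab: "a \<in> carrier K" "b \<in> carrier K"
    show "m (a \<oplus>\<^bsub>K\<^esub> b) = m a \<oplus>\<^bsub>K\<^esub> m b"
    proof (rule inj)
      show "w \<otimes> \<beta> (m (a \<oplus>\<^bsub>K\<^esub> b)) = w \<otimes> \<beta> (m a \<oplus>\<^bsub>K\<^esub> m b)"
        using mc(2)[of "a \<oplus>\<^bsub>K\<^esub> b", symmetric] rep_add[OF \<alpha> ab] rep_add[OF \<beta> mc(1) mc(1), OF ab] r mc ab wc
        by (simp add: l_distr r_distr)
    qed (use ab mc in auto)
    show "m (a \<otimes>\<^bsub>K\<^esub> b) = m a \<otimes>\<^bsub>K\<^esub> m b"
    proof (rule inj)
      have "w \<otimes> \<beta> (m (a \<otimes>\<^bsub>K\<^esub> b)) = \<alpha> a \<otimes> (\<alpha> b \<otimes> w)"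
        using mc(2)[of "a \<otimes>\<^bsub>K\<^esub> b", symmetric] rep_mult[OF \<alpha> ab] r ab wc by (simp add: m_assoc)
      also have "\<dots> = \<alpha> a \<otimes> w \<otimes> \<beta> (m b)" 
        unfolding mc(2)[OF ab(2)] using m_assoc[of "\<alpha> a" w "\<beta> (m b)"] r ab mc(1) wc by simp
      also have "\<dots> = w \<otimes> \<beta> (m a \<otimes>\<^bsub>K\<^esub> m b)"
        unfolding mc(2)[OF ab(1)] using rep_mult[OF \<beta> mc(1) mc(1), OF ab] r ab mc wc by (simp add: m_assoc)
      finally show "w \<otimes> \<beta> (m (a \<otimes>\<^bsub>K\<^esub> b)) = w \<otimes> \<beta> (m a \<otimes>\<^bsub>K\<^esub> m b)" .
    qed (use ab mc in auto)
  next
    show "m \<one>\<^bsub>K\<^esub> = \<one>\<^bsub>K\<^esub>"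
      by (rule inj) (use mc(1) mc(2)[of "\<one>\<^bsub>K\<^esub>"] wc in auto)
  qed (use mc in auto)
  moreover have "m c = c" if c: "c \<in> k" for c
    by (rule inj) (use c base_subset mc mc(2)[of c] base_scalar[OF \<alpha> \<beta> w(1) c] in auto)
  moreover have "(K.algebraic over k) a" if "a \<in> carrier K" for a
    using separable that by (simp add: separable_extension_def)
  ultimately show ?thesis
    by (intro algebraic_endomorphism_in_galois_group[OF K.field_axioms k])
qed

text \<open>Only a finite basis of \<open>K\<close> over \<open>k\<close> has to be diagonalized;
  \<open>eigenvector_Span\<close> extends the eigenvalues to all of \<open>K\<close>.\<close>

lemma semi_span:
  assumes \<alpha>: "rep \<alpha>" and \<beta>: "rep \<beta>" and x: "x \<in> between \<alpha> \<beta>"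
  shows "x \<in> add_span (\<Union>\<psi>\<in>galois_group K k. semi \<alpha> \<beta> \<psi>)"
proof -
  obtain as where as: "set as \<subseteq> carrier K" "K.Span k as = carrier K"
    using finite_extension K.exists_base[OF k] unfolding K.finite_dimension_def by blast
  have "x \<in> add_span {w \<in> between \<alpha> \<beta>. \<forall>a\<in>set as. \<exists>l\<in>carrier K. \<alpha> a \<otimes> w = w \<otimes> \<beta> l}"
    by (rule simultaneous_eigenvectors_span[OF \<alpha> \<beta> x as(1)])
  then show ?thesis
  proof (rule add_span_trans[OF _ _ semi_subset])
    fix w assume "w \<in> {w \<in> between \<alpha> \<beta>. \<forall>a\<in>set as. \<exists>l\<in>carrier K. \<alpha> a \<otimes> w = w \<otimes> \<beta> l}"
    then have w: "w \<in> between \<alpha> \<beta>" and e: "\<And>a. a \<in> set as \<Longrightarrow> \<exists>l\<in>carrier K. \<alpha> a \<otimes> w = w \<otimes> \<beta> l" by auto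
    show "w \<in> add_span (\<Union>\<psi>\<in>galois_group K k. semi \<alpha> \<beta> \<psi>)"
    \<comment> \<open>The eigenvalues of zero are arbitrary and need not form a
      homomorphism.\<close>
    proof (cases "w = \<zero>")
      case True
      then show ?thesis by (simp add: add_span.zero)
    next
      case False
      have "\<forall>a\<in>carrier K. \<exists>l\<in>carrier K. \<alpha> a \<otimes> w = w \<otimes> \<beta> l"
        using eigenvector_Span[OF \<alpha> \<beta> w as(1) e] as(2) by simp
      then obtain m where m: "\<And>a. a \<in> carrier K \<Longrightarrow> m a \<in> carrier K \<and> \<alpha> a \<otimes> w = w \<otimes> \<beta> (m a)"
        by metis
      have "m \<in> galois_group K k" by (rule eigencharacter_in_galois_group[OF \<alpha> \<beta> w False m])
      moreover have "w \<in> semi \<alpha> \<beta> m" using w m by (simp add: semi_def)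
      ultimately show ?thesis by (intro add_span_base[OF _ semi_subset]) auto
    qed
  qed
qed

end

section \<open>Independence of characters\<close>

context field_reps
begin

text \<open>Dedekind's independence argument: a product of the maps \<open>x \<mapsto> \<beta>(a) x - x \<beta>(\<psi> a)\<close> kills \<open>w\<close> but multiplies
  every \<open>z\<close> that commutes with \<open>\<beta>\<close> by one nonzero scalar.\<close>

lemma nontrivial_semi_annihilator:
  assumes \<beta>: "rep \<beta>" and G: "G \<subseteq> carrier K \<rightarrow> carrier K"
    and nontriv: "\<forall>\<psi>\<in>G. \<exists>a\<in>carrier K. \<psi> a \<noteq> a"
    and w: "w \<in> add_span (\<Union>\<psi>\<in>G. semi \<beta> \<beta> \<psi>)"
  shows "\<exists>T. (\<forall>x\<in>carrier R. T x \<in> carrier R) \<and> (\<forall>x\<in>carrier R. \<forall>y\<in>carrier R. T (x \<oplus> y) = T x \<oplus> T y) \<and>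
      T w = \<zero> \<and> (\<forall>\<psi>\<in>G. \<forall>x\<in>semi \<beta> \<beta> \<psi>. T x \<in> semi \<beta> \<beta> \<psi>) \<and>
      (\<exists>b\<in>carrier K. b \<noteq> \<zero>\<^bsub>K\<^esub> \<and> (\<forall>z\<in>semi \<beta> \<beta> id. T z = z \<otimes> \<beta> b))"
  using w
proof induction
  case zero
  \<comment> \<open>The empty product of operators is the identity, with scalar 1.\<close>
  show ?case
    by (intro exI[of _ "\<lambda>x. x"] conjI bexI[of _ "\<one>\<^bsub>K\<^esub>"]) (auto simp: semi_def between_def)
next
  case (step y w)
  then obtain T b where IH: "\<forall>x\<in>carrier R. T x \<in> carrier R"
      "\<forall>x\<in>carrier R. \<forall>y\<in>carrier R. T (x \<oplus> y) = T x \<oplus> T y"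
      "\<forall>\<psi>\<in>G. \<forall>x\<in>semi \<beta> \<beta> \<psi>. T x \<in> semi \<beta> \<beta> \<psi>"
      "\<forall>z\<in>semi \<beta> \<beta> id. T z = z \<otimes> \<beta> b"
    and Tw: "T w = \<zero>" and b: "b \<in> carrier K" "b \<noteq> \<zero>\<^bsub>K\<^esub>"
    by (elim exE conjE bexE) iprover
  note Tc = IH(1)[rule_format] and Ta = IH(2)[rule_format] and Ts = IH(3)[rule_format]
    and Tb = IH(4)[rule_format]
  obtain \<psi> where \<psi>: "\<psi> \<in> G" "y \<in> semi \<beta> \<beta> \<psi>" using step by auto
  obtain a where a: "a \<in> carrier K" "\<psi> a \<noteq> a" using nontriv \<psi> by blast
  have pa: "\<psi> a \<in> carrier K" using G \<psi> a by auto
  note r = rep_closed[OF \<beta>]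
  \<comment> \<open>The new factor is chosen to kill \<open>T y\<close>, which lies in the same
    class \<open>\<psi>\<close> as \<open>y\<close>; it is applied after \<open>T\<close>, so
    \<open>w\<close> is still killed.\<close>
  define T' where "T' x = \<beta> a \<otimes> T x \<oplus> \<ominus> (T x \<otimes> \<beta> (\<psi> a))" for x
  have yc: "y \<in> carrier R" "w \<in> carrier R"
    using \<psi> semi_closed add_span_closed[OF step(2) semi_subset] by auto
  have 1: "T' x \<in> carrier R" if "x \<in> carrier R" for x using that Tc a pa r by (simp add: T'_def)
  have 2: "T' (x \<oplus> y) = T' x \<oplus> T' y" if "x \<in> carrier R" "y \<in> carrier R" for x y
    using that Tc Ta a pa r by (simp add: T'_def l_distr r_distr minus_add a_ac)
  have "T' y = \<zero>"
    using Ts[OF \<psi>] a pa r Tc yc by (simp add: T'_def semi_def r_neg)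
  moreover have "T' w = \<zero>" using Tw a pa r by (simp add: T'_def)
  ultimately have 3: "T' (y \<oplus> w) = \<zero>" using 2 yc by simp
  have 4: "T' x \<in> semi \<beta> \<beta> \<tau>" if \<tau>: "\<tau> \<in> G" "x \<in> semi \<beta> \<beta> \<tau>" for \<tau> x
  proof -
    have t: "T x \<in> semi \<beta> \<beta> \<tau>" using Ts \<tau> by blast
    then have tc: "T x \<in> carrier R" and tb: "T x \<in> between \<beta> \<beta>"
      and te: "\<And>c. c \<in> carrier K \<Longrightarrow> \<beta> c \<otimes> T x = T x \<otimes> \<beta> (\<tau> c)"
      by (auto simp: semi_def between_def)
    have "T' x \<in> between \<beta> \<beta>"
      unfolding T'_def by (intro between_add[OF \<beta> \<beta>] between_minus[OF \<beta> \<beta>] between_mult[OF \<beta> \<beta>] tb a(1) pa)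
    moreover have "\<beta> c \<otimes> T' x = T' x \<otimes> \<beta> (\<tau> c)" if c: "c \<in> carrier K" for c
    proof -
      have tau: "\<tau> c \<in> carrier K" using G \<tau> c by auto
      have "\<beta> c \<otimes> (\<beta> a \<otimes> T x) = \<beta> a \<otimes> (\<beta> c \<otimes> T x)"
        using m_assoc[of "\<beta> c" "\<beta> a" "T x"] m_assoc[of "\<beta> a" "\<beta> c" "T x"] rep_commute[OF \<beta> c a(1)] r c a tc by simp
      also have "\<dots> = \<beta> a \<otimes> T x \<otimes> \<beta> (\<tau> c)"
        unfolding te[OF c] using r a tau tc by (simp add: m_assoc)
      finally have A: "\<beta> c \<otimes> (\<beta> a \<otimes> T x) = \<beta> a \<otimes> T x \<otimes> \<beta> (\<tau> c)" .
      have "\<beta> c \<otimes> (T x \<otimes> \<beta> (\<psi> a)) = T x \<otimes> \<beta> (\<tau> c) \<otimes> \<beta> (\<psi> a)"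
        unfolding te[OF c, symmetric] using r c pa tc by (simp add: m_assoc)
      also have "\<dots> = T x \<otimes> \<beta> (\<psi> a) \<otimes> \<beta> (\<tau> c)"
        using rep_commute[OF \<beta> tau pa] r tau pa tc by (simp add: m_assoc)
      finally have B: "\<beta> c \<otimes> (T x \<otimes> \<beta> (\<psi> a)) = T x \<otimes> \<beta> (\<psi> a) \<otimes> \<beta> (\<tau> c)" .
      show ?thesis
        unfolding T'_def using r c a pa tau tc A B by (simp add: l_distr r_distr l_minus r_minus)
    qed
    ultimately show ?thesis by (simp add: semi_def)
  qed
  \<comment> \<open>On elements commuting with \<open>\<beta>\<close>, the new factor contributes
    the scalar \<open>a - \<psi> a\<close>, nonzero by the choice of \<open>a\<close>.\<close>
  define d where "d = b \<otimes>\<^bsub>K\<^esub> (a \<oplus>\<^bsub>K\<^esub> \<ominus>\<^bsub>K\<^esub> \<psi> a)"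
  have d0: "a \<oplus>\<^bsub>K\<^esub> \<ominus>\<^bsub>K\<^esub> \<psi> a \<noteq> \<zero>\<^bsub>K\<^esub>"
    using a pa K.r_right_minus_eq[of a "\<psi> a"] by (auto simp: a_minus_def)
  have d: "d \<in> carrier K" "d \<noteq> \<zero>\<^bsub>K\<^esub>"
    using a pa b d0 K.integral[of b "a \<oplus>\<^bsub>K\<^esub> \<ominus>\<^bsub>K\<^esub> \<psi> a"] by (auto simp: d_def)
  have 5: "T' z = z \<otimes> \<beta> d" if z: "z \<in> semi \<beta> \<beta> id" for z
  proof -
    have zc: "z \<in> carrier R" and ze: "\<beta> a \<otimes> z = z \<otimes> \<beta> a" using z a by (auto simp: semi_def between_def)
    have "\<beta> a \<otimes> (z \<otimes> \<beta> b) = z \<otimes> (\<beta> b \<otimes> \<beta> a)"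
      using m_assoc[of "\<beta> a" z "\<beta> b"] ze rep_commute[OF \<beta> a(1) b(1)] r a b zc by (simp add: m_assoc)
    then have "T' z = z \<otimes> (\<beta> b \<otimes> \<beta> a) \<oplus> \<ominus> (z \<otimes> (\<beta> b \<otimes> \<beta> (\<psi> a)))"
      unfolding T'_def Tb[OF z] using r b pa zc by (simp add: m_assoc)
    also have "\<dots> = z \<otimes> (\<beta> b \<otimes> (\<beta> a \<oplus> \<ominus> \<beta> (\<psi> a)))"
      using r a pa b zc by (simp add: r_distr r_minus)
    also have "\<beta> b \<otimes> (\<beta> a \<oplus> \<ominus> \<beta> (\<psi> a)) = \<beta> d"
      unfolding d_def using rep_mult[OF \<beta> b(1), of "a \<oplus>\<^bsub>K\<^esub> \<ominus>\<^bsub>K\<^esub> \<psi> a"]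
        rep_add[OF \<beta> a(1), of "\<ominus>\<^bsub>K\<^esub> \<psi> a"] rep_minus[OF \<beta> pa] a pa by simp
    finally show ?thesis .
  qed
  show ?case
    by (intro exI[of _ T'] conjI ballI bexI[of _ d]) (fact 1 2 3 4 5 d)+
qed

text \<open>An operator that kills \<open>w\<close> also kills \<open>z\<close>, because their sum
  is zero; but on \<open>z\<close> it is multiplication by a nonzero scalar.\<close>

lemma semi_id_independent:
  assumes \<beta>: "rep \<beta>" and G: "G \<subseteq> carrier K \<rightarrow> carrier K"
    and nontriv: "\<forall>\<psi>\<in>G. \<exists>a\<in>carrier K. \<psi> a \<noteq> a"
    and w: "w \<in> add_span (\<Union>\<psi>\<in>G. semi \<beta> \<beta> \<psi>)"
    and z: "z \<in> semi \<beta> \<beta> id" and zw: "z \<oplus> w = \<zero>"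
  shows "z = \<zero>"
proof -
  obtain T b where T: "\<forall>x\<in>carrier R. T x \<in> carrier R"
      "\<forall>x\<in>carrier R. \<forall>y\<in>carrier R. T (x \<oplus> y) = T x \<oplus> T y"
      "\<forall>z\<in>semi \<beta> \<beta> id. T z = z \<otimes> \<beta> b"
    and Tw: "T w = \<zero>" and b: "b \<in> carrier K" "b \<noteq> \<zero>\<^bsub>K\<^esub>"
    using nontrivial_semi_annihilator[OF \<beta> G nontriv w] by (elim exE conjE bexE) iprover
  note Tc = T(1)[rule_format] and Ta = T(2)[rule_format] and Tb = T(3)[rule_format, OF z]
  have zc: "z \<in> carrier R" "w \<in> carrier R"
    using z semi_closed add_span_closed[OF w semi_subset] by auto
  have "T \<zero> \<oplus> T \<zero> = T \<zero>" using Ta[of \<zero> \<zero>] by simp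
  then have T0: "T \<zero> = \<zero>" using Tc[of \<zero>] add.l_cancel_one by simp
  have "T z \<oplus> T w = \<zero>" using Ta[OF zc] zw T0 by simp
  then have "z \<otimes> \<beta> b = \<zero>" using Tw Tb Tc[OF zc(1)] by simp
  then show ?thesis
    using rep_cancel[OF \<beta> zc(1) _ b] z by (simp add: semi_def between_def)
qed

end

context galois_reps
begin

lemma galois_group_closed: "\<psi> \<in> galois_group K k \<Longrightarrow> a \<in> carrier K \<Longrightarrow> \<psi> a \<in> carrier K"
  by (auto simp: galois_group_def ring_iso_def ring_hom_def)

text \<open>\<open>\<psi>\<close> is applied first because \<open>\<alpha> a\<close>, moving to the
  right, meets \<open>x\<close> before \<open>y\<close>.\<close>

lemma semi_mult:
  assumes \<alpha>: "rep \<alpha>" and \<beta>: "rep \<beta>" and \<gamma>: "rep \<gamma>"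
    and x: "x \<in> semi \<alpha> \<beta> \<psi>" and y: "y \<in> semi \<beta> \<gamma> \<phi>"
    and \<psi>: "\<psi> \<in> carrier K \<rightarrow> carrier K" and \<phi>: "\<phi> \<in> carrier K \<rightarrow> carrier K"
  shows "x \<otimes> y \<in> semi \<alpha> \<gamma> (\<phi> \<circ> \<psi>)"
proof -
  have c: "x \<in> carrier R" "y \<in> carrier R" using x y semi_closed by auto
  have e: "\<alpha> \<one>\<^bsub>K\<^esub> \<otimes> x = x" "y \<otimes> \<gamma> \<one>\<^bsub>K\<^esub> = y" using x y by (auto simp: semi_def between_def)
  note r = rep_closed[OF \<alpha>] rep_closed[OF \<beta>] rep_closed[OF \<gamma>]
  have "\<alpha> a \<otimes> (x \<otimes> y) = x \<otimes> y \<otimes> \<gamma> (\<phi> (\<psi> a))" if a: "a \<in> carrier K" for a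
  proof -
    have p: "\<psi> a \<in> carrier K" "\<phi> (\<psi> a) \<in> carrier K" using a \<psi> \<phi> by auto
    have "\<alpha> a \<otimes> (x \<otimes> y) = x \<otimes> \<beta> (\<psi> a) \<otimes> y"
      using x a r c by (simp add: semi_def m_assoc[symmetric])
    also have "\<dots> = x \<otimes> (y \<otimes> \<gamma> (\<phi> (\<psi> a)))" using y p r c by (simp add: semi_def m_assoc)
    finally show ?thesis using r c p by (simp add: m_assoc)
  qed
  moreover have "x \<otimes> y \<in> between \<alpha> \<gamma>"
    using c r e e[THEN mult_assoc_eq] by (simp add: between_def m_assoc)
  ultimately show ?thesis by (simp add: semi_def)
qed

end

context field_reps
begin

text \<open>Restriction of a representation to a summand that it preserves: the ring stays the same,
  and only the image of 1 shrinks to \<open>h\<close>.\<close>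

lemma rep_corner:
  assumes \<alpha>: "rep \<alpha>" and h: "idempotent h" "in_corner (\<alpha> \<one>\<^bsub>K\<^esub>) {} h"
    and comm: "\<And>a. a \<in> carrier K \<Longrightarrow> h \<otimes> \<alpha> a = \<alpha> a \<otimes> h"
  shows "rep (\<lambda>a. h \<otimes> \<alpha> a)"
proof -
  have hc: "h \<in> carrier R" "h \<otimes> h = h" using h by (auto simp: idempotent_def)
  note r = rep_closed[OF \<alpha>]
  show ?thesis
    unfolding rep_def
  proof (intro conjI ballI)
    show "(\<lambda>a. h \<otimes> \<alpha> a) \<in> carrier K \<rightarrow> carrier R" using hc r by auto
  next
    fix a b assume ab: "a \<in> carrier K" "b \<in> carrier K"
    show "h \<otimes> \<alpha> (a \<oplus>\<^bsub>K\<^esub> b) = h \<otimes> \<alpha> a \<oplus> h \<otimes> \<alpha> b"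
      using ab hc r rep_add[OF \<alpha> ab] by (simp add: r_distr)
    have "h \<otimes> \<alpha> a \<otimes> (h \<otimes> \<alpha> b) = h \<otimes> (\<alpha> a \<otimes> h) \<otimes> \<alpha> b"
      using ab hc r by (simp add: m_assoc)
    also have "\<dots> = h \<otimes> \<alpha> (a \<otimes>\<^bsub>K\<^esub> b)"
      unfolding comm[OF ab(1), symmetric] using ab hc r rep_mult[OF \<alpha> ab] hc(2)[THEN mult_assoc_eq]
      by (simp add: m_assoc)
    finally show "h \<otimes> \<alpha> (a \<otimes>\<^bsub>K\<^esub> b) = h \<otimes> \<alpha> a \<otimes> (h \<otimes> \<alpha> b)" by simp
  next
    fix c assume c: "c \<in> k"
    have "h \<otimes> \<alpha> c = h \<otimes> \<eta> c \<otimes> \<alpha> \<one>\<^bsub>K\<^esub>"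
      using c \<alpha> hc r eta_closed[OF c] by (simp add: rep_def m_assoc)
    then show "h \<otimes> \<alpha> c = \<eta> c \<otimes> (h \<otimes> \<alpha> \<one>\<^bsub>K\<^esub>)"
      unfolding eta_commute[OF c hc(1), symmetric] using hc r eta_closed[OF c] by (simp add: m_assoc)
  qed
qed

lemma semi_id_add_span:
  assumes \<beta>: "rep \<beta>" and Z: "Z \<subseteq> semi \<beta> \<beta> id" and x: "x \<in> add_span Z"
  shows "x \<in> semi \<beta> \<beta> id"
  using x
proof induction
  case zero
  then show ?case using rep_closed[OF \<beta>] by (auto simp: semi_def between_def)
next
  case (step z x)
  have z: "z \<in> semi \<beta> \<beta> id" using step Z by auto
  then show ?case
    using step(3) between_add[OF \<beta> \<beta>, of z x] rep_closed[OF \<beta>] semi_closed[OF z] semi_closed[OF step(3)]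
    by (auto simp: semi_def l_distr r_distr)
qed

end

section \<open>Splitting off twisted summands\<close>

locale galois_fitting = galois_reps R K k \<eta> + fitting_ring R rank
  for R (structure) and K :: "'k ring" and k and \<eta> and rank
begin

text \<open>The summands are sorted by whether they commute with \<open>\<beta>\<close>. The
  commuting part minus the image of 1, together with the remaining part, is a vanishing sum to which
  \<open>semi_id_independent\<close> applies.\<close>

lemma trivial_component:
  assumes \<beta>: "rep \<beta>" and Z: "\<And>z. z \<in> Z \<Longrightarrow> \<exists>\<psi> \<in> carrier K \<rightarrow> carrier K. z \<in> semi \<beta> \<beta> \<psi>"
    and one: "\<beta> \<one>\<^bsub>K\<^esub> \<in> add_span Z"
  shows "\<beta> \<one>\<^bsub>K\<^esub> \<in> add_span (Z \<inter> semi \<beta> \<beta> id)"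
proof -
  \<comment> \<open>These maps need not be automorphisms, and values outside
    \<open>carrier K\<close> do not count.\<close>
  let ?G = "{\<psi> \<in> carrier K \<rightarrow> carrier K. \<exists>a\<in>carrier K. \<psi> a \<noteq> a}"
  let ?N = "\<Union>\<psi>\<in>?G. semi \<beta> \<beta> \<psi>"
  have Zc: "Z \<subseteq> carrier R" using Z semi_closed by blast
  have "\<exists>u \<in> add_span (Z \<inter> semi \<beta> \<beta> id). \<exists>w \<in> add_span ?N. x = u \<oplus> w" if "x \<in> add_span Z" for x
    using that
  proof induction
    case zero
    show ?case by (intro bexI[of _ \<zero>]) (auto intro: add_span.zero)
  next
    case (step z x)
    then obtain u w where u: "u \<in> add_span (Z \<inter> semi \<beta> \<beta> id)" and w: "w \<in> add_span ?N" and x: "x = u \<oplus> w"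
      by blast
    have c: "z \<in> carrier R" "u \<in> carrier R" "w \<in> carrier R"
      using step Zc add_span_closed[OF u] add_span_closed[OF w semi_subset] by auto
    show ?case
    proof (cases "z \<in> semi \<beta> \<beta> id")
      case True
      then have "z \<oplus> u \<in> add_span (Z \<inter> semi \<beta> \<beta> id)" using step u by (intro add_span.step) auto
      moreover have "z \<oplus> x = z \<oplus> u \<oplus> w" using c by (simp add: x a_assoc)
      ultimately show ?thesis using w by blast
    next
      case False
      obtain \<psi> where \<psi>: "\<psi> \<in> carrier K \<rightarrow> carrier K" "z \<in> semi \<beta> \<beta> \<psi>" using Z step by blast
      then have "\<exists>a\<in>carrier K. \<psi> a \<noteq> a" using False unfolding semi_def by fastforce
      then have "z \<oplus> w \<in> add_span ?N" using \<psi> w by (intro add_span.step) auto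
      moreover have "z \<oplus> x = u \<oplus> (z \<oplus> w)" using c by (simp add: x a_lcomm)
      ultimately show ?thesis using u by blast
    qed
  qed
  then obtain u w where u: "u \<in> add_span (Z \<inter> semi \<beta> \<beta> id)" and w: "w \<in> add_span ?N"
    and uw: "\<beta> \<one>\<^bsub>K\<^esub> = u \<oplus> w" using one by blast
  have u1: "u \<in> semi \<beta> \<beta> id" by (rule semi_id_add_span[OF \<beta> _ u]) simp
  have b1: "\<ominus> \<beta> \<one>\<^bsub>K\<^esub> \<in> semi \<beta> \<beta> id"
    using rep_closed[OF \<beta>] rep_one[OF \<beta>] by (auto simp: semi_def between_def l_minus r_minus)
  have z: "u \<oplus> \<ominus> \<beta> \<one>\<^bsub>K\<^esub> \<in> semi \<beta> \<beta> id"
    by (rule semi_id_add_span[OF \<beta>, of "{u, \<ominus> \<beta> \<one>\<^bsub>K\<^esub>}"])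
      (use u1 b1 semi_closed in \<open>auto intro!: add_span_add[OF add_span_base add_span_base]\<close>)
  have c: "u \<in> carrier R" "w \<in> carrier R" using semi_closed[OF u1] add_span_closed[OF w semi_subset] by auto
  have zw: "u \<oplus> \<ominus> \<beta> \<one>\<^bsub>K\<^esub> \<oplus> w = \<zero>"
    unfolding uw using c by (simp add: minus_add a_assoc l_neg r_neg)
  have "u \<oplus> \<ominus> \<beta> \<one>\<^bsub>K\<^esub> = \<zero>"
    by (rule semi_id_independent[OF \<beta> _ _ w z zw]) auto
  then have "u = \<beta> \<one>\<^bsub>K\<^esub>" using c rep_closed[OF \<beta>] r_right_minus_eq[of u "\<beta> \<one>\<^bsub>K\<^esub>"] by (simp add: a_minus_def)
  then show ?thesis using u by simp
qed

text \<open>The image of \<open>e\<close> appears as a summand on the side of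
  \<open>\<alpha>\<close>: \<open>w\<close> embeds it, \<open>v\<close> retracts onto it, and they
  intertwine the actions of \<open>K\<close> up to mutually inverse automorphisms. They come from a
  product \<open>f \<otimes> g\<close> in the expansion of \<open>x \<otimes> y\<close> that is
  invertible in the local corner of \<open>e\<close>.\<close>

lemma semilinear_summand:
  assumes \<alpha>: "rep \<alpha>" and \<beta>: "rep \<beta>" and iso: "idem_iso (\<alpha> \<one>\<^bsub>K\<^esub>) (\<beta> \<one>\<^bsub>K\<^esub>) x y"
    and e: "primitive_idempotent (\<beta> ` carrier K) e" and e1: "e \<otimes> \<beta> \<one>\<^bsub>K\<^esub> = e"
  shows "\<exists>\<phi>\<in>galois_group K k. \<exists>\<psi>\<in>galois_group K k. \<exists>v w. (\<forall>a\<in>carrier K. \<phi> (\<psi> a) = a) \<and>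
    v \<in> carrier R \<and> w \<in> carrier R \<and> v \<otimes> w = e \<and> e \<otimes> v = v \<and> v \<otimes> \<alpha> \<one>\<^bsub>K\<^esub> = v \<and> \<alpha> \<one>\<^bsub>K\<^esub> \<otimes> w = w \<and> w \<otimes> e = w \<and>
    (\<forall>a\<in>carrier K. \<beta> a \<otimes> v = v \<otimes> \<alpha> (\<phi> a)) \<and> (\<forall>a\<in>carrier K. \<alpha> a \<otimes> w = w \<otimes> \<beta> (\<psi> a))"
proof -
  let ?G = "galois_group K k" and ?S = "\<beta> ` carrier K"
  note r = rep_closed[OF \<alpha>] rep_closed[OF \<beta>]
  have S: "?S \<subseteq> carrier R" using r by auto
  have ec: "e \<in> carrier R" "e \<otimes> e = e" and eS: "in_corner e ?S e"
    and ebeta: "\<And>a. a \<in> carrier K \<Longrightarrow> e \<otimes> \<beta> a = \<beta> a \<otimes> e"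
    using e by (auto simp: primitive_idempotent_def idempotent_def in_corner_def)
  have GK: "\<psi> \<in> carrier K \<rightarrow> carrier K" if "\<psi> \<in> ?G" for \<psi> using galois_group_closed[OF that] by auto
  have x: "x \<in> between \<beta> \<alpha>" and y: "y \<in> between \<alpha> \<beta>" and xy: "x \<otimes> y = \<beta> \<one>\<^bsub>K\<^esub>"
    using iso by (auto simp: idem_iso_def between_def)
  let ?Z = "{f \<otimes> g | f g. f \<in> (\<Union>\<phi>\<in>?G. semi \<beta> \<alpha> \<phi>) \<and> g \<in> (\<Union>\<psi>\<in>?G. semi \<alpha> \<beta> \<psi>)}"
  have "\<beta> \<one>\<^bsub>K\<^esub> \<in> add_span ?Z"
    unfolding xy[symmetric]
    by (rule add_span_mult[OF semi_span[OF \<beta> \<alpha> x] semi_span[OF \<alpha> \<beta> y] semi_subset semi_subset])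
  then have "\<beta> \<one>\<^bsub>K\<^esub> \<in> add_span (?Z \<inter> semi \<beta> \<beta> id)"
  proof (rule trivial_component[OF \<beta>, rotated])
    fix z assume "z \<in> ?Z"
    then obtain f g \<phi> \<psi> where "z = f \<otimes> g" "\<phi> \<in> ?G" "\<psi> \<in> ?G" "f \<in> semi \<beta> \<alpha> \<phi>" "g \<in> semi \<alpha> \<beta> \<psi>" by auto
    then show "\<exists>\<psi> \<in> carrier K \<rightarrow> carrier K. z \<in> semi \<beta> \<beta> \<psi>"
      using semi_mult[OF \<beta> \<alpha> \<beta> _ _ GK GK] galois_group_closed by (intro bexI[of _ "\<psi> \<circ> \<phi>"]) auto
  qed
  \<comment> \<open>Compression by \<open>e\<close> is additive, so it carries the expansion of the
    image of 1 to an expansion of \<open>e\<close> inside its corner.\<close>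
  then have span: "e \<otimes> \<beta> \<one>\<^bsub>K\<^esub> \<otimes> e \<in> add_span ((\<lambda>u. e \<otimes> u \<otimes> e) ` (?Z \<inter> semi \<beta> \<beta> id))"
    by (rule add_span_additive_image) (use ec semi_closed in \<open>auto simp: l_distr r_distr\<close>)
  have corner: "in_corner e ?S z" if z: "z \<in> (\<lambda>u. e \<otimes> u \<otimes> e) ` (?Z \<inter> semi \<beta> \<beta> id)" for z
  proof -
    obtain u where u: "z = e \<otimes> u \<otimes> e" "u \<in> semi \<beta> \<beta> id" using z by blast
    have uc: "u \<in> carrier R" using semi_closed u by blast
    have "e \<otimes> u \<otimes> e \<otimes> \<beta> a = \<beta> a \<otimes> (e \<otimes> u \<otimes> e)" if a: "a \<in> carrier K" for a
    proof -
      have ua: "u \<otimes> \<beta> a = \<beta> a \<otimes> u" using u a by (simp add: semi_def)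
      show ?thesis
        by (intro mult_commute_mult ebeta[OF a] ua) (use ec uc r a in auto)
    qed
    then show ?thesis using ec uc ec(2)[THEN mult_assoc_eq] by (auto simp: in_corner_def u m_assoc)
  qed
  have unit1: "corner_unit e ?S (e \<otimes> \<beta> \<one>\<^bsub>K\<^esub> \<otimes> e)"
  proof -
    show ?thesis using eS ec e1 by (auto simp: corner_unit_def)
  qed
  obtain z where "z \<in> (\<lambda>u. e \<otimes> u \<otimes> e) ` (?Z \<inter> semi \<beta> \<beta> id)" "corner_unit e ?S z"
    by (rule bexE[OF corner_unit_add_span[OF e S corner span unit1]])
  then obtain f g \<phi> \<psi> where G: "\<phi> \<in> ?G" "\<psi> \<in> ?G" and f: "f \<in> semi \<beta> \<alpha> \<phi>" and g: "g \<in> semi \<alpha> \<beta> \<psi>"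
    and fg: "f \<otimes> g \<in> semi \<beta> \<beta> id" and unit: "corner_unit e ?S (e \<otimes> (f \<otimes> g) \<otimes> e)"
    by blast
  have c: "f \<in> carrier R" "g \<in> carrier R" using f g semi_closed by auto
  obtain t where t: "in_corner e ?S t" "e \<otimes> (f \<otimes> g) \<otimes> e \<otimes> t = e" using unit by (auto simp: corner_unit_def)
  have tc: "t \<in> carrier R" "e \<otimes> t = t" "t \<otimes> e = t" and tbeta: "\<And>a. a \<in> carrier K \<Longrightarrow> t \<otimes> \<beta> a = \<beta> a \<otimes> t"
    using t by (auto simp: in_corner_def)
  have fe: "f \<otimes> \<alpha> \<one>\<^bsub>K\<^esub> = f" "\<alpha> \<one>\<^bsub>K\<^esub> \<otimes> g = g" using f g by (auto simp: semi_def between_def)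
  have "e \<noteq> \<zero>" using e by (simp add: primitive_idempotent_def)
  then have fg0: "f \<otimes> g \<noteq> \<zero>" using t(2) ec tc by auto
  \<comment> \<open>The product \<open>f \<otimes> g\<close> is semilinear both for the identity and
    for \<open>\<psi> \<circ> \<phi>\<close>; being nonzero, it determines its automorphism by
    \<open>rep_inj\<close>.\<close>
  have psi_phi: "\<psi> (\<phi> a) = a" if a: "a \<in> carrier K" for a
    by (rule rep_inj[OF \<beta> _ _ fg0])
      (use fg semi_mult[OF \<beta> \<alpha> \<beta> f g GK GK] G galois_group_closed a in \<open>auto simp: semi_def between_def\<close>)
  have phi_psi: "\<phi> (\<psi> a) = a" if a: "a \<in> carrier K" for a
  proof -
    have "bij_betw \<phi> (carrier K) (carrier K)" using G by (auto simp: galois_group_def ring_iso_def)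
    then obtain b where "b \<in> carrier K" "a = \<phi> b" using a by (auto simp: bij_betw_def)
    then show ?thesis using psi_phi by simp
  qed
  \<comment> \<open>\<open>t\<close> inverts \<open>e \<otimes> (f \<otimes> g) \<otimes> e\<close>.
    Placed on the side of \<open>g\<close> it gives \<open>v \<otimes> w = e\<close>, and since it
    commutes with \<beta>(K), \<open>w\<close> stays semilinear.\<close>
  define v where "v = e \<otimes> f"
  define w where "w = g \<otimes> (e \<otimes> t)"
  have vw: "v \<otimes> w = e"
    using t(2) ec c tc by (simp add: v_def w_def m_assoc)
  have V: "v \<in> carrier R" "w \<in> carrier R" "e \<otimes> v = v" "v \<otimes> \<alpha> \<one>\<^bsub>K\<^esub> = v" "\<alpha> \<one>\<^bsub>K\<^esub> \<otimes> w = w" "w \<otimes> e = w"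
    using ec c tc r fe fe[THEN mult_assoc_eq] ec(2)[THEN mult_assoc_eq] by (simp_all add: v_def w_def m_assoc)
  have va: "\<beta> a \<otimes> v = v \<otimes> \<alpha> (\<phi> a)" if a: "a \<in> carrier K" for a
  proof -
    have "\<beta> a \<otimes> v = e \<otimes> (\<beta> a \<otimes> f)"
      using ebeta[OF a] m_assoc[of "\<beta> a" e f] m_assoc[of e "\<beta> a" f] ec r c a by (simp add: v_def)
    also have "\<dots> = v \<otimes> \<alpha> (\<phi> a)"
      using f a ec c r galois_group_closed[OF G(1) a] by (simp add: v_def semi_def m_assoc)
    finally show ?thesis .
  qed
  have wa: "\<alpha> a \<otimes> w = w \<otimes> \<beta> (\<psi> a)" if a: "a \<in> carrier K" for a
  proof -
    have p: "\<psi> a \<in> carrier K" by (rule galois_group_closed[OF G(2) a])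
    have "\<alpha> a \<otimes> w = \<alpha> a \<otimes> g \<otimes> (e \<otimes> t)" using a ec c tc r by (simp add: w_def m_assoc)
    also have "\<dots> = g \<otimes> (\<beta> (\<psi> a) \<otimes> (e \<otimes> t))" using g a p ec c tc r by (simp add: semi_def m_assoc)
    also have "\<beta> (\<psi> a) \<otimes> (e \<otimes> t) = e \<otimes> t \<otimes> \<beta> (\<psi> a)"
      by (rule mult_commute_mult[OF ebeta[OF p] tbeta[OF p], symmetric]) (use ec tc r p in auto)
    finally show ?thesis using ec c tc r p by (simp add: w_def m_assoc)
  qed
  show ?thesis
    using G phi_psi vw V va wa by blast
qed

text \<open>The given \<open>x\<close> and \<open>y\<close> carry no compatibility with
  \<open>K\<close>. This is just what cancellation provides for the complements, so the induction
  can go on with \<open>\<alpha>\<close> and \<open>\<beta>\<close> restricted to them.\<close>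

theorem twisted_idem_iso:
  assumes "finite I" and \<alpha>: "rep \<alpha>" and \<beta>: "rep \<beta>" and iso: "idem_iso (\<alpha> \<one>\<^bsub>K\<^esub>) (\<beta> \<one>\<^bsub>K\<^esub>) x y"
    and prim: "\<And>i. i \<in> I \<Longrightarrow> primitive_idempotent (\<beta> ` carrier K) (e i)"
    and orth: "\<And>i j. i \<in> I \<Longrightarrow> j \<in> I \<Longrightarrow> i \<noteq> j \<Longrightarrow> e i \<otimes> e j = \<zero>"
    and corner: "\<And>i. i \<in> I \<Longrightarrow> in_corner (\<beta> \<one>\<^bsub>K\<^esub>) {} (e i)"
    and sum: "\<beta> \<one>\<^bsub>K\<^esub> = (\<Oplus>i\<in>I. e i)"
  shows "\<exists>\<phi> u v. (\<forall>i\<in>I. \<phi> i \<in> galois_group K k) \<and> idem_iso (\<alpha> \<one>\<^bsub>K\<^esub>) (\<beta> \<one>\<^bsub>K\<^esub>) u v \<and>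
    (\<forall>i\<in>I. \<forall>a\<in>carrier K. e i \<otimes> u \<otimes> \<alpha> a = e i \<otimes> \<beta> (\<phi> i a) \<otimes> u)"
  using assms
proof (induction I arbitrary: \<alpha> \<beta> x y rule: finite_induct)
  case empty
  then show ?case by blast
next
  case (insert j I)
  note \<alpha> = insert.prems(1) and \<beta> = insert.prems(2) and iso = insert.prems(3)
    and prim = insert.prems(4) and orth = insert.prems(5) and corner = insert.prems(6)
  define p where "p = \<alpha> \<one>\<^bsub>K\<^esub>"
  define q where "q = \<beta> \<one>\<^bsub>K\<^esub>"
  note r = rep_closed[OF \<alpha>] rep_closed[OF \<beta>]
  have ec: "e i \<in> carrier R" "e i \<otimes> e i = e i" "q \<otimes> e i = e i" "e i \<otimes> q = e i" if "i \<in> insert j I" for i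
    using prim[OF that] corner[OF that]
    by (auto simp: primitive_idempotent_def idempotent_def in_corner_def q_def)
  have ebeta: "e i \<otimes> \<beta> a = \<beta> a \<otimes> e i" if "i \<in> insert j I" "a \<in> carrier K" for i a
    using prim[OF that(1)] that(2) by (auto simp: primitive_idempotent_def in_corner_def)
  have pq: "p \<in> carrier R" "q \<in> carrier R" "idempotent p" "idempotent q"
    using r rep_one[OF \<alpha>] rep_one[OF \<beta>] by (auto simp: p_def q_def idempotent_def)
  have jI: "j \<in> insert j I" by simp
  have ej: "idempotent (e j)" using ec[OF jI] by (simp add: idempotent_def)
  obtain \<phi> \<psi> v w where G: "\<phi> \<in> galois_group K k" "\<psi> \<in> galois_group K k"
    and O: "\<forall>a\<in>carrier K. \<phi> (\<psi> a) = a"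
      "\<forall>a\<in>carrier K. \<beta> a \<otimes> v = v \<otimes> \<alpha> (\<phi> a)" "\<forall>a\<in>carrier K. \<alpha> a \<otimes> w = w \<otimes> \<beta> (\<psi> a)"
    and vw: "v \<in> carrier R" "w \<in> carrier R" "v \<otimes> w = e j" "e j \<otimes> v = v" "v \<otimes> p = v" "p \<otimes> w = w" "w \<otimes> e j = w"
    using semilinear_summand[OF \<alpha> \<beta> iso prim[OF jI] ec(4)[OF jI, unfolded q_def]] unfolding p_def
    by (elim bexE exE conjE) iprover
  note phi_psi = O(1)[rule_format] and va = O(2)[rule_format] and wa = O(3)[rule_format]
  note GK = galois_group_closed[OF G(1)] galois_group_closed[OF G(2)]
  \<comment> \<open>The summand matched with \<open>e j\<close>; it is preserved by
    \<open>\<alpha>\<close> because the twists of \<open>w\<close> and \<open>v\<close>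
    cancel.\<close>
  define p1 where "p1 = w \<otimes> v"
  have p1c: "p1 \<in> carrier R" using vw by (simp add: p1_def)
  have p1: "idempotent p1" "in_corner p {} p1"
    using vw vw(3-7)[THEN mult_assoc_eq] pq by (simp_all add: idempotent_def in_corner_def p1_def m_assoc)
  have iso1: "idem_iso p1 (e j) v w"
    unfolding idem_iso_def p1_def
    using vw vw(3-7)[THEN mult_assoc_eq] ec[OF jI] by (simp add: m_assoc)
  have p1a: "p1 \<otimes> \<alpha> a = \<alpha> a \<otimes> p1" if a: "a \<in> carrier K" for a
  proof -
    have "\<alpha> a \<otimes> p1 = w \<otimes> (\<beta> (\<psi> a) \<otimes> v)"
      unfolding p1_def using wa[OF a] vw r GK a by (simp add: m_assoc[symmetric])
    also have "\<dots> = p1 \<otimes> \<alpha> a"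
      unfolding va[OF GK(2)[OF a]] phi_psi[OF a] p1_def using vw r a by (simp add: m_assoc)
    finally show ?thesis by simp
  qed
  define p' where "p' = p \<ominus> p1"
  define q' where "q' = q \<ominus> e j"
  note P = idempotent_split[OF pq(3) p1, folded p'_def]
  note Q = idempotent_split[OF pq(4) ej corner[OF jI, folded q_def], folded q'_def]
  have p'c: "p' \<in> carrier R" "q' \<in> carrier R" using P Q by (auto simp: idempotent_def)
  \<comment> \<open>\<open>x\<close> need not match \<open>p1\<close> with \<open>e j\<close>;
    cancellation still yields some equivalence of the complements.\<close>
  have "idem_iso (p1 \<oplus> p') (e j \<oplus> q') x y" using iso P(4) Q(4) by (simp add: p_def q_def)
  then obtain x' y' where iso': "idem_iso p' q' x' y'"
    using idem_iso_cancel[OF p1(1) ej P(1) Q(1) P(3) Q(3) iso1] by blast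
  have p'a: "p' \<otimes> \<alpha> a = \<alpha> a \<otimes> p'" if a: "a \<in> carrier K" for a
    unfolding p'_def a_minus_def p_def using p1a[OF a] rep_one[OF \<alpha> a] r a p1c
    by (simp add: l_distr r_distr l_minus r_minus)
  have q'b: "q' \<otimes> \<beta> a = \<beta> a \<otimes> q'" if a: "a \<in> carrier K" for a
    unfolding q'_def a_minus_def q_def using ebeta[OF jI a] rep_one[OF \<beta> a] r a ec[OF jI]
    by (simp add: l_distr r_distr l_minus r_minus)
  define \<alpha>' where "\<alpha>' a = p' \<otimes> \<alpha> a" for a
  define \<beta>' where "\<beta>' a = q' \<otimes> \<beta> a" for a
  have \<alpha>': "rep \<alpha>'" unfolding \<alpha>'_def by (rule rep_corner[OF \<alpha> P(1) P(2)[unfolded p_def] p'a])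
  have \<beta>': "rep \<beta>'" unfolding \<beta>'_def by (rule rep_corner[OF \<beta> Q(1) Q(2)[unfolded q_def] q'b])
  have one': "\<alpha>' \<one>\<^bsub>K\<^esub> = p'" "\<beta>' \<one>\<^bsub>K\<^esub> = q'"
    using P(2) Q(2) by (auto simp: \<alpha>'_def \<beta>'_def in_corner_def p_def q_def)
  have eq': "e i \<otimes> q' = e i" "q' \<otimes> e i = e i" if i: "i \<in> I" for i
  proof -
    have ij: "i \<noteq> j" "i \<in> insert j I" using i insert.hyps by auto
    show "e i \<otimes> q' = e i" "q' \<otimes> e i = e i"
      unfolding q'_def a_minus_def
      using ec[OF ij(2)] ec[OF jI] orth[OF ij(2) jI ij(1)] orth[OF jI ij(2) ij(1)[symmetric]] pq
      by (simp_all add: l_distr r_distr l_minus r_minus)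
  qed
  have eb': "e i \<otimes> \<beta>' a = e i \<otimes> \<beta> a" "\<beta>' a \<otimes> e i = \<beta> a \<otimes> e i" if i: "i \<in> I" and a: "a \<in> carrier K" for i a
  proof -
    have ic: "e i \<in> carrier R" using ec i by auto
    show "e i \<otimes> \<beta>' a = e i \<otimes> \<beta> a"
      unfolding \<beta>'_def using eq'(1)[OF i, THEN mult_assoc_eq] ic p'c r a by simp
    show "\<beta>' a \<otimes> e i = \<beta> a \<otimes> e i"
      unfolding \<beta>'_def q'b[OF a] using eq'(2)[OF i] ic p'c r a by (simp add: m_assoc)
  qed
  \<comment> \<open>In the corner at \<open>e i\<close>, \<open>q'\<close> acts as the identity, so
    commuting with \<open>\<beta>'\<close> implies commuting with \<open>\<beta>\<close>.\<close>
  have prim': "primitive_idempotent (\<beta>' ` carrier K) (e i)" if i: "i \<in> I" for i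
  proof -
    have ii: "i \<in> insert j I" using i by simp
    have ic: "e i \<in> carrier R" using ec i by auto
    have conv: "in_corner (e i) (\<beta> ` carrier K) h" if h: "in_corner (e i) (\<beta>' ` carrier K) h" for h
    proof -
      have hc: "h \<in> carrier R" "e i \<otimes> h = h" "h \<otimes> e i = h"
        and hb: "\<And>a. a \<in> carrier K \<Longrightarrow> h \<otimes> \<beta>' a = \<beta>' a \<otimes> h"
        using h by (auto simp: in_corner_def)
      have "h \<otimes> \<beta> a = \<beta> a \<otimes> h" if a: "a \<in> carrier K" for a
      proof -
        have bc: "\<beta>' a \<in> carrier R" "\<beta> a \<in> carrier R" using rep_closed[OF \<beta>' a] r a by auto
        have "h \<otimes> \<beta> a = h \<otimes> (e i \<otimes> \<beta> a)" using hc(3)[THEN mult_assoc_eq] hc ic bc by simp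
        also have "\<dots> = h \<otimes> \<beta>' a" unfolding eb'(1)[OF i a, symmetric] using hc(3)[THEN mult_assoc_eq] hc ic bc by simp
        also have "\<dots> = \<beta>' a \<otimes> (e i \<otimes> h)" using hb[OF a] hc by simp
        also have "\<dots> = \<beta> a \<otimes> e i \<otimes> h" unfolding eb'(2)[OF i a, symmetric] using bc ic hc(1) by (simp add: m_assoc)
        also have "\<dots> = \<beta> a \<otimes> h" using bc ic hc by (simp add: m_assoc)
        finally show ?thesis .
      qed
      then show ?thesis using hc by (auto simp: in_corner_def)
    qed
    have "in_corner (e i) (\<beta>' ` carrier K) (e i)"
      using ec[OF ii] eb'[OF i] ebeta[OF ii] by (auto simp: in_corner_def)
    then show ?thesis
      using prim[OF ii] conv unfolding primitive_idempotent_def by blast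
  qed
  have sum': "\<beta>' \<one>\<^bsub>K\<^esub> = (\<Oplus>i\<in>I. e i)"
  proof -
    have s: "(\<Oplus>i\<in>I. e i) \<in> carrier R" by (rule finsum_closed) (use ec in auto)
    have "q = e j \<oplus> (\<Oplus>i\<in>I. e i)"
      using insert.prems(7) insert.hyps ec unfolding q_def[symmetric] by (subst (asm) finsum_insert) auto
    then have "q' = (\<Oplus>i\<in>I. e i)"
      unfolding q'_def a_minus_def using ec[OF jI] s by (simp add: a_comm[of "e j"] a_assoc r_neg)
    then show ?thesis by (simp add: one')
  qed
  have corner': "in_corner (\<beta>' \<one>\<^bsub>K\<^esub>) {} (e i)" if i: "i \<in> I" for i
    using eq'[OF i] ec i by (auto simp: in_corner_def one')
  have iso'': "idem_iso (\<alpha>' \<one>\<^bsub>K\<^esub>) (\<beta>' \<one>\<^bsub>K\<^esub>) x' y'" using iso' one' by simp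
  have orth': "e i \<otimes> e i' = \<zero>" if "i \<in> I" "i' \<in> I" "i \<noteq> i'" for i i' using orth that by auto
  have "\<exists>\<phi> u v. (\<forall>i\<in>I. \<phi> i \<in> galois_group K k) \<and> idem_iso (\<alpha>' \<one>\<^bsub>K\<^esub>) (\<beta>' \<one>\<^bsub>K\<^esub>) u v \<and>
      (\<forall>i\<in>I. \<forall>a\<in>carrier K. e i \<otimes> u \<otimes> \<alpha>' a = e i \<otimes> \<beta>' (\<phi> i a) \<otimes> u)"
    by (rule insert.IH[OF \<alpha>' \<beta>' iso'' prim' orth' corner' sum'])
  then obtain \<chi> u' v' where X: "\<forall>i\<in>I. \<chi> i \<in> galois_group K k"
    and uv: "idem_iso p' q' u' v'"
    and UA: "\<forall>i\<in>I. \<forall>a\<in>carrier K. e i \<otimes> u' \<otimes> \<alpha>' a = e i \<otimes> \<beta>' (\<chi> i a) \<otimes> u'"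
    unfolding one'
    by (elim exE conjE) iprover
  note \<chi> = X[rule_format] and ua = UA[rule_format]
  have uc: "u' \<in> carrier R" "u' \<otimes> p' = u'" "q' \<otimes> u' = u'" using uv by (auto simp: idem_iso_def)
  have "idem_iso (p1 \<oplus> p') (e j \<oplus> q') (v \<oplus> u') (w \<oplus> v')"
    by (rule idem_iso_add[OF iso1 uv P(3) Q(3)])
  then have iso_uv: "idem_iso (\<alpha> \<one>\<^bsub>K\<^esub>) (\<beta> \<one>\<^bsub>K\<^esub>) (v \<oplus> u') (w \<oplus> v')"
    unfolding P(4) Q(4) by (simp add: p_def q_def)
  have ej_u': "e j \<otimes> u' = \<zero>"
    using Q(3) m_assoc[of "e j" q' u'] uc p'c ec[OF jI] by (simp add: orth_def)
  have ei_v: "e i \<otimes> v = \<zero>" if i: "i \<in> I" for i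
  proof -
    have ij: "i \<noteq> j" "i \<in> insert j I" using i insert.hyps by auto
    show ?thesis
      using m_assoc[of "e i" "e j" v] orth[OF ij(2) jI ij(1)] vw ec[OF jI] ec[OF ij(2)] by simp
  qed
  \<comment> \<open>At \<open>j\<close> only \<open>v\<close> contributes, and the twist is
    \<open>\<psi>\<close>: take \<open>b = \<psi> a\<close> in
    \<open>\<beta> b \<otimes> v = v \<otimes> \<alpha> (\<phi> b)\<close>. On every other component
    only \<open>u'\<close> contributes.\<close>
  have main: "e i \<otimes> (v \<oplus> u') \<otimes> \<alpha> a = e i \<otimes> \<beta> ((\<chi>(j := \<psi>)) i a) \<otimes> (v \<oplus> u')"
    if i: "i \<in> insert j I" and a: "a \<in> carrier K" for i a
  proof (cases "i = j")
    case True
    have b: "\<beta> (\<psi> a) \<in> carrier R" using r GK a by simp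
    have "e j \<otimes> (v \<oplus> u') = v" using ej_u' vw uc ec[OF jI] by (simp add: r_distr)
    moreover have "e j \<otimes> \<beta> (\<psi> a) \<otimes> (v \<oplus> u') = v \<otimes> \<alpha> a"
      unfolding ebeta[OF jI GK(2)[OF a]]
      using ej_u' vw uc ec[OF jI] b va[OF GK(2)[OF a]] phi_psi[OF a] r(1)[OF a] by (simp add: r_distr m_assoc)
    ultimately show ?thesis using True by simp
  next
    case False
    then have iI: "i \<in> I" using i by simp
    have c: "\<chi> i a \<in> carrier K" using galois_group_closed[OF \<chi>[OF iI] a] .
    have ic: "e i \<in> carrier R" using ec[OF i] by simp
    have "e i \<otimes> (v \<oplus> u') \<otimes> \<alpha> a = e i \<otimes> u' \<otimes> \<alpha> a" using ei_v[OF iI] ic vw uc by (simp add: r_distr)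
    also have "\<dots> = e i \<otimes> u' \<otimes> \<alpha>' a"
      unfolding \<alpha>'_def using uc(2)[THEN mult_assoc_eq] uc p'c ic r a by (simp add: m_assoc)
    also have "\<dots> = e i \<otimes> \<beta> (\<chi> i a) \<otimes> u'" unfolding ua[OF iI a] eb'(1)[OF iI c] ..
    also have "\<dots> = e i \<otimes> \<beta> (\<chi> i a) \<otimes> (v \<oplus> u')"
    proof -
      have "e i \<otimes> \<beta> (\<chi> i a) \<otimes> v = \<zero>"
        unfolding ebeta[OF i c] using ei_v[OF iI] ic r c vw by (simp add: m_assoc)
      then show ?thesis using ic r c vw uc by (simp add: r_distr)
    qed
    finally show ?thesis using False by simp
  qed
  show ?case
    by (intro exI[of _ "\<chi>(j := \<psi>)"] exI[of _ "v \<oplus> u'"] exI[of _ "w \<oplus> v'"] conjI ballI iso_uv main)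
      (use G \<chi> in auto)
qed

end

section \<open>Endomorphism rings of modules of finite rank\<close>

context left_module
begin

lemma smult_zero_right: "a \<in> carrier R \<Longrightarrow> a \<odot>\<^bsub>M\<^esub> \<zero>\<^bsub>M\<^esub> = \<zero>\<^bsub>M\<^esub>"
proof -
  assume a: "a \<in> carrier R"
  have "a \<odot>\<^bsub>M\<^esub> \<zero>\<^bsub>M\<^esub> \<oplus>\<^bsub>M\<^esub> a \<odot>\<^bsub>M\<^esub> \<zero>\<^bsub>M\<^esub> = a \<odot>\<^bsub>M\<^esub> \<zero>\<^bsub>M\<^esub>"
    using smult_r_distr[OF a, of "\<zero>\<^bsub>M\<^esub>" "\<zero>\<^bsub>M\<^esub>"] by simp
  then show ?thesis using M.add.l_cancel_one smult_closed[OF a] by simp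
qed

lemma smult_minus_right:
  assumes a: "a \<in> carrier R" and x: "x \<in> carrier M"
  shows "a \<odot>\<^bsub>M\<^esub> (\<ominus>\<^bsub>M\<^esub> x) = \<ominus>\<^bsub>M\<^esub> (a \<odot>\<^bsub>M\<^esub> x)"
proof -
  have "a \<odot>\<^bsub>M\<^esub> (\<ominus>\<^bsub>M\<^esub> x) \<oplus>\<^bsub>M\<^esub> a \<odot>\<^bsub>M\<^esub> x = \<zero>\<^bsub>M\<^esub>"
    using smult_r_distr[OF a, of "\<ominus>\<^bsub>M\<^esub> x" x] x smult_zero_right[OF a] by (simp add: M.l_neg)
  then show ?thesis using M.minus_equality smult_closed[OF a] x by simp
qed

lemma left_submoduleI:
  assumes "H \<subseteq> carrier M" and "\<zero>\<^bsub>M\<^esub> \<in> H" and "\<And>x. x \<in> H \<Longrightarrow> \<ominus>\<^bsub>M\<^esub> x \<in> H"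
    and "\<And>x y. \<lbrakk>x \<in> H; y \<in> H\<rbrakk> \<Longrightarrow> x \<oplus>\<^bsub>M\<^esub> y \<in> H" and "\<And>a x. \<lbrakk>a \<in> carrier R; x \<in> H\<rbrakk> \<Longrightarrow> a \<odot>\<^bsub>M\<^esub> x \<in> H"
  shows "submodule H R M"
  using assms by (intro submodule.intro subgroup.intro) (simp_all add: submodule_axioms_def a_inv_def)

lemma left_submoduleD:
  assumes "submodule H R M"
  shows "H \<subseteq> carrier M" and "\<zero>\<^bsub>M\<^esub> \<in> H" and "x \<in> H \<Longrightarrow> \<ominus>\<^bsub>M\<^esub> x \<in> H"
    and "\<lbrakk>x \<in> H; y \<in> H\<rbrakk> \<Longrightarrow> x \<oplus>\<^bsub>M\<^esub> y \<in> H" and "\<lbrakk>a \<in> carrier R; x \<in> H\<rbrakk> \<Longrightarrow> a \<odot>\<^bsub>M\<^esub> x \<in> H"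
proof -
  interpret submodule H R M by fact
  show "H \<subseteq> carrier M" using subset by simp
  show "\<zero>\<^bsub>M\<^esub> \<in> H" using one_closed by simp
  show "x \<in> H \<Longrightarrow> \<ominus>\<^bsub>M\<^esub> x \<in> H" using m_inv_closed by (simp add: a_inv_def)
  show "\<lbrakk>x \<in> H; y \<in> H\<rbrakk> \<Longrightarrow> x \<oplus>\<^bsub>M\<^esub> y \<in> H" using m_closed by simp
  show "\<lbrakk>a \<in> carrier R; x \<in> H\<rbrakk> \<Longrightarrow> a \<odot>\<^bsub>M\<^esub> x \<in> H" using smult_closed by simp
qed

end

text \<open>The rank counts the pivots of a submodule with respect to an enumeration of the generators.\<close>

lemma finite_generated_rank:
  fixes V :: "('f, 'm, 'z) module_scheme"
  assumes F: "field F" and V: "left_module F V" and "finite B" and "B \<subseteq> carrier V"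
  shows "\<exists>S (\<rho> :: 'm set \<Rightarrow> nat). submodule S F V \<and> B \<subseteq> S \<and>
    (\<forall>U W. submodule U F V \<longrightarrow> submodule W F V \<longrightarrow> W \<subseteq> S \<longrightarrow> U \<subset> W \<longrightarrow> \<rho> U < \<rho> W)"
  using assms(3,4)
proof (induction B rule: finite_induct)
  interpret F: field F by fact
  interpret left_module F V by fact
  {
    case empty
    have "submodule {\<zero>\<^bsub>V\<^esub>} F V" by (rule left_submoduleI) (auto simp: smult_zero_right)
    moreover have "\<not> U \<subset> W" if "W \<subseteq> {\<zero>\<^bsub>V\<^esub>}" "submodule U F V" for U W
      using left_submoduleD(2)[OF that(2)] that(1) by blast
    ultimately show ?case by blast
  next
    case (insert b B)
    then obtain S and \<rho> :: "'m set \<Rightarrow> nat" where S: "submodule S F V" "B \<subseteq> S"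
      and \<rho>: "\<And>U W. submodule U F V \<Longrightarrow> submodule W F V \<Longrightarrow> W \<subseteq> S \<Longrightarrow> U \<subset> W \<Longrightarrow> \<rho> U < \<rho> W"
      by blast
    note SD = left_submoduleD[OF S(1)]
    have b: "b \<in> carrier V" using insert by simp
    define T where "T = {c \<odot>\<^bsub>V\<^esub> b \<oplus>\<^bsub>V\<^esub> s | c s. c \<in> carrier F \<and> s \<in> S}"
    have TI: "c \<odot>\<^bsub>V\<^esub> b \<oplus>\<^bsub>V\<^esub> s \<in> T" if "c \<in> carrier F" "s \<in> S" for c s using that by (auto simp: T_def)
    have sc: "s \<in> carrier V" if "s \<in> S" for s using SD that by auto
    have zero_smult: "\<zero>\<^bsub>F\<^esub> \<odot>\<^bsub>V\<^esub> x = \<zero>\<^bsub>V\<^esub>" if "x \<in> carrier V" for x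
    proof -
      have "\<zero>\<^bsub>F\<^esub> \<odot>\<^bsub>V\<^esub> x \<oplus>\<^bsub>V\<^esub> \<zero>\<^bsub>F\<^esub> \<odot>\<^bsub>V\<^esub> x = \<zero>\<^bsub>F\<^esub> \<odot>\<^bsub>V\<^esub> x"
        using smult_l_distr[of "\<zero>\<^bsub>F\<^esub>" "\<zero>\<^bsub>F\<^esub>" x] that by simp
      then show ?thesis using M.add.l_cancel_one smult_closed that by simp
    qed
    have ST: "S \<subseteq> T"
    proof
      fix s assume "s \<in> S"
      then show "s \<in> T" using TI[of "\<zero>\<^bsub>F\<^esub>" s] zero_smult[OF b] sc by simp
    qed
    have T: "submodule T F V"
    proof (rule left_submoduleI)
      show "T \<subseteq> carrier V" using smult_closed b sc by (auto simp: T_def)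
      show "\<zero>\<^bsub>V\<^esub> \<in> T" using ST SD(2) by blast
    next
      fix x y assume "x \<in> T" "y \<in> T"
      then obtain c s d t where x: "x = c \<odot>\<^bsub>V\<^esub> b \<oplus>\<^bsub>V\<^esub> s" "c \<in> carrier F" "s \<in> S"
        and y: "y = d \<odot>\<^bsub>V\<^esub> b \<oplus>\<^bsub>V\<^esub> t" "d \<in> carrier F" "t \<in> S" by (auto simp: T_def)
      have "x \<oplus>\<^bsub>V\<^esub> y = (c \<oplus>\<^bsub>F\<^esub> d) \<odot>\<^bsub>V\<^esub> b \<oplus>\<^bsub>V\<^esub> (s \<oplus>\<^bsub>V\<^esub> t)"
        using x y b sc smult_closed by (simp add: smult_l_distr M.a_ac)
      then show "x \<oplus>\<^bsub>V\<^esub> y \<in> T" using TI x y SD by simp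
    next
      fix a x assume a: "a \<in> carrier F" and "x \<in> T"
      then obtain c s where x: "x = c \<odot>\<^bsub>V\<^esub> b \<oplus>\<^bsub>V\<^esub> s" "c \<in> carrier F" "s \<in> S" by (auto simp: T_def)
      have "a \<odot>\<^bsub>V\<^esub> x = (a \<otimes>\<^bsub>F\<^esub> c) \<odot>\<^bsub>V\<^esub> b \<oplus>\<^bsub>V\<^esub> a \<odot>\<^bsub>V\<^esub> s"
        using x a b sc smult_closed by (simp add: smult_r_distr smult_assoc1)
      then show "a \<odot>\<^bsub>V\<^esub> x \<in> T" using TI x a SD by simp
    next
      fix x assume "x \<in> T"
      then obtain c s where x: "x = c \<odot>\<^bsub>V\<^esub> b \<oplus>\<^bsub>V\<^esub> s" "c \<in> carrier F" "s \<in> S" by (auto simp: T_def)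
      have "(\<ominus>\<^bsub>F\<^esub> c) \<odot>\<^bsub>V\<^esub> b \<oplus>\<^bsub>V\<^esub> c \<odot>\<^bsub>V\<^esub> b = \<zero>\<^bsub>V\<^esub>"
        using smult_l_distr[of "\<ominus>\<^bsub>F\<^esub> c" c b] x b zero_smult by (simp add: F.l_neg)
      then have m: "\<ominus>\<^bsub>V\<^esub> (c \<odot>\<^bsub>V\<^esub> b) = (\<ominus>\<^bsub>F\<^esub> c) \<odot>\<^bsub>V\<^esub> b"
        using M.minus_equality smult_closed x b by simp
      have "\<ominus>\<^bsub>V\<^esub> x = (\<ominus>\<^bsub>F\<^esub> c) \<odot>\<^bsub>V\<^esub> b \<oplus>\<^bsub>V\<^esub> \<ominus>\<^bsub>V\<^esub> s"
        using x b sc smult_closed m by (simp add: M.minus_add)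
      then show "\<ominus>\<^bsub>V\<^esub> x \<in> T" using TI x SD by simp
    qed
    have "b \<in> T" using TI[of "\<one>\<^bsub>F\<^esub>" "\<zero>\<^bsub>V\<^esub>"] SD b smult_one by simp
    \<comment> \<open>The summand 1 records a pivot at \<open>b\<close>, that is, an element of
      \<open>U\<close> outside \<open>S\<close>.\<close>
    define \<rho>' where "\<rho>' U = \<rho> (U \<inter> S) + (if U \<subseteq> S then 0 else 1)" for U
    have "\<rho>' U < \<rho>' W" if U: "submodule U F V" and W: "submodule W F V" and WT: "W \<subseteq> T" and UW: "U \<subset> W" for U W
    proof -
      note UD = left_submoduleD[OF U] and WD = left_submoduleD[OF W]
      have US: "submodule (U \<inter> S) F V"
        by (rule left_submoduleI) (use UD SD in auto)
      have WS: "submodule (W \<inter> S) F V"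
        by (rule left_submoduleI) (use WD SD in auto)
      show ?thesis
      proof (cases "U \<inter> S = W \<inter> S")
        case False
        then have "\<rho> (U \<inter> S) < \<rho> (W \<inter> S)" using UW by (intro \<rho> US WS) auto
        then show ?thesis using UW by (auto simp: \<rho>'_def)
      next
        case True
        \<comment> \<open>If \<open>U\<close> had a pivot at \<open>b\<close> too, a multiple of
          \<open>u\<close> could be subtracted from \<open>w\<close> to clear its coefficient at
          \<open>b\<close>. The remainder lies in the common trace on \<open>S\<close>, which puts
          \<open>w\<close> into \<open>U\<close>.\<close>
        have "U \<subseteq> S"
        proof (rule ccontr)
          assume "\<not> U \<subseteq> S"
          then obtain u where u: "u \<in> U" "u \<notin> S" by blast
          obtain w where w: "w \<in> W" "w \<notin> U" using UW by blast
          obtain c s where c: "u = c \<odot>\<^bsub>V\<^esub> b \<oplus>\<^bsub>V\<^esub> s" "c \<in> carrier F" "s \<in> S"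
            using u(1) psubset_imp_subset[OF UW] WT unfolding T_def by blast
          obtain d t where d: "w = d \<odot>\<^bsub>V\<^esub> b \<oplus>\<^bsub>V\<^esub> t" "d \<in> carrier F" "t \<in> S"
            using w(1) WT unfolding T_def by blast
          have "c \<noteq> \<zero>\<^bsub>F\<^esub>" using u c zero_smult[OF b] sc by auto
          then have "c \<in> Units F" using c F.field_Units by blast
          then obtain c' where c': "c' \<in> carrier F" "c' \<otimes>\<^bsub>F\<^esub> c = \<one>\<^bsub>F\<^esub>" using F.Units_l_inv_ex by blast
          define m where "m = d \<otimes>\<^bsub>F\<^esub> c'"
          have m: "m \<in> carrier F" "m \<otimes>\<^bsub>F\<^esub> c = d" using c c' d by (simp_all add: m_def F.m_assoc)
          have mu: "m \<odot>\<^bsub>V\<^esub> u = d \<odot>\<^bsub>V\<^esub> b \<oplus>\<^bsub>V\<^esub> m \<odot>\<^bsub>V\<^esub> s"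
            using c m b sc smult_closed smult_assoc1[of m c b] by (simp add: smult_r_distr)
          have muU: "m \<odot>\<^bsub>V\<^esub> u \<in> U" using UD m u by simp
          have cc: "d \<odot>\<^bsub>V\<^esub> b \<in> carrier V" "t \<in> carrier V" "m \<odot>\<^bsub>V\<^esub> s \<in> carrier V"
            using d b sc m c smult_closed by auto
          have "w \<oplus>\<^bsub>V\<^esub> \<ominus>\<^bsub>V\<^esub> (m \<odot>\<^bsub>V\<^esub> u) = t \<oplus>\<^bsub>V\<^esub> \<ominus>\<^bsub>V\<^esub> (m \<odot>\<^bsub>V\<^esub> s)"
          proof -
            have "w \<oplus>\<^bsub>V\<^esub> \<ominus>\<^bsub>V\<^esub> (m \<odot>\<^bsub>V\<^esub> u)
                = (d \<odot>\<^bsub>V\<^esub> b \<oplus>\<^bsub>V\<^esub> \<ominus>\<^bsub>V\<^esub> (d \<odot>\<^bsub>V\<^esub> b)) \<oplus>\<^bsub>V\<^esub> (t \<oplus>\<^bsub>V\<^esub> \<ominus>\<^bsub>V\<^esub> (m \<odot>\<^bsub>V\<^esub> s))"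
              unfolding mu d(1) using cc by (simp add: M.minus_add M.a_ac)
            then show ?thesis using cc by (simp add: M.r_neg)
          qed
          then have "w \<oplus>\<^bsub>V\<^esub> \<ominus>\<^bsub>V\<^esub> (m \<odot>\<^bsub>V\<^esub> u) \<in> S" using SD d m c by simp
          moreover have "w \<oplus>\<^bsub>V\<^esub> \<ominus>\<^bsub>V\<^esub> (m \<odot>\<^bsub>V\<^esub> u) \<in> W" using WD w muU UW by blast
          ultimately have "w \<oplus>\<^bsub>V\<^esub> \<ominus>\<^bsub>V\<^esub> (m \<odot>\<^bsub>V\<^esub> u) \<in> U" using True by blast
          then have "(w \<oplus>\<^bsub>V\<^esub> \<ominus>\<^bsub>V\<^esub> (m \<odot>\<^bsub>V\<^esub> u)) \<oplus>\<^bsub>V\<^esub> m \<odot>\<^bsub>V\<^esub> u \<in> U" using UD muU by blast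
          moreover have "(w \<oplus>\<^bsub>V\<^esub> \<ominus>\<^bsub>V\<^esub> (m \<odot>\<^bsub>V\<^esub> u)) \<oplus>\<^bsub>V\<^esub> m \<odot>\<^bsub>V\<^esub> u = w"
            using WD(1) UD(1) w muU by (auto simp: M.a_assoc M.l_neg subset_iff)
          ultimately show False using w by simp
        qed
        moreover have "\<not> W \<subseteq> S" using \<open>U \<subseteq> S\<close> True UW by blast
        ultimately show ?thesis using True by (simp add: \<rho>'_def)
      qed
    qed
    moreover have "insert b B \<subseteq> T" using \<open>b \<in> T\<close> ST S by blast
    ultimately show ?case using T by blast
  }
qed

text \<open>A submodule that contains the generators contains all their linear combinations, so the
  bound \<open>W \<subseteq> S\<close> in \<open>finite_generated_rank\<close> holds for every
  \<open>W\<close>.\<close>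

lemma finite_dimensional_rank:
  fixes V :: "('f, 'm, 'z) module_scheme"
  assumes F: "field F" and V: "left_module F V" and fd: "finite_dimensional F V"
  shows "\<exists>\<rho> :: 'm set \<Rightarrow> nat. \<forall>U W. submodule U F V \<longrightarrow> submodule W F V \<longrightarrow> U \<subset> W \<longrightarrow> \<rho> U < \<rho> W"
proof -
  interpret left_module F V by fact
  obtain B where B: "finite B" "B \<subseteq> carrier V"
    and span: "\<And>v. v \<in> carrier V \<Longrightarrow> \<exists>a\<in>B \<rightarrow> carrier F. v = (\<Oplus>\<^bsub>V\<^esub>b\<in>B. a b \<odot>\<^bsub>V\<^esub> b)"
    using fd by (auto simp: finite_dimensional_def)
  obtain S and \<rho> :: "'m set \<Rightarrow> nat" where S: "submodule S F V" "B \<subseteq> S"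
    and \<rho>: "\<forall>U W. submodule U F V \<longrightarrow> submodule W F V \<longrightarrow> W \<subseteq> S \<longrightarrow> U \<subset> W \<longrightarrow> \<rho> U < \<rho> W"
    using finite_generated_rank[OF F V B] by blast
  note SD = left_submoduleD[OF S(1)]
  have "(\<Oplus>\<^bsub>V\<^esub>b\<in>A. a b \<odot>\<^bsub>V\<^esub> b) \<in> S" if "finite A" "A \<subseteq> B" "a \<in> B \<rightarrow> carrier F" for A a
    using that
  proof (induction A rule: finite_induct)
    case empty
    then show ?case using SD by simp
  next
    case (insert b A)
    have "(\<Oplus>\<^bsub>V\<^esub>b\<in>insert b A. a b \<odot>\<^bsub>V\<^esub> b) = a b \<odot>\<^bsub>V\<^esub> b \<oplus>\<^bsub>V\<^esub> (\<Oplus>\<^bsub>V\<^esub>b\<in>A. a b \<odot>\<^bsub>V\<^esub> b)"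
      by (rule M.finsum_insert) (use insert B smult_closed in \<open>auto simp: Pi_iff subset_iff\<close>)
    moreover have "a b \<odot>\<^bsub>V\<^esub> b \<in> S" using SD insert S by (auto simp: Pi_iff)
    ultimately show ?case using insert SD by simp
  qed
  then have "carrier V \<subseteq> S" using span B by (metis subsetI subset_refl)
  then have "W \<subseteq> S" if "submodule W F V" for W using left_submoduleD(1)[OF that] by blast
  then show ?thesis using \<rho> by blast
qed

text \<open>Extensional functions, so that endomorphisms with the same values on the carrier are
  equal and the ring axioms hold as equations of functions.\<close>

definition module_endomorphisms :: "('s, 'x) ring_scheme \<Rightarrow> ('s, 'm, 'y) module_scheme \<Rightarrow> ('m \<Rightarrow> 'm) set" where
  "module_endomorphisms S V = {h \<in> carrier V \<rightarrow>\<^sub>E carrier V.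
     (\<forall>x\<in>carrier V. \<forall>y\<in>carrier V. h (x \<oplus>\<^bsub>V\<^esub> y) = h x \<oplus>\<^bsub>V\<^esub> h y) \<and>
     (\<forall>s\<in>carrier S. \<forall>x\<in>carrier V. h (s \<odot>\<^bsub>V\<^esub> x) = s \<odot>\<^bsub>V\<^esub> h x)}"

definition endomorphism_ring :: "('s, 'x) ring_scheme \<Rightarrow> ('s, 'm, 'y) module_scheme \<Rightarrow> ('m \<Rightarrow> 'm) ring" where
  "endomorphism_ring S V =
     \<lparr>carrier = module_endomorphisms S V,
      monoid.mult = (\<lambda>g h. compose (carrier V) g h), one = (\<lambda>x\<in>carrier V. x),
      ring.zero = (\<lambda>x\<in>carrier V. \<zero>\<^bsub>V\<^esub>), add = (\<lambda>g h. \<lambda>x\<in>carrier V. g x \<oplus>\<^bsub>V\<^esub> h x)\<rparr>"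

context left_module
begin

abbreviation End where "End \<equiv> endomorphism_ring R M"

lemma End_sel [simp]:
  "monoid.mult End g h = compose (carrier M) g h" "monoid.one End = (\<lambda>x\<in>carrier M. x)"
  "ring.zero End = (\<lambda>x\<in>carrier M. \<zero>\<^bsub>M\<^esub>)" "ring.add End g h = (\<lambda>x\<in>carrier M. g x \<oplus>\<^bsub>M\<^esub> h x)"
  by (simp_all add: endomorphism_ring_def)

lemma EndI:
  assumes "h \<in> extensional (carrier M)" and "\<And>x. x \<in> carrier M \<Longrightarrow> h x \<in> carrier M"
    and "\<And>x y. x \<in> carrier M \<Longrightarrow> y \<in> carrier M \<Longrightarrow> h (x \<oplus>\<^bsub>M\<^esub> y) = h x \<oplus>\<^bsub>M\<^esub> h y"
    and "\<And>s x. s \<in> carrier R \<Longrightarrow> x \<in> carrier M \<Longrightarrow> h (s \<odot>\<^bsub>M\<^esub> x) = s \<odot>\<^bsub>M\<^esub> h x"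
  shows "h \<in> carrier End"
  using assms by (auto simp: endomorphism_ring_def module_endomorphisms_def PiE_def Pi_iff)

lemma EndD:
  assumes "h \<in> carrier End"
  shows "h \<in> extensional (carrier M)" and "x \<in> carrier M \<Longrightarrow> h x \<in> carrier M"
    and "\<lbrakk>x \<in> carrier M; y \<in> carrier M\<rbrakk> \<Longrightarrow> h (x \<oplus>\<^bsub>M\<^esub> y) = h x \<oplus>\<^bsub>M\<^esub> h y"
    and "\<lbrakk>s \<in> carrier R; x \<in> carrier M\<rbrakk> \<Longrightarrow> h (s \<odot>\<^bsub>M\<^esub> x) = s \<odot>\<^bsub>M\<^esub> h x"
  using assms by (auto simp: endomorphism_ring_def module_endomorphisms_def PiE_def Pi_iff)

lemma End_eqI:
  assumes "g \<in> carrier End" and "h \<in> carrier End" and "\<And>x. x \<in> carrier M \<Longrightarrow> g x = h x"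
  shows "g = h"
  using assms EndD(1) by (intro extensionalityI) auto

lemma End_zero_apply:
  assumes "h \<in> carrier End"
  shows "h \<zero>\<^bsub>M\<^esub> = \<zero>\<^bsub>M\<^esub>"
proof -
  have "h \<zero>\<^bsub>M\<^esub> \<oplus>\<^bsub>M\<^esub> h \<zero>\<^bsub>M\<^esub> = h \<zero>\<^bsub>M\<^esub>"
    using EndD(3)[OF assms, of "\<zero>\<^bsub>M\<^esub>" "\<zero>\<^bsub>M\<^esub>"] by simp
  then show ?thesis using M.add.l_cancel_one EndD(2)[OF assms] by simp
qed

lemma End_minus_apply:
  assumes "h \<in> carrier End" and "x \<in> carrier M"
  shows "h (\<ominus>\<^bsub>M\<^esub> x) = \<ominus>\<^bsub>M\<^esub> h x"
proof -
  have "h (\<ominus>\<^bsub>M\<^esub> x) \<oplus>\<^bsub>M\<^esub> h x = \<zero>\<^bsub>M\<^esub>"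
    using EndD(3)[OF assms(1), of "\<ominus>\<^bsub>M\<^esub> x" x] assms End_zero_apply[OF assms(1)] by (simp add: M.l_neg)
  then show ?thesis using M.minus_equality EndD(2)[OF assms(1)] assms(2) by simp
qed

lemma End_mult_closed: "g \<in> carrier End \<Longrightarrow> h \<in> carrier End \<Longrightarrow> compose (carrier M) g h \<in> carrier End"
  by (rule EndI) (auto simp: compose_eq EndD smult_closed)

lemma ring_End: "ring End"
proof (rule ringI)
  show "abelian_group End"
  proof (rule abelian_groupI)
    fix g h f assume "g \<in> carrier End" "h \<in> carrier End" "f \<in> carrier End"
    note g = EndD[OF this(1)] and h = EndD[OF this(2)] and f = EndD[OF this(3)]
    show "g \<oplus>\<^bsub>End\<^esub> h \<in> carrier End"
      by (rule EndI) (use g h in \<open>auto simp: M.a_ac smult_closed smult_r_distr\<close>)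
    show "g \<oplus>\<^bsub>End\<^esub> h \<oplus>\<^bsub>End\<^esub> f = g \<oplus>\<^bsub>End\<^esub> (h \<oplus>\<^bsub>End\<^esub> f)"
      by (rule extensionalityI[of _ "carrier M"]) (use g h f in \<open>auto simp: M.a_assoc\<close>)
    show "g \<oplus>\<^bsub>End\<^esub> h = h \<oplus>\<^bsub>End\<^esub> g"
      by (rule extensionalityI[of _ "carrier M"]) (use g h in \<open>auto simp: M.a_comm\<close>)
    show "\<zero>\<^bsub>End\<^esub> \<oplus>\<^bsub>End\<^esub> g = g"
      by (rule extensionalityI[of _ "carrier M"]) (use g in auto)
    show "\<exists>y\<in>carrier End. y \<oplus>\<^bsub>End\<^esub> g = \<zero>\<^bsub>End\<^esub>"
    proof (rule bexI[of _ "\<lambda>x\<in>carrier M. \<ominus>\<^bsub>M\<^esub> g x"])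
      show "(\<lambda>x\<in>carrier M. \<ominus>\<^bsub>M\<^esub> g x) \<in> carrier End"
        by (rule EndI) (use g in \<open>auto simp: smult_closed smult_minus_right M.minus_add\<close>)
      show "(\<lambda>x\<in>carrier M. \<ominus>\<^bsub>M\<^esub> g x) \<oplus>\<^bsub>End\<^esub> g = \<zero>\<^bsub>End\<^esub>"
        by (rule extensionalityI[of _ "carrier M"]) (use g in \<open>auto simp: M.l_neg\<close>)
    qed
  next
    show "\<zero>\<^bsub>End\<^esub> \<in> carrier End"
      by (rule EndI) (auto simp: smult_closed smult_zero_right)
  qed
  show "monoid End"
  proof (rule monoidI)
    fix g h f assume gh: "g \<in> carrier End" "h \<in> carrier End" and f: "f \<in> carrier End"
    note g = EndD[OF gh(1)] and h = EndD[OF gh(2)] and f = EndD[OF f]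
    show "g \<otimes>\<^bsub>End\<^esub> h \<in> carrier End"
      using End_mult_closed gh by simp
    show "g \<otimes>\<^bsub>End\<^esub> h \<otimes>\<^bsub>End\<^esub> f = g \<otimes>\<^bsub>End\<^esub> (h \<otimes>\<^bsub>End\<^esub> f)"
      by (rule extensionalityI[of _ "carrier M"]) (use g h f in \<open>auto simp: compose_eq\<close>)
    show "\<one>\<^bsub>End\<^esub> \<otimes>\<^bsub>End\<^esub> g = g" "g \<otimes>\<^bsub>End\<^esub> \<one>\<^bsub>End\<^esub> = g"
      by (rule extensionalityI[of _ "carrier M"]; use g in \<open>auto simp: compose_eq\<close>)+
  next
    show "\<one>\<^bsub>End\<^esub> \<in> carrier End" by (rule EndI) (auto simp: smult_closed)
  qed
next
  fix g h f assume "g \<in> carrier End" "h \<in> carrier End" "f \<in> carrier End"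
  note g = EndD[OF this(1)] and h = EndD[OF this(2)] and f = EndD[OF this(3)]
  show "(g \<oplus>\<^bsub>End\<^esub> h) \<otimes>\<^bsub>End\<^esub> f = g \<otimes>\<^bsub>End\<^esub> f \<oplus>\<^bsub>End\<^esub> h \<otimes>\<^bsub>End\<^esub> f"
    by (rule extensionalityI[of _ "carrier M"]) (use g h f in \<open>auto simp: compose_eq\<close>)
  show "f \<otimes>\<^bsub>End\<^esub> (g \<oplus>\<^bsub>End\<^esub> h) = f \<otimes>\<^bsub>End\<^esub> g \<oplus>\<^bsub>End\<^esub> f \<otimes>\<^bsub>End\<^esub> h"
    by (rule extensionalityI[of _ "carrier M"]) (use g h f in \<open>auto simp: compose_eq\<close>)
qed

lemma submodule_image: "h \<in> carrier End \<Longrightarrow> submodule (h ` carrier M) R M"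
proof (rule left_submoduleI)
  assume h: "h \<in> carrier End"
  note hD = EndD[OF h]
  show "h ` carrier M \<subseteq> carrier M" using hD by auto
  show "\<zero>\<^bsub>M\<^esub> \<in> h ` carrier M" using End_zero_apply[OF h] by (metis M.zero_closed imageI)
  show "\<ominus>\<^bsub>M\<^esub> x \<in> h ` carrier M" if "x \<in> h ` carrier M" for x
    using that End_minus_apply[OF h, symmetric] by auto
  show "x \<oplus>\<^bsub>M\<^esub> y \<in> h ` carrier M" if "x \<in> h ` carrier M" "y \<in> h ` carrier M" for x y
    using that hD(3)[symmetric] by auto
  show "a \<odot>\<^bsub>M\<^esub> x \<in> h ` carrier M" if "a \<in> carrier R" "x \<in> h ` carrier M" for a x
    using that hD(4)[symmetric] smult_closed by auto
qed

lemma submodule_kernel: "h \<in> carrier End \<Longrightarrow> submodule {x \<in> carrier M. h x = \<zero>\<^bsub>M\<^esub>} R M"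
  by (rule left_submoduleI)
    (auto simp: End_zero_apply End_minus_apply EndD smult_closed smult_zero_right)

text \<open>Fitting's lemma: some power of \<open>h\<close> is bijective on its own image \<open>B\<close>, and its inverse there,
  composed with that power, is the required \<open>y\<close>.\<close>

lemma fitting_End:
  fixes \<rho> :: "'m set \<Rightarrow> nat"
  assumes \<rho>: "\<And>U W. submodule U R M \<Longrightarrow> submodule W R M \<Longrightarrow> U \<subset> W \<Longrightarrow> \<rho> U < \<rho> W"
  shows "fitting_ring End (\<lambda>h. \<rho> (h ` carrier M))"
proof -
  interpret E: ring End by (rule ring_End)
  have le: "\<rho> U \<le> \<rho> W" if "submodule U R M" "submodule W R M" "U \<subseteq> W" for U W
    using \<rho>[OF that(1,2)] that(3) by (metis less_imp_le order_refl psubsetI)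
  have MM: "submodule (carrier M) R M"
    by (rule left_submoduleI) (auto simp: smult_closed)
  show ?thesis
  proof (rule fitting_ring.intro[OF ring_End], unfold_locales)
    \<comment> \<open>The rank of an idempotent is that of its image; two comparable idempotents
      with the same image coincide.\<close>
    fix p q assume pq: "E.idempotent p" "E.idempotent q" "q \<otimes>\<^bsub>End\<^esub> p = p" "p \<otimes>\<^bsub>End\<^esub> q = p" "p \<noteq> q"
    have pc: "p \<in> carrier End" "q \<in> carrier End" using pq by (auto simp: E.idempotent_def)
    have ap: "q (p x) = p x" "p (q x) = p x" "p (p x) = p x" if "x \<in> carrier M" for x
      using pq that unfolding E.idempotent_def End_sel by (metis compose_eq)+
    have "p ` carrier M \<subseteq> q ` carrier M"
    proof (rule image_subsetI)
      fix x assume "x \<in> carrier M"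
      then show "p x \<in> q ` carrier M"
        using ap(1) EndD(2)[OF pc(1)] by (intro image_eqI[of _ q "p x"]) auto
    qed
    moreover have "p ` carrier M \<noteq> q ` carrier M"
    proof
      assume eq: "p ` carrier M = q ` carrier M"
      have "p = q"
      proof (rule End_eqI[OF pc])
        fix x assume x: "x \<in> carrier M"
        then have "q x \<in> p ` carrier M" using eq by auto
        then obtain u where u: "u \<in> carrier M" "q x = p u" by auto
        then have "p (q x) = q x" using ap(3) by simp
        then show "p x = q x" using ap(2) x by simp
      qed
      then show False using pq by simp
    qed
    ultimately show "\<rho> (p ` carrier M) < \<rho> (q ` carrier M)"
      by (intro \<rho> submodule_image pc) auto
  next
    fix h assume h: "h \<in> carrier End"
    define H where "H n = h [^]\<^bsub>End\<^esub> n" for n :: nat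
    have Hc: "H n \<in> carrier End" for n using E.nat_pow_closed[OF h] by (simp add: H_def)
    note HD = EndD[OF Hc]
    note hD = EndD[OF h]
    have Hadd: "H (m + n) x = H m (H n x)" if "x \<in> carrier M" for m n x
    proof -
      have "H (m + n) = compose (carrier M) (H m) (H n)"
        using E.nat_pow_mult[OF h, of m n] by (simp add: H_def)
      then show ?thesis using that by (simp add: compose_eq)
    qed
    have H1: "H 1 = h" using E.nat_pow_eone[OF h] by (simp add: H_def del: End_sel)
    have Hr: "H (Suc n) x = H n (h x)" if "x \<in> carrier M" for n x
      using Hadd[OF that, of n 1] H1 by simp
    have Hl: "H (Suc n) x = h (H n x)" if "x \<in> carrier M" for n x
      using Hadd[OF that, of 1 n] H1 by simp
    define W where "W n = H n ` carrier M" for n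
    define N where "N n = {x \<in> carrier M. H n x = \<zero>\<^bsub>M\<^esub>}" for n
    have Ws: "submodule (W n) R M" and Ns: "submodule (N n) R M" for n
      unfolding W_def N_def using submodule_image submodule_kernel Hc by auto
    have Wdec: "W (Suc n) \<subseteq> W n" for n unfolding W_def using Hr hD by auto
    have Ninc: "N n \<subseteq> N (Suc n)" for n unfolding N_def using Hl End_zero_apply[OF h] by auto
    \<comment> \<open>Images shrink and kernels grow with \<open>n\<close>, so both summands
      decrease weakly; where their sum is least, both chains are stationary for one step.\<close>
    define \<mu> where "\<mu> n = \<rho> (W n) + (\<rho> (carrier M) - \<rho> (N n))" for n
    obtain n where n: "\<And>m. \<mu> n \<le> \<mu> m"
      using ex_has_least_nat[of "\<lambda>_. True" undefined \<mu>] by auto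
    have a: "\<rho> (W (Suc n)) \<le> \<rho> (W n)" "\<rho> (N n) \<le> \<rho> (N (Suc n))" "\<rho> (N (Suc n)) \<le> \<rho> (carrier M)"
      using le Ws Ns Wdec Ninc MM left_submoduleD(1)[OF Ns] by auto
    have Wn: "W (Suc n) = W n"
      using \<rho>[OF Ws Ws, of "Suc n" n] Wdec[of n] a n[of "Suc n"] unfolding \<mu>_def by (metis add_less_le_mono diff_le_mono2 leD psubsetI)
    have Nn: "N (Suc n) = N n"
      using \<rho>[OF Ns Ns, of n "Suc n"] Ninc[of n] a n[of "Suc n"] unfolding \<mu>_def
      by (metis add_le_less_mono diff_less_mono2 leD order_less_le_trans psubsetI)
    define B where "B = W n"
    have Bc: "B \<subseteq> carrier M" unfolding B_def using left_submoduleD(1)[OF Ws] .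
    have hB: "h ` B = B"
    proof -
      have "h ` W n = W (Suc n)" unfolding W_def image_image using Hl by auto
      then show ?thesis by (simp add: B_def Wn)
    qed
    \<comment> \<open>An element of \<open>B\<close> is some \<open>H n v\<close>. If
      \<open>h\<close> kills it, \<open>v\<close> lies in the kernel of the next power, which is
      already the kernel of \<open>H n\<close>.\<close>
    have h0: "w = \<zero>\<^bsub>M\<^esub>" if w: "w \<in> B" "h w = \<zero>\<^bsub>M\<^esub>" for w
    proof -
      obtain v where v: "v \<in> carrier M" "w = H n v" using w by (auto simp: B_def W_def)
      then have "v \<in> N (Suc n)" using w Hl by (simp add: N_def)
      then have "v \<in> N n" unfolding Nn .
      then show ?thesis using v by (simp add: N_def)
    qed
    note BD = left_submoduleD[OF Ws[of n], folded B_def]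
    have inj1: "inj_on h B"
    proof (rule inj_onI)
      fix u w assume uw: "u \<in> B" "w \<in> B" "h u = h w"
      have uwc: "u \<in> carrier M" "w \<in> carrier M" using uw Bc by auto
      have "h (u \<oplus>\<^bsub>M\<^esub> \<ominus>\<^bsub>M\<^esub> w) = \<zero>\<^bsub>M\<^esub>"
        using uw uwc hD End_minus_apply[OF h] by (simp add: M.r_neg)
      then have "u \<oplus>\<^bsub>M\<^esub> \<ominus>\<^bsub>M\<^esub> w = \<zero>\<^bsub>M\<^esub>" using h0 BD uw by simp
      then show "u = w" using uwc M.minus_equality[of u "\<ominus>\<^bsub>M\<^esub> w"] by simp
    qed
    have bij: "bij_betw (H m) B B" for m
    proof (induction m)
      case 0
      have "H 0 x = x" if "x \<in> B" for x using that Bc by (auto simp: H_def)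
      then show ?case by (auto simp: bij_betw_def inj_on_def)
    next
      case (Suc m)
      have "bij_betw (h \<circ> H m) B B" using Suc inj1 hB by (intro bij_betw_trans) (auto simp: bij_betw_def)
      moreover have "(h \<circ> H m) x = H (Suc m) x" if "x \<in> B" for x using Hl that Bc by auto
      ultimately show ?case by (simp cong: bij_betw_cong)
    qed
    \<comment> \<open>On \<open>B\<close> this is the inverse of \<open>h\<close>; since
      \<open>H n\<close> moves everything into \<open>B\<close>, the formula extends it to the whole
      module.\<close>
    define y where "y = (\<lambda>x\<in>carrier M. inv_into B (H (Suc n)) (H n x))"
    have HnB: "H n x \<in> B" if "x \<in> carrier M" for x using that by (auto simp: B_def W_def)
    have yB: "y x \<in> B" "H (Suc n) (y x) = H n x" if "x \<in> carrier M" for x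
    proof -
      have "H n x \<in> H (Suc n) ` B" using bij[of "Suc n"] HnB[OF that] by (simp add: bij_betw_def)
      then show "y x \<in> B" "H (Suc n) (y x) = H n x"
        using that by (simp_all add: y_def inv_into_into f_inv_into_f)
    qed
    \<comment> \<open>From this characterization of \<open>y x\<close> follow additivity, linearity
      and the commutation with every \<open>z\<close> that commutes with \<open>h\<close>.\<close>
    have uniq: "y x = w" if "x \<in> carrier M" "w \<in> B" "H (Suc n) w = H n x" for x w
      by (rule inj_onD[OF bij_betw_imp_inj_on[OF bij[of "Suc n"]]]) (use yB[OF that(1)] that in auto)
    have yc: "y \<in> carrier End"
    proof (rule EndI)
      show "y \<in> extensional (carrier M)" by (simp add: y_def)
      show "y x \<in> carrier M" if "x \<in> carrier M" for x using yB that Bc by auto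
      show "y (x \<oplus>\<^bsub>M\<^esub> x') = y x \<oplus>\<^bsub>M\<^esub> y x'" if "x \<in> carrier M" "x' \<in> carrier M" for x x'
        by (rule uniq) (use that yB BD HD Bc in \<open>auto simp: subset_iff\<close>)
      show "y (s \<odot>\<^bsub>M\<^esub> x) = s \<odot>\<^bsub>M\<^esub> y x" if "s \<in> carrier R" "x \<in> carrier M" for s x
        by (rule uniq) (use that yB BD HD Bc smult_closed in \<open>auto simp: subset_iff\<close>)
    qed
    have eq1: "H (Suc n) = compose (carrier M) (H (Suc (Suc n))) y"
    proof (rule End_eqI[OF Hc End_mult_closed[OF Hc yc]])
      fix x assume x: "x \<in> carrier M"
      have "H (Suc (Suc n)) (y x) = h (H (Suc n) (y x))" using Hl yB[OF x] Bc by blast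
      then show "H (Suc n) x = compose (carrier M) (H (Suc (Suc n))) y x"
        using x yB(2)[OF x] Hl by (simp add: compose_eq)
    qed
    have comm: "z \<otimes>\<^bsub>End\<^esub> y = y \<otimes>\<^bsub>End\<^esub> z" if z: "z \<in> carrier End" and zh: "z \<otimes>\<^bsub>End\<^esub> h = h \<otimes>\<^bsub>End\<^esub> z" for z
    proof -
      note zD = EndD[OF z]
      have zH: "z (H m x) = H m (z x)" if "x \<in> carrier M" for m x
      proof -
        have "H m \<otimes>\<^bsub>End\<^esub> z = z \<otimes>\<^bsub>End\<^esub> H m"
          unfolding H_def by (rule E.group_commutes_pow[OF zh[symmetric] h z])
        then show ?thesis using that unfolding End_sel by (metis compose_eq)
      qed
      show ?thesis unfolding End_sel
      proof (rule End_eqI[OF End_mult_closed[OF z yc] End_mult_closed[OF yc z]])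
        fix x assume x: "x \<in> carrier M"
        obtain v where v: "v \<in> carrier M" "y x = H n v" using yB(1)[OF x] by (auto simp: B_def W_def)
        have "z (y x) \<in> B" unfolding v(2) zH[OF v(1)] using HnB zD v by simp
        moreover have "H (Suc n) (z (y x)) = H n (z x)"
          using zH[of "y x" "Suc n"] zH[OF x, of n] yB[OF x] Bc by auto
        ultimately have "y (z x) = z (y x)" using uniq zD x by simp
        then show "compose (carrier M) z y x = compose (carrier M) y z x" using x by (simp add: compose_eq)
      qed
    qed
    show "\<exists>y\<in>carrier End. \<exists>n. h [^]\<^bsub>End\<^esub> Suc n = h [^]\<^bsub>End\<^esub> Suc (Suc n) \<otimes>\<^bsub>End\<^esub> y \<and>
        (\<forall>z\<in>carrier End. z \<otimes>\<^bsub>End\<^esub> h = h \<otimes>\<^bsub>End\<^esub> z \<longrightarrow> z \<otimes>\<^bsub>End\<^esub> y = y \<otimes>\<^bsub>End\<^esub> z)"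
      using yc eq1 comm unfolding H_def End_sel(1) by blast
  qed
qed

end

section \<open>Direct sums of modules\<close>

context left_module
begin

lemma smult_zero_left: "x \<in> carrier M \<Longrightarrow> \<zero> \<odot>\<^bsub>M\<^esub> x = \<zero>\<^bsub>M\<^esub>"
proof -
  assume x: "x \<in> carrier M"
  have "\<zero> \<odot>\<^bsub>M\<^esub> x \<oplus>\<^bsub>M\<^esub> \<zero> \<odot>\<^bsub>M\<^esub> x = \<zero> \<odot>\<^bsub>M\<^esub> x"
    using smult_l_distr[of \<zero> \<zero> x] x by simp
  then show ?thesis using M.add.l_cancel_one smult_closed x by simp
qed

lemma smult_minus_left:
  assumes "a \<in> carrier R" and "x \<in> carrier M"
  shows "(\<ominus> a) \<odot>\<^bsub>M\<^esub> x = \<ominus>\<^bsub>M\<^esub> (a \<odot>\<^bsub>M\<^esub> x)"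
proof -
  have "(\<ominus> a) \<odot>\<^bsub>M\<^esub> x \<oplus>\<^bsub>M\<^esub> a \<odot>\<^bsub>M\<^esub> x = \<zero>\<^bsub>M\<^esub>"
    using smult_l_distr[of "\<ominus> a" a x] assms smult_zero_left by (simp add: R.l_neg)
  then show ?thesis using M.minus_equality smult_closed assms by simp
qed

lemma smult_diff_left:
  assumes "a \<in> carrier R" and "b \<in> carrier R" and "x \<in> carrier M"
  shows "(a \<ominus> b) \<odot>\<^bsub>M\<^esub> x = a \<odot>\<^bsub>M\<^esub> x \<ominus>\<^bsub>M\<^esub> b \<odot>\<^bsub>M\<^esub> x"
  using assms by (simp add: a_minus_def smult_l_distr smult_minus_left)

end

lemma left_module_direct_sum:
  assumes R: "ring R" and M: "\<And>i. i \<in> I \<Longrightarrow> left_module R (M i)"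
  shows "left_module R (direct_sum_module I M)"
proof -
  interpret R: ring R by fact
  let ?N = "direct_sum_module I M"
  have ab: "abelian_group (M i)" if "i \<in> I" for i using M[OF that] by (simp add: left_module_def)
  note sm = left_module.smult_closed[OF M] left_module.smult_r_distr[OF M] left_module.smult_l_distr[OF M]
    left_module.smult_assoc1[OF M] left_module.smult_one[OF M] left_module.smult_zero_right[OF M]
  note am = abelian_group.axioms(1)[OF ab]
  have minus_zero: "\<ominus>\<^bsub>M i\<^esub> \<zero>\<^bsub>M i\<^esub> = \<zero>\<^bsub>M i\<^esub>" if "i \<in> I" for i
  proof -
    interpret abelian_group "M i" by (rule ab[OF that])
    show ?thesis by simp
  qed
  have zc: "\<zero>\<^bsub>M i\<^esub> \<in> carrier (M i)" if "i \<in> I" for i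
    using abelian_monoid.zero_closed[OF abelian_group.axioms(1)[OF ab[OF that]]] .
  have mem: "x \<in> carrier ?N \<longleftrightarrow> x \<in> (\<Pi>\<^sub>E i\<in>I. carrier (M i)) \<and> finite {i \<in> I. x i \<noteq> \<zero>\<^bsub>M i\<^esub>}" for x
    by (simp add: direct_sum_module_def)
  have sel: "x \<oplus>\<^bsub>?N\<^esub> y = (\<lambda>i\<in>I. x i \<oplus>\<^bsub>M i\<^esub> y i)" "\<zero>\<^bsub>?N\<^esub> = (\<lambda>i\<in>I. \<zero>\<^bsub>M i\<^esub>)"
    "a \<odot>\<^bsub>?N\<^esub> x = (\<lambda>i\<in>I. a \<odot>\<^bsub>M i\<^esub> x i)" for x y a
    by (simp_all add: direct_sum_module_def)
  have comp: "x i \<in> carrier (M i)" if "x \<in> carrier ?N" "i \<in> I" for x i using that by (auto simp: mem)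
  have ext: "x = y" if "x \<in> carrier ?N" "y \<in> extensional I" "\<And>i. i \<in> I \<Longrightarrow> x i = y i" for x y
    by (rule extensionalityI[of _ I]) (use that mem in \<open>auto simp: PiE_def\<close>)
  have add_mem: "x \<oplus>\<^bsub>?N\<^esub> y \<in> carrier ?N" if x: "x \<in> carrier ?N" and y: "y \<in> carrier ?N" for x y
  proof -
    have "{i \<in> I. x i \<oplus>\<^bsub>M i\<^esub> y i \<noteq> \<zero>\<^bsub>M i\<^esub>} \<subseteq> {i \<in> I. x i \<noteq> \<zero>\<^bsub>M i\<^esub>} \<union> {i \<in> I. y i \<noteq> \<zero>\<^bsub>M i\<^esub>}"
      using abelian_monoid.l_zero[OF am] zc by auto
    then have "finite {i \<in> I. x i \<oplus>\<^bsub>M i\<^esub> y i \<noteq> \<zero>\<^bsub>M i\<^esub>}"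
      using x y by (auto simp: mem elim: finite_subset)
    moreover have "{i \<in> I. (\<lambda>i\<in>I. x i \<oplus>\<^bsub>M i\<^esub> y i) i \<noteq> \<zero>\<^bsub>M i\<^esub>} = {i \<in> I. x i \<oplus>\<^bsub>M i\<^esub> y i \<noteq> \<zero>\<^bsub>M i\<^esub>}" by auto
    ultimately show ?thesis using x y comp abelian_monoid.a_closed[OF am] zc unfolding sel mem by auto
  qed
  \<comment> \<open>A componentwise map that preserves zero cannot enlarge the support; this serves
    both negation and scalar multiplication.\<close>
  have map_mem: "(\<lambda>i\<in>I. h i (x i)) \<in> carrier ?N"
    if x: "x \<in> carrier ?N" and h: "\<And>i y. i \<in> I \<Longrightarrow> y \<in> carrier (M i) \<Longrightarrow> h i y \<in> carrier (M i)"
      "\<And>i. i \<in> I \<Longrightarrow> h i \<zero>\<^bsub>M i\<^esub> = \<zero>\<^bsub>M i\<^esub>" for x h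
  proof -
    have "{i \<in> I. (\<lambda>i\<in>I. h i (x i)) i \<noteq> \<zero>\<^bsub>M i\<^esub>} \<subseteq> {i \<in> I. x i \<noteq> \<zero>\<^bsub>M i\<^esub>}"
      using h(2) by auto
    then have "finite {i \<in> I. (\<lambda>i\<in>I. h i (x i)) i \<noteq> \<zero>\<^bsub>M i\<^esub>}"
      by (rule finite_subset) (use x in \<open>simp add: mem\<close>)
    then show ?thesis using x h(1) comp unfolding mem by auto
  qed
  have zero_mem: "\<zero>\<^bsub>?N\<^esub> \<in> carrier ?N"
  proof -
    have "{i \<in> I. (\<lambda>i\<in>I. \<zero>\<^bsub>M i\<^esub>) i \<noteq> \<zero>\<^bsub>M i\<^esub>} = {}" by auto
    then show ?thesis unfolding sel mem using zc by auto
  qed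
  have ag: "abelian_group ?N"
  proof (rule abelian_groupI)
    fix x y z assume x: "x \<in> carrier ?N" and y: "y \<in> carrier ?N" and z: "z \<in> carrier ?N"
    show "x \<oplus>\<^bsub>?N\<^esub> y \<in> carrier ?N" by (rule add_mem[OF x y])
    show "x \<oplus>\<^bsub>?N\<^esub> y \<oplus>\<^bsub>?N\<^esub> z = x \<oplus>\<^bsub>?N\<^esub> (y \<oplus>\<^bsub>?N\<^esub> z)"
      by (rule ext[OF add_mem[OF add_mem[OF x y] z]]) (use abelian_monoid.a_assoc[OF am] comp x y z in \<open>auto simp: sel\<close>)
    show "x \<oplus>\<^bsub>?N\<^esub> y = y \<oplus>\<^bsub>?N\<^esub> x"
      by (rule ext[OF add_mem[OF x y]]) (use abelian_monoid.a_comm[OF am] comp x y in \<open>auto simp: sel\<close>)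
    show "\<zero>\<^bsub>?N\<^esub> \<oplus>\<^bsub>?N\<^esub> x = x"
      by (rule ext[symmetric, OF x]) (use abelian_monoid.l_zero[OF am] comp x in \<open>auto simp: sel\<close>)
    have neg: "(\<lambda>i\<in>I. \<ominus>\<^bsub>M i\<^esub> x i) \<in> carrier ?N"
      by (rule map_mem[OF x]) (use abelian_group.a_inv_closed[OF ab] minus_zero in auto)
    show "\<exists>y\<in>carrier ?N. y \<oplus>\<^bsub>?N\<^esub> x = \<zero>\<^bsub>?N\<^esub>"
      by (rule bexI[OF _ neg], rule ext[OF add_mem[OF neg x]]) (use abelian_group.l_neg[OF ab] comp x in \<open>auto simp: sel\<close>)
  qed (rule zero_mem)
  have smult_mem: "a \<odot>\<^bsub>?N\<^esub> x \<in> carrier ?N" if "a \<in> carrier R" "x \<in> carrier ?N" for a x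
    unfolding sel by (rule map_mem[OF that(2)]) (use sm(1,6) that in auto)
  show ?thesis
  proof (rule left_module.intro[OF R ag], rule left_module_axioms.intro)
    fix a b x y assume ab: "a \<in> carrier R" "b \<in> carrier R" and x: "x \<in> carrier ?N"
    show "(a \<oplus>\<^bsub>R\<^esub> b) \<odot>\<^bsub>?N\<^esub> x = a \<odot>\<^bsub>?N\<^esub> x \<oplus>\<^bsub>?N\<^esub> b \<odot>\<^bsub>?N\<^esub> x"
      by (rule ext[OF smult_mem]) (use ab x comp sm in \<open>auto simp: sel\<close>)
    show "(a \<otimes>\<^bsub>R\<^esub> b) \<odot>\<^bsub>?N\<^esub> x = a \<odot>\<^bsub>?N\<^esub> (b \<odot>\<^bsub>?N\<^esub> x)"
      by (rule ext[OF smult_mem]) (use ab x comp sm in \<open>auto simp: sel\<close>)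
  next
    fix a x y assume a: "a \<in> carrier R" and x: "x \<in> carrier ?N" and y: "y \<in> carrier ?N"
    show "a \<odot>\<^bsub>?N\<^esub> (x \<oplus>\<^bsub>?N\<^esub> y) = a \<odot>\<^bsub>?N\<^esub> x \<oplus>\<^bsub>?N\<^esub> a \<odot>\<^bsub>?N\<^esub> y"
      by (rule ext[OF smult_mem[OF a add_mem[OF x y]]]) (use a x y comp sm in \<open>auto simp: sel\<close>)
  next
    fix x assume x: "x \<in> carrier ?N"
    show "\<one>\<^bsub>R\<^esub> \<odot>\<^bsub>?N\<^esub> x = x"
      by (rule ext[OF smult_mem]) (use x comp sm mem in \<open>auto simp: sel PiE_def\<close>)
  qed (rule smult_mem)
qed

section \<open>Modules over the tensor product\<close>

text \<open>That the tensor product is a ring is assumed here; the theorem supplies it, since a left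
  module over it comes with the ring axioms for its scalars.\<close>

locale tensor_setting = K: field K + A: assoc_algebra "K\<lparr>carrier := k\<rparr>" A
  for K :: "'a ring" and k :: "'a set" and A :: "('a, 'l) module" +
  assumes subfield: "subfield k K" and ring_tensor: "ring (tensor_ring K k A)"
begin

abbreviation T where "T \<equiv> tensor_ring K k A"
abbreviation P where "P \<equiv> carrier K \<times> carrier A"
abbreviation F where "F \<equiv> free_pair_ring K A"
abbreviation rel where "rel \<equiv> tensor_relations K k A"
abbreviation pure where "pure \<equiv> pure_tensor K k A"

sublocale T: ring T by (rule ring_tensor)

lemma base_subset: "k \<subseteq> carrier K"
  using subfieldE(3)[OF subfield] .

lemma base_smult_closed: "c \<in> k \<Longrightarrow> x \<in> carrier A \<Longrightarrow> c \<odot>\<^bsub>A\<^esub> x \<in> carrier A"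
  using A.smult_closed by simp

lemma carrier_F [simp]: "carrier F = {u. Poly_Mapping.keys u \<subseteq> P}"
  by (simp add: free_pair_ring_def free_Abelian_group_def)

lemma add_F [simp]: "u \<oplus>\<^bsub>F\<^esub> v = u + v" and zero_F [simp]: "\<zero>\<^bsub>F\<^esub> = 0"
  by (simp_all add: free_pair_ring_def)

lemma add_monoid_F: "add_monoid F = free_Abelian_group P"
  by (simp add: free_pair_ring_def free_Abelian_group_def)

lemma frag_of_in_F: "a \<in> carrier K \<Longrightarrow> x \<in> carrier A \<Longrightarrow> frag_of (a, x) \<in> carrier F"
  by simp

lemma abelian_group_F: "abelian_group F"
proof -
  have c: "comm_group (add_monoid F)" unfolding add_monoid_F by (rule abelian_free_Abelian_group)
  then show ?thesis
    by (intro abelian_group.intro abelian_monoid.intro abelian_group_axioms.intro)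
      (simp_all add: comm_group_def)
qed

lemma F_diff: "u \<in> carrier F \<Longrightarrow> v \<in> carrier F \<Longrightarrow> u - v \<in> carrier F"
  unfolding carrier_F mem_Collect_eq using keys_diff by (meson Un_least order_trans)

lemma F_add: "u \<in> carrier F \<Longrightarrow> v \<in> carrier F \<Longrightarrow> u + v \<in> carrier F"
  unfolding carrier_F mem_Collect_eq using keys_add by (meson Un_least order_trans)

lemma relators_in_F: "tensor_relators K k A \<subseteq> carrier F"
  unfolding tensor_relators_def
proof (intro Un_least subsetI; elim CollectE exE conjE; hypsubst)
  fix a b x assume "a \<in> carrier K" "b \<in> carrier K" "x \<in> carrier A"
  then show "frag_of (a \<oplus>\<^bsub>K\<^esub> b, x) - frag_of (a, x) - frag_of (b, x) \<in> carrier F"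
    by (intro F_diff frag_of_in_F) auto
next
  fix a x y assume "a \<in> carrier K" "x \<in> carrier A" "y \<in> carrier A"
  then show "frag_of (a, x \<oplus>\<^bsub>A\<^esub> y) - frag_of (a, x) - frag_of (a, y) \<in> carrier F"
    by (intro F_diff frag_of_in_F) auto
next
  fix a c x assume "a \<in> carrier K" "c \<in> k" "x \<in> carrier A"
  then show "frag_of (a \<otimes>\<^bsub>K\<^esub> c, x) - frag_of (a, c \<odot>\<^bsub>A\<^esub> x) \<in> carrier F"
    using base_subset base_smult_closed by (intro F_diff frag_of_in_F) auto
qed

sublocale rel: abelian_subgroup rel F
proof (rule abelian_subgroupI3[OF _ abelian_group_F])
  interpret group "add_monoid F" unfolding add_monoid_F by simp
  have "subgroup rel (add_monoid F)"
    unfolding tensor_relations_def add_monoid_F[symmetric]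
    by (rule generate_is_subgroup) (use relators_in_F in simp)
  then show "additive_subgroup rel F" by (rule additive_subgroup.intro)
qed

definition coset where "coset u = rel +>\<^bsub>F\<^esub> u"

lemma pure_eq_coset: "pure a x = coset (frag_of (a, x))"
  by (simp add: pure_tensor_def coset_def)

lemma T_sel: "carrier T = a_rcosets\<^bsub>F\<^esub> rel" "C \<otimes>\<^bsub>T\<^esub> D = rcoset_mult F rel C D"
  "\<one>\<^bsub>T\<^esub> = coset \<one>\<^bsub>F\<^esub>" "\<zero>\<^bsub>T\<^esub> = rel" "C \<oplus>\<^bsub>T\<^esub> D = C <+>\<^bsub>F\<^esub> D"
  by (simp_all add: tensor_ring_def FactRing_def coset_def)

lemma rel_subset: "rel \<subseteq> carrier F"
  using rel.a_subset .

lemma coset_closed: "u \<in> carrier F \<Longrightarrow> coset u \<in> carrier T"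
  unfolding T_sel coset_def by (rule rel.a_rcosetsI[OF rel_subset])

lemma coset_cases:
  assumes "C \<in> carrier T"
  obtains u where "u \<in> carrier F" "C = coset u"
  using assms unfolding T_sel A_RCOSETS_def' coset_def by auto

lemma coset_add: "u \<in> carrier F \<Longrightarrow> v \<in> carrier F \<Longrightarrow> coset u \<oplus>\<^bsub>T\<^esub> coset v = coset (u + v)"
  unfolding T_sel coset_def using rel.a_rcos_sum[of u v] by simp

lemma mem_coset: "w \<in> coset u \<longleftrightarrow> (\<exists>h\<in>rel. w = h + u)"
  by (auto simp: coset_def a_r_coset_def')

lemma coset_eqI:
  assumes "u \<in> carrier F" and "v - u \<in> rel"
  shows "coset u = coset v"
proof -
  have "v \<in> rel +>\<^bsub>F\<^esub> u" using assms(2) mem_coset[of v u] by (force simp: coset_def)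
  then show ?thesis unfolding coset_def by (rule rel.a_repr_independence'[OF _ assms(1)])
qed

lemma coset_diff:
  assumes "u \<in> carrier F" and "v \<in> carrier F"
  shows "coset u \<ominus>\<^bsub>T\<^esub> coset v = coset (u - v)"
proof -
  have c: "coset u \<in> carrier T" "coset v \<in> carrier T" "coset (u - v) \<in> carrier T"
    using coset_closed assms F_diff by auto
  have "coset u = coset (u - v) \<oplus>\<^bsub>T\<^esub> coset v"
    using coset_add[OF F_diff[OF assms] assms(2)] by simp
  then show ?thesis
    using c by (simp add: a_minus_def T.a_assoc T.r_neg)
qed

lemma coset_zero: "coset 0 = \<zero>\<^bsub>T\<^esub>"
  unfolding coset_def T_sel using rel.a_coset_add_zero[OF rel_subset] by simp

lemma pure_closed [simp]: "a \<in> carrier K \<Longrightarrow> x \<in> carrier A \<Longrightarrow> pure a x \<in> carrier T"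
  unfolding pure_eq_coset by (rule coset_closed) simp

lemma relators_rel: "u \<in> tensor_relators K k A \<Longrightarrow> u \<in> rel"
  unfolding tensor_relations_def by (rule generate.incl)

lemma pure_add_left:
  assumes "a \<in> carrier K" "b \<in> carrier K" "x \<in> carrier A"
  shows "pure (a \<oplus>\<^bsub>K\<^esub> b) x = pure a x \<oplus>\<^bsub>T\<^esub> pure b x"
proof -
  have "coset (frag_of (a, x) + frag_of (b, x)) = coset (frag_of (a \<oplus>\<^bsub>K\<^esub> b, x))"
  proof (rule coset_eqI)
    show "frag_of (a, x) + frag_of (b, x) \<in> carrier F" using assms by (intro F_add) auto
    have "frag_of (a \<oplus>\<^bsub>K\<^esub> b, x) - frag_of (a, x) - frag_of (b, x) \<in> rel"
      by (rule relators_rel) (use assms in \<open>auto simp: tensor_relators_def\<close>)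
    then show "frag_of (a \<oplus>\<^bsub>K\<^esub> b, x) - (frag_of (a, x) + frag_of (b, x)) \<in> rel"
      by (simp add: diff_diff_add)
  qed
  then show ?thesis unfolding pure_eq_coset using coset_add frag_of_in_F assms by simp
qed

lemma pure_add_right:
  assumes "a \<in> carrier K" "x \<in> carrier A" "y \<in> carrier A"
  shows "pure a (x \<oplus>\<^bsub>A\<^esub> y) = pure a x \<oplus>\<^bsub>T\<^esub> pure a y"
proof -
  have "coset (frag_of (a, x) + frag_of (a, y)) = coset (frag_of (a, x \<oplus>\<^bsub>A\<^esub> y))"
  proof (rule coset_eqI)
    show "frag_of (a, x) + frag_of (a, y) \<in> carrier F" using assms by (intro F_add) auto
    have "frag_of (a, x \<oplus>\<^bsub>A\<^esub> y) - frag_of (a, x) - frag_of (a, y) \<in> rel"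
      by (rule relators_rel) (use assms in \<open>auto simp: tensor_relators_def\<close>)
    then show "frag_of (a, x \<oplus>\<^bsub>A\<^esub> y) - (frag_of (a, x) + frag_of (a, y)) \<in> rel"
      by (simp add: diff_diff_add)
  qed
  then show ?thesis unfolding pure_eq_coset using coset_add frag_of_in_F assms by simp
qed

lemma pure_balance:
  assumes "a \<in> carrier K" "c \<in> k" "x \<in> carrier A"
  shows "pure (a \<otimes>\<^bsub>K\<^esub> c) x = pure a (c \<odot>\<^bsub>A\<^esub> x)"
  unfolding pure_eq_coset
proof (rule coset_eqI[symmetric])
  show "frag_of (a, c \<odot>\<^bsub>A\<^esub> x) \<in> carrier F" using assms base_smult_closed by (intro frag_of_in_F) auto
  show "frag_of (a \<otimes>\<^bsub>K\<^esub> c, x) - frag_of (a, c \<odot>\<^bsub>A\<^esub> x) \<in> rel"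
    by (rule relators_rel) (use assms in \<open>auto simp: tensor_relators_def\<close>)
qed

text \<open>Since \<open>T\<close> is a ring, the product of two cosets is a coset; hence it is the coset of the
  product of any two representatives.\<close>

lemma pure_mult:
  assumes "a \<in> carrier K" "b \<in> carrier K" "x \<in> carrier A" "y \<in> carrier A"
  shows "pure a x \<otimes>\<^bsub>T\<^esub> pure b y = pure (a \<otimes>\<^bsub>K\<^esub> b) (x \<otimes>\<^bsub>A\<^esub> y)"
proof -
  have "pure a x \<otimes>\<^bsub>T\<^esub> pure b y \<in> carrier T" using assms by simp
  then obtain u where u: "u \<in> carrier F" "pure a x \<otimes>\<^bsub>T\<^esub> pure b y = coset u" by (rule coset_cases)
  have self: "v \<in> coset v" if "v \<in> carrier F" for v using rel.a_rcos_self[OF that] by (simp add: coset_def)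
  let ?w = "frag_of (a \<otimes>\<^bsub>K\<^esub> b, x \<otimes>\<^bsub>A\<^esub> y)"
  have w: "?w = frag_of (a, x) \<otimes>\<^bsub>F\<^esub> frag_of (b, y)" by (simp add: free_pair_ring_def)
  have "?w \<in> coset (frag_of (a, x) \<otimes>\<^bsub>F\<^esub> frag_of (b, y))"
    unfolding w[symmetric] by (rule self) (use assms in simp)
  moreover have "frag_of (a, x) \<in> pure a x" "frag_of (b, y) \<in> pure b y"
    unfolding pure_eq_coset by (rule self, use assms in simp)+
  ultimately have "?w \<in> rcoset_mult F rel (pure a x) (pure b y)"
    unfolding rcoset_mult_def coset_def by blast
  then have "?w \<in> rel +>\<^bsub>F\<^esub> u" using u(2) by (simp add: T_sel coset_def)
  then have "coset u = coset ?w" unfolding coset_def by (rule rel.a_repr_independence'[OF _ u(1)])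
  then show ?thesis using u(2) by (simp add: pure_eq_coset)
qed

lemma pure_one: "pure \<one>\<^bsub>K\<^esub> \<one>\<^bsub>A\<^esub> = \<one>\<^bsub>T\<^esub>"
  by (simp add: T_sel pure_eq_coset free_pair_ring_def)

text \<open>Differences cover sums and negatives in one step, following the induction principle of
  the free abelian group.\<close>

lemma tensor_induct [consumes 1, case_names zero pure diff]:
  assumes C: "C \<in> carrier T" and zero: "Q \<zero>\<^bsub>T\<^esub>"
    and pure: "\<And>a x. a \<in> carrier K \<Longrightarrow> x \<in> carrier A \<Longrightarrow> Q (pure a x)"
    and diff: "\<And>C D. C \<in> carrier T \<Longrightarrow> D \<in> carrier T \<Longrightarrow> Q C \<Longrightarrow> Q D \<Longrightarrow> Q (C \<ominus>\<^bsub>T\<^esub> D)"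
  shows "Q C"
proof -
  obtain u where u: "u \<in> carrier F" "C = coset u" using C by (rule coset_cases)
  have "Poly_Mapping.keys u \<subseteq> P" using u by simp
  then have "Q (coset u)"
  proof (induction rule: free_Abelian_group_induct[consumes 1, case_names zero diff one])
    case zero
    show ?case using assms(2) coset_zero by simp
  next
    case (diff x y)
    then show ?case using assms(4)[of "coset x" "coset y"] coset_closed coset_diff[of x y] by simp
  next
    case (one p)
    then show ?case using pure[of "fst p" "snd p"] by (auto simp: pure_eq_coset)
  qed
  then show ?thesis using u by simp
qed

section \<open>The action of an automorphism on the tensor product\<close>

context
  fixes \<phi> assumes \<phi>: "\<phi> \<in> galois_group K k"
begin

lemma phi_hom:
  "a \<in> carrier K \<Longrightarrow> \<phi> a \<in> carrier K"
  "a \<in> carrier K \<Longrightarrow> b \<in> carrier K \<Longrightarrow> \<phi> (a \<oplus>\<^bsub>K\<^esub> b) = \<phi> a \<oplus>\<^bsub>K\<^esub> \<phi> b"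
  "a \<in> carrier K \<Longrightarrow> b \<in> carrier K \<Longrightarrow> \<phi> (a \<otimes>\<^bsub>K\<^esub> b) = \<phi> a \<otimes>\<^bsub>K\<^esub> \<phi> b"
  "c \<in> k \<Longrightarrow> \<phi> c = c"
  using \<phi> by (auto simp: galois_group_def ring_iso_def ring_hom_def)

definition frag_map where "frag_map = frag_extend (\<lambda>(a, x). frag_of (\<phi> a, x))"

lemma frag_map_closed: "u \<in> carrier F \<Longrightarrow> frag_map u \<in> carrier F"
proof -
  assume "u \<in> carrier F"
  then have "Poly_Mapping.keys u \<subseteq> P" by simp
  then show ?thesis
  proof (induction rule: free_Abelian_group_induct[consumes 1, case_names zero diff one])
    case zero
    show ?case by (simp add: frag_map_def)
  next
    case (diff x y)
    then show ?case unfolding frag_map_def frag_extend_diff by (intro F_diff)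
  next
    case (one p)
    then show ?case by (cases p) (simp add: frag_map_def phi_hom)
  qed
qed

text \<open>Relators of each kind go to relators of the same kind; for the balancing ones it matters
  that \<open>\<phi>\<close> fixes \<open>k\<close>.\<close>

lemma frag_map_relators: "u \<in> tensor_relators K k A \<Longrightarrow> frag_map u \<in> tensor_relators K k A"
proof -
  assume u: "u \<in> tensor_relators K k A"
  show ?thesis
    using u[unfolded tensor_relators_def]
  proof (elim UnE CollectE exE conjE; hypsubst)
    fix a b x assume abx: "a \<in> carrier K" "b \<in> carrier K" "x \<in> carrier A"
    have "frag_map (frag_of (a \<oplus>\<^bsub>K\<^esub> b, x) - frag_of (a, x) - frag_of (b, x))
        = frag_of (\<phi> a \<oplus>\<^bsub>K\<^esub> \<phi> b, x) - frag_of (\<phi> a, x) - frag_of (\<phi> b, x)"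
      using abx by (simp add: frag_map_def frag_extend_diff phi_hom)
    then show "frag_map (frag_of (a \<oplus>\<^bsub>K\<^esub> b, x) - frag_of (a, x) - frag_of (b, x)) \<in> tensor_relators K k A"
      unfolding tensor_relators_def by (intro UnI1 CollectI exI[of _ "\<phi> a"] exI[of _ "\<phi> b"] exI[of _ x]) (simp add: abx phi_hom)
  next
    fix a x y assume axy: "a \<in> carrier K" "x \<in> carrier A" "y \<in> carrier A"
    have "frag_map (frag_of (a, x \<oplus>\<^bsub>A\<^esub> y) - frag_of (a, x) - frag_of (a, y))
        = frag_of (\<phi> a, x \<oplus>\<^bsub>A\<^esub> y) - frag_of (\<phi> a, x) - frag_of (\<phi> a, y)"
      by (simp add: frag_map_def frag_extend_diff)
    then show "frag_map (frag_of (a, x \<oplus>\<^bsub>A\<^esub> y) - frag_of (a, x) - frag_of (a, y)) \<in> tensor_relators K k A"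
      unfolding tensor_relators_def by - (rule UnI1, rule UnI2, intro CollectI exI[of _ "\<phi> a"] exI[of _ x] exI[of _ y], simp add: axy phi_hom)
  next
    fix a c x assume acx: "a \<in> carrier K" "c \<in> k" "x \<in> carrier A"
    have "frag_map (frag_of (a \<otimes>\<^bsub>K\<^esub> c, x) - frag_of (a, c \<odot>\<^bsub>A\<^esub> x))
        = frag_of (\<phi> a \<otimes>\<^bsub>K\<^esub> c, x) - frag_of (\<phi> a, c \<odot>\<^bsub>A\<^esub> x)"
      using acx base_subset by (simp add: frag_map_def frag_extend_diff phi_hom subset_iff)
    then show "frag_map (frag_of (a \<otimes>\<^bsub>K\<^esub> c, x) - frag_of (a, c \<odot>\<^bsub>A\<^esub> x)) \<in> tensor_relators K k A"
      unfolding tensor_relators_def by - (rule UnI2, intro CollectI exI[of _ "\<phi> a"] exI[of _ c] exI[of _ x], simp add: acx phi_hom)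
  qed
qed

lemma frag_map_rel: "u \<in> rel \<Longrightarrow> frag_map u \<in> rel"
  unfolding tensor_relations_def
proof (induction rule: generate.induct)
  case one
  then show ?case using generate.one[of "free_Abelian_group P" "tensor_relators K k A"] by (simp add: frag_map_def)
next
  case (incl h)
  then show ?case using frag_map_relators generate.incl by metis
next
  case (inv h)
  have h: "Poly_Mapping.keys h \<subseteq> P" "Poly_Mapping.keys (frag_map h) \<subseteq> P"
    using inv relators_in_F frag_map_closed by auto
  have "frag_map (- h) = - frag_map h" by (simp add: frag_map_def frag_extend_minus)
  then show ?case
    using generate.inv[OF frag_map_relators[OF inv], of "free_Abelian_group P"] h by simp
next
  case (eng h1 h2)
  then show ?case
    using generate.eng[of "frag_map h1" "free_Abelian_group P" "tensor_relators K k A" "frag_map h2"]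
    by (simp add: frag_map_def frag_extend_add)
qed

lemma tensor_map_coset:
  assumes u: "u \<in> carrier F"
  shows "tensor_map K k A \<phi> (coset u) = coset (frag_map u)"
proof -
  have "coset (frag_map v) = coset (frag_map u)" if "v \<in> coset u" for v
  proof -
    obtain h where h: "h \<in> rel" "v = h + u" using \<open>v \<in> coset u\<close> mem_coset by blast
    have "frag_map v - frag_map u = frag_map h" by (simp add: h frag_map_def frag_extend_add)
    then show ?thesis using coset_eqI[OF frag_map_closed[OF u], of "frag_map v"] frag_map_rel h by simp
  qed
  moreover have "u \<in> coset u" using rel.a_rcos_self[OF u] by (simp add: coset_def)
  ultimately show ?thesis
    unfolding tensor_map_def frag_map_def[symmetric] coset_def[symmetric] by blast
qed

lemma tensor_map_closed: "C \<in> carrier T \<Longrightarrow> tensor_map K k A \<phi> C \<in> carrier T"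
  by (erule coset_cases) (simp only: tensor_map_coset coset_closed frag_map_closed)

lemma tensor_map_pure:
  "a \<in> carrier K \<Longrightarrow> x \<in> carrier A \<Longrightarrow> tensor_map K k A \<phi> (pure a x) = pure (\<phi> a) x"
  unfolding pure_eq_coset using tensor_map_coset[OF frag_of_in_F] by (simp add: frag_map_def)

lemma tensor_map_zero: "tensor_map K k A \<phi> \<zero>\<^bsub>T\<^esub> = \<zero>\<^bsub>T\<^esub>"
  using tensor_map_coset[of 0] by (simp add: coset_zero frag_map_def)

lemma tensor_map_diff:
  assumes "C \<in> carrier T" and "D \<in> carrier T"
  shows "tensor_map K k A \<phi> (C \<ominus>\<^bsub>T\<^esub> D) = tensor_map K k A \<phi> C \<ominus>\<^bsub>T\<^esub> tensor_map K k A \<phi> D"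
proof -
  obtain u v where uv: "u \<in> carrier F" "C = coset u" "v \<in> carrier F" "D = coset v"
    using assms by (metis coset_cases)
  show ?thesis
    unfolding uv coset_diff[OF uv(1,3)] tensor_map_coset[OF F_diff[OF uv(1,3)]]
      tensor_map_coset[OF uv(1)] tensor_map_coset[OF uv(3)]
      coset_diff[OF frag_map_closed[OF uv(1)] frag_map_closed[OF uv(3)]]
    by (simp add: frag_map_def frag_extend_diff)
qed

end

text \<open>Both sides are additive in \<open>C\<close>, so pure tensors suffice. \<open>s\<close>
  is general for two uses: the identity for linear maps, and \<open>tensor_map\<close> for
  semilinear ones.\<close>

lemma tensor_semilinearI:
  assumes M: "left_module T M" and N: "left_module T N"
    and h: "\<And>m. m \<in> carrier M \<Longrightarrow> h m \<in> carrier N"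
      "\<And>m m'. m \<in> carrier M \<Longrightarrow> m' \<in> carrier M \<Longrightarrow> h (m \<oplus>\<^bsub>M\<^esub> m') = h m \<oplus>\<^bsub>N\<^esub> h m'"
    and s: "\<And>C. C \<in> carrier T \<Longrightarrow> s C \<in> carrier T" "s \<zero>\<^bsub>T\<^esub> = \<zero>\<^bsub>T\<^esub>"
      "\<And>C D. C \<in> carrier T \<Longrightarrow> D \<in> carrier T \<Longrightarrow> s (C \<ominus>\<^bsub>T\<^esub> D) = s C \<ominus>\<^bsub>T\<^esub> s D"
    and pure: "\<And>a x m. a \<in> carrier K \<Longrightarrow> x \<in> carrier A \<Longrightarrow> m \<in> carrier M \<Longrightarrow>
      h (pure a x \<odot>\<^bsub>M\<^esub> m) = s (pure a x) \<odot>\<^bsub>N\<^esub> h m"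
    and C: "C \<in> carrier T" and m: "m \<in> carrier M"
  shows "h (C \<odot>\<^bsub>M\<^esub> m) = s C \<odot>\<^bsub>N\<^esub> h m"
proof -
  interpret M: left_module T M by fact
  interpret N: left_module T N by fact
  have "h \<zero>\<^bsub>M\<^esub> \<oplus>\<^bsub>N\<^esub> h \<zero>\<^bsub>M\<^esub> = h \<zero>\<^bsub>M\<^esub>" using h(2)[of "\<zero>\<^bsub>M\<^esub>" "\<zero>\<^bsub>M\<^esub>"] by simp
  then have h0: "h \<zero>\<^bsub>M\<^esub> = \<zero>\<^bsub>N\<^esub>" using N.M.add.l_cancel_one h(1) by simp
  have hm: "h (\<ominus>\<^bsub>M\<^esub> x) = \<ominus>\<^bsub>N\<^esub> h x" if x: "x \<in> carrier M" for x
  proof -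
    have "h (\<ominus>\<^bsub>M\<^esub> x) \<oplus>\<^bsub>N\<^esub> h x = \<zero>\<^bsub>N\<^esub>"
      using h(2)[of "\<ominus>\<^bsub>M\<^esub> x" x] x h0 by (simp add: M.M.l_neg)
    then show ?thesis using N.M.minus_equality h(1) x by simp
  qed
  show ?thesis
    using C
  proof (induction rule: tensor_induct)
    case zero
    then show ?case using s(2) M.smult_zero_left[OF m] N.smult_zero_left[OF h(1)[OF m]] h0 by simp
  next
    case (diff C D)
    then show ?case
      using M.smult_diff_left[of C D m] N.smult_diff_left[of "s C" "s D" "h m"] s m h hm M.smult_closed
      by (simp add: a_minus_def)
  qed (rule pure, use m in auto)
qed

end

context tensor_setting
begin

lemma pure_hom_right: "(\<lambda>x. pure \<one>\<^bsub>K\<^esub> x) \<in> ring_hom A T"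
  by (rule ring_hom_memI) (simp_all add: pure_mult pure_add_right pure_one)

lemma pure_hom_left: "(\<lambda>a. pure a \<one>\<^bsub>A\<^esub>) \<in> ring_hom (K\<lparr>carrier := k\<rparr>) T"
  using base_subset by (intro ring_hom_memI) (auto simp: pure_mult pure_add_left pure_one subset_iff)

text \<open>Scalars from \<open>k\<close> thus act through \<open>A\<close>: submodules over
  \<open>A\<close> are \<open>k\<close>-subspaces, and \<open>A\<close>-linear maps are
  \<open>k\<close>-linear.\<close>

lemma pure_base:
  assumes "c \<in> k"
  shows "pure c \<one>\<^bsub>A\<^esub> = pure \<one>\<^bsub>K\<^esub> (c \<odot>\<^bsub>A\<^esub> \<one>\<^bsub>A\<^esub>)"
  using pure_balance[of "\<one>\<^bsub>K\<^esub>" c "\<one>\<^bsub>A\<^esub>"] assms base_subset by (simp add: subset_iff)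

lemma pure_factor:
  assumes "a \<in> carrier K" "x \<in> carrier A"
  shows "pure a x = pure a \<one>\<^bsub>A\<^esub> \<otimes>\<^bsub>T\<^esub> pure \<one>\<^bsub>K\<^esub> x" "pure a x = pure \<one>\<^bsub>K\<^esub> x \<otimes>\<^bsub>T\<^esub> pure a \<one>\<^bsub>A\<^esub>"
  using assms by (simp_all add: pure_mult)

lemma pure_smult:
  assumes M: "left_module T M" and "a \<in> carrier K" "x \<in> carrier A" "m \<in> carrier M"
  shows "pure a x \<odot>\<^bsub>M\<^esub> m = pure a \<one>\<^bsub>A\<^esub> \<odot>\<^bsub>M\<^esub> (pure \<one>\<^bsub>K\<^esub> x \<odot>\<^bsub>M\<^esub> m)"
    and "pure a x \<odot>\<^bsub>M\<^esub> m = pure \<one>\<^bsub>K\<^esub> x \<odot>\<^bsub>M\<^esub> (pure a \<one>\<^bsub>A\<^esub> \<odot>\<^bsub>M\<^esub> m)"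
  using left_module.smult_assoc1[OF M, of "pure a \<one>\<^bsub>A\<^esub>" "pure \<one>\<^bsub>K\<^esub> x" m]
    left_module.smult_assoc1[OF M, of "pure \<one>\<^bsub>K\<^esub> x" "pure a \<one>\<^bsub>A\<^esub>" m] assms pure_factor[of a x]
  by simp_all

lemma right_factor_left_module:
  assumes "left_module T M"
  shows "left_module A (as_right_factor_module K k A M)"
  unfolding as_right_factor_module_def
  by (rule left_module_restrict_scalars[OF assms A.ring_axioms pure_hom_right])

text \<open>Finite dimension is given for the action of \<open>k\<close> through \<open>K\<close>.
  By \<open>pure_base\<close>, every \<open>A\<close>-submodule is a subspace for that action, so
  the rank function of subspaces serves.\<close>

lemma right_factor_rank:
  fixes M :: "(('a \<times> 'l \<Rightarrow>\<^sub>0 int) set, 'm) module"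
  assumes M: "left_module T M"
    and fd: "finite_dimensional (K\<lparr>carrier := k\<rparr>) (as_left_factor_module K k A M)"
  shows "\<exists>\<rho> :: 'm set \<Rightarrow> nat. \<forall>U W. submodule U A (as_right_factor_module K k A M) \<longrightarrow>
    submodule W A (as_right_factor_module K k A M) \<longrightarrow> U \<subset> W \<longrightarrow> \<rho> U < \<rho> W"
proof -
  let ?k = "K\<lparr>carrier := k\<rparr>" and ?L = "as_left_factor_module K k A M" and ?V = "as_right_factor_module K k A M"
  interpret M: left_module T M by fact
  have kf: "field ?k" using K.subfield_iff(2)[OF subfield] .
  have kr: "ring ?k" by (rule cring.axioms(1)[OF domain.axioms(1)[OF field.axioms(1)[OF kf]]])
  have L: "left_module ?k ?L"
    unfolding as_left_factor_module_def
    by (rule left_module_restrict_scalars[OF M kr pure_hom_left])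
  have "submodule U ?k ?L" if U: "submodule U A ?V" for U
  proof -
    note D = left_module.left_submoduleD[OF right_factor_left_module[OF M] U]
    show ?thesis
    proof (rule left_module.left_submoduleI[OF L])
      show "U \<subseteq> carrier ?L" using D(1) by (simp add: as_left_factor_module_def as_right_factor_module_def restrict_scalars_def)
      show "\<zero>\<^bsub>?L\<^esub> \<in> U" using D(2) by (simp add: as_left_factor_module_def as_right_factor_module_def restrict_scalars_def)
      show "\<ominus>\<^bsub>?L\<^esub> x \<in> U" if x: "x \<in> U" for x
      proof -
        \<comment> \<open>Negatives in the two module records are different terms and are identified
          by uniqueness of inverses.\<close>
        interpret L: left_module ?k ?L by (rule L)
        interpret V: left_module A ?V by (rule right_factor_left_module[OF M])
        have xc: "x \<in> carrier ?V" "\<ominus>\<^bsub>?V\<^esub> x \<in> carrier ?V" using D(1) x by auto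
        have "\<ominus>\<^bsub>?V\<^esub> x \<oplus>\<^bsub>?V\<^esub> x = \<zero>\<^bsub>?V\<^esub>" using xc by (simp add: V.M.l_neg)
        then have "\<ominus>\<^bsub>?L\<^esub> x = \<ominus>\<^bsub>?V\<^esub> x"
          using xc by (intro L.M.minus_equality)
            (simp_all add: as_left_factor_module_def as_right_factor_module_def restrict_scalars_def)
        then show ?thesis using D(3)[OF x] by simp
      qed
      show "x \<oplus>\<^bsub>?L\<^esub> y \<in> U" if "x \<in> U" "y \<in> U" for x y
        using D(4)[OF that] by (simp add: as_left_factor_module_def as_right_factor_module_def restrict_scalars_def)
      show "c \<odot>\<^bsub>?L\<^esub> x \<in> U" if "c \<in> carrier ?k" "x \<in> U" for c x
        using D(5)[of "c \<odot>\<^bsub>A\<^esub> \<one>\<^bsub>A\<^esub>" x] that base_smult_closed[of c "\<one>\<^bsub>A\<^esub>"] pure_base[of c]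
        by (simp add: as_left_factor_module_def as_right_factor_module_def restrict_scalars_def)
    qed
  qed
  note submodule = this
  obtain \<rho> :: "'m set \<Rightarrow> nat"
    where \<rho>: "\<forall>U W. submodule U ?k ?L \<longrightarrow> submodule W ?k ?L \<longrightarrow> U \<subset> W \<longrightarrow> \<rho> U < \<rho> W"
    by (rule exE[OF finite_dimensional_rank[OF kf L fd]])
  show ?thesis
    by (intro exI[of _ \<rho>] allI impI) (rule \<rho>[rule_format, OF submodule submodule])
qed

end

section \<open>Transport of the action of K along an isomorphism over the algebra\<close>

locale isomorphic_over_algebra = tensor_setting K k A
  for K :: "'a ring" and k :: "'a set" and A :: "('a, 'l) module" +
  fixes M :: "(('a \<times> 'l \<Rightarrow>\<^sub>0 int) set, 'm) module"
    and J :: "'i set" and Ms :: "'i \<Rightarrow> (('a \<times> 'l \<Rightarrow>\<^sub>0 int) set, 'n) module"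
    and f :: "'m \<Rightarrow> 'i \<Rightarrow> 'n" and \<rho> :: "'m set \<Rightarrow> nat"
  assumes M: "left_module T M" and J: "finite J" and Ms: "\<And>i. i \<in> J \<Longrightarrow> left_module T (Ms i)"
    and indecomposable: "\<And>i. i \<in> J \<Longrightarrow> indecomposable_module T (Ms i)"
    and f_bij: "bij_betw f (carrier M) (carrier (direct_sum_module J Ms))"
    and f_add: "\<lbrakk>x \<in> carrier M; y \<in> carrier M\<rbrakk> \<Longrightarrow> f (x \<oplus>\<^bsub>M\<^esub> y) = f x \<oplus>\<^bsub>direct_sum_module J Ms\<^esub> f y"
    and f_smult: "\<lbrakk>a \<in> carrier A; x \<in> carrier M\<rbrakk> \<Longrightarrow>
      f (pure \<one>\<^bsub>K\<^esub> a \<odot>\<^bsub>M\<^esub> x) = pure \<one>\<^bsub>K\<^esub> a \<odot>\<^bsub>direct_sum_module J Ms\<^esub> f x"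
    and separable: "separable_extension K k" and normal: "normal_extension K k"
    and finite_extension: "ring.finite_dimension K k (carrier K)"
    and rank: "\<lbrakk>submodule U A (as_right_factor_module K k A M); submodule W A (as_right_factor_module K k A M);
      U \<subset> W\<rbrakk> \<Longrightarrow> \<rho> U < \<rho> W"
begin

abbreviation N where "N \<equiv> direct_sum_module J Ms"
abbreviation V where "V \<equiv> as_right_factor_module K k A M"
abbreviation E where "E \<equiv> endomorphism_ring A V"

sublocale M: left_module T M by (rule M)
sublocale N: left_module T N by (rule left_module_direct_sum[OF T.ring_axioms Ms])
sublocale V: left_module A V by (rule right_factor_left_module[OF M])

lemma V_sel [simp]: "carrier V = carrier M" "x \<oplus>\<^bsub>V\<^esub> y = x \<oplus>\<^bsub>M\<^esub> y" "\<zero>\<^bsub>V\<^esub> = \<zero>\<^bsub>M\<^esub>"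
  "a \<odot>\<^bsub>V\<^esub> x = pure \<one>\<^bsub>K\<^esub> a \<odot>\<^bsub>M\<^esub> x"
  by (simp_all add: as_right_factor_module_def restrict_scalars_def)

lemma N_mem: "n \<in> carrier N \<longleftrightarrow> n \<in> (\<Pi>\<^sub>E i\<in>J. carrier (Ms i))"
  using J by (simp add: direct_sum_module_def)

lemma N_sel: "x \<oplus>\<^bsub>N\<^esub> y = (\<lambda>i\<in>J. x i \<oplus>\<^bsub>Ms i\<^esub> y i)" "\<zero>\<^bsub>N\<^esub> = (\<lambda>i\<in>J. \<zero>\<^bsub>Ms i\<^esub>)"
  "C \<odot>\<^bsub>N\<^esub> x = (\<lambda>i\<in>J. C \<odot>\<^bsub>Ms i\<^esub> x i)"
  by (simp_all add: direct_sum_module_def)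

lemma N_component: "n \<in> carrier N \<Longrightarrow> i \<in> J \<Longrightarrow> n i \<in> carrier (Ms i)"
  by (auto simp: N_mem)

lemma N_eqI: "n \<in> carrier N \<Longrightarrow> n' \<in> carrier N \<Longrightarrow> (\<And>i. i \<in> J \<Longrightarrow> n i = n' i) \<Longrightarrow> n = n'"
  unfolding N_mem by (rule PiE_ext)

lemma Ms_group: "i \<in> J \<Longrightarrow> abelian_group (Ms i)"
  using Ms by (simp add: left_module_def)

lemma Ms_zero_closed: "i \<in> J \<Longrightarrow> \<zero>\<^bsub>Ms i\<^esub> \<in> carrier (Ms i)"
  by (rule abelian_monoid.zero_closed[OF abelian_group.axioms(1)[OF Ms_group]])

definition g where "g = inv_into (carrier M) f"

lemma f_closed: "m \<in> carrier M \<Longrightarrow> f m \<in> carrier N"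
  using f_bij by (auto simp: bij_betw_def)

lemma g_closed: "n \<in> carrier N \<Longrightarrow> g n \<in> carrier M"
  unfolding g_def using f_bij by (metis bij_betw_def inv_into_into)

lemma f_g: "n \<in> carrier N \<Longrightarrow> f (g n) = n"
  unfolding g_def using f_bij by (metis bij_betw_def f_inv_into_f)

lemma f_inj: "x \<in> carrier M \<Longrightarrow> y \<in> carrier M \<Longrightarrow> f x = f y \<Longrightarrow> x = y"
  using f_bij by (auto simp: bij_betw_def dest: inj_onD)

text \<open>Carries a self-map of \<open>N\<close> over to \<open>M\<close>, so that both actions of
  \<open>K\<close> and the projections live in one endomorphism ring.\<close>

definition conj where "conj t = (\<lambda>m\<in>carrier M. g (t (f m)))"

lemma f_conj: "m \<in> carrier M \<Longrightarrow> t (f m) \<in> carrier N \<Longrightarrow> f (conj t m) = t (f m)"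
  by (simp add: conj_def f_g)

lemma E_eqI:
  assumes "h \<in> carrier E" "h' \<in> carrier E"
    and "\<And>m i. m \<in> carrier M \<Longrightarrow> i \<in> J \<Longrightarrow> f (h m) i = f (h' m) i"
  shows "h = h'"
proof (rule V.End_eqI[OF assms(1,2)])
  fix m assume "m \<in> carrier V"
  then show "h m = h' m"
    using V.EndD(2)[OF assms(1), of m] V.EndD(2)[OF assms(2), of m] assms(3)
    by (intro f_inj N_eqI[of "f (h m)" "f (h' m)"]) (auto simp: f_closed)
qed

lemma conj_closed:
  assumes t: "\<And>n. n \<in> carrier N \<Longrightarrow> t n \<in> carrier N"
    and a: "\<And>n n'. n \<in> carrier N \<Longrightarrow> n' \<in> carrier N \<Longrightarrow> t (n \<oplus>\<^bsub>N\<^esub> n') = t n \<oplus>\<^bsub>N\<^esub> t n'"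
    and s: "\<And>x n. x \<in> carrier A \<Longrightarrow> n \<in> carrier N \<Longrightarrow> t (pure \<one>\<^bsub>K\<^esub> x \<odot>\<^bsub>N\<^esub> n) = pure \<one>\<^bsub>K\<^esub> x \<odot>\<^bsub>N\<^esub> t n"
  shows "conj t \<in> carrier E"
proof (rule V.EndI)
  show "conj t \<in> extensional (carrier V)" by (simp add: conj_def)
  have c: "conj t x \<in> carrier M" if "x \<in> carrier M" for x
    using that t by (simp add: conj_def g_closed f_closed)
  then show "conj t x \<in> carrier V" if "x \<in> carrier V" for x using that by simp
  have fc: "f (conj t x) = t (f x)" if "x \<in> carrier M" for x using f_conj that t f_closed by blast
  show "conj t (x \<oplus>\<^bsub>V\<^esub> y) = conj t x \<oplus>\<^bsub>V\<^esub> conj t y" if "x \<in> carrier V" "y \<in> carrier V" for x y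
    using that c fc a f_closed by (simp add: f_inj f_add)
  show "conj t (s \<odot>\<^bsub>V\<^esub> x) = s \<odot>\<^bsub>V\<^esub> conj t x" if "s \<in> carrier A" "x \<in> carrier V" for s x
    using that c fc s f_closed M.smult_closed by (simp add: f_inj f_smult)
qed

text \<open>\<open>\<alpha>\<close> is the action of \<open>K\<close> on \<open>M\<close>; \<open>\<beta>\<close> and \<open>e\<close> are the action of \<open>K\<close> on \<open>N\<close> and the projections
  of \<open>N\<close>, both transported to \<open>M\<close> along \<open>f\<close>.\<close>

definition \<alpha> where "\<alpha> a = (\<lambda>m\<in>carrier M. pure a \<one>\<^bsub>A\<^esub> \<odot>\<^bsub>M\<^esub> m)"
definition \<beta> where "\<beta> a = conj (\<lambda>n. pure a \<one>\<^bsub>A\<^esub> \<odot>\<^bsub>N\<^esub> n)"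
definition component where "component i n = (\<lambda>j\<in>J. if j = i then n j else \<zero>\<^bsub>Ms j\<^esub>)"
definition e where "e i = conj (component i)"

lemma component_closed: "n \<in> carrier N \<Longrightarrow> component i n \<in> carrier N"
  unfolding N_mem component_def using N_component[of n] Ms_zero_closed by (auto simp: N_mem)

lemma component_add:
  assumes "n \<in> carrier N" "n' \<in> carrier N"
  shows "component i (n \<oplus>\<^bsub>N\<^esub> n') = component i n \<oplus>\<^bsub>N\<^esub> component i n'"
proof (rule N_eqI)
  fix j assume j: "j \<in> J"
  interpret G: abelian_group "Ms j" by (rule Ms_group[OF j])
  show "component i (n \<oplus>\<^bsub>N\<^esub> n') j = (component i n \<oplus>\<^bsub>N\<^esub> component i n') j"
    using j by (cases "j = i") (simp_all add: N_sel component_def)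
qed (use assms component_closed in auto)

lemma component_smult:
  assumes "C \<in> carrier T" "n \<in> carrier N"
  shows "component i (C \<odot>\<^bsub>N\<^esub> n) = C \<odot>\<^bsub>N\<^esub> component i n"
proof (rule N_eqI)
  fix j assume j: "j \<in> J"
  interpret G: left_module T "Ms j" by (rule Ms[OF j])
  show "component i (C \<odot>\<^bsub>N\<^esub> n) j = (C \<odot>\<^bsub>N\<^esub> component i n) j"
    using j assms by (cases "j = i") (simp_all add: N_sel component_def G.smult_zero_right)
qed (use assms component_closed N.smult_closed in auto)

lemma e_closed: "e i \<in> carrier E"
  unfolding e_def by (rule conj_closed) (simp_all add: component_closed component_add component_smult)

lemma f_e: "m \<in> carrier M \<Longrightarrow> f (e i m) = component i (f m)"
  unfolding e_def by (rule f_conj) (simp_all add: component_closed f_closed)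

lemma \<beta>_closed:
  assumes a: "a \<in> carrier K"
  shows "\<beta> a \<in> carrier E"
  unfolding \<beta>_def
proof (rule conj_closed)
  fix x n assume "x \<in> carrier A" "n \<in> carrier N"
  then show "pure a \<one>\<^bsub>A\<^esub> \<odot>\<^bsub>N\<^esub> (pure \<one>\<^bsub>K\<^esub> x \<odot>\<^bsub>N\<^esub> n) = pure \<one>\<^bsub>K\<^esub> x \<odot>\<^bsub>N\<^esub> (pure a \<one>\<^bsub>A\<^esub> \<odot>\<^bsub>N\<^esub> n)"
    using pure_smult[OF N.left_module_axioms a] by metis
qed (use a N.smult_closed N.smult_r_distr in auto)

lemma f_\<beta>: "a \<in> carrier K \<Longrightarrow> m \<in> carrier M \<Longrightarrow> f (\<beta> a m) = pure a \<one>\<^bsub>A\<^esub> \<odot>\<^bsub>N\<^esub> f m"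
  unfolding \<beta>_def by (rule f_conj) (simp_all add: N.smult_closed f_closed)

lemma \<alpha>_closed:
  assumes a: "a \<in> carrier K"
  shows "\<alpha> a \<in> carrier E"
proof (rule V.EndI)
  fix x m assume "x \<in> carrier A" "m \<in> carrier V"
  then show "\<alpha> a (x \<odot>\<^bsub>V\<^esub> m) = x \<odot>\<^bsub>V\<^esub> \<alpha> a m"
    using pure_smult[OF M a, of x m] M.smult_closed by (simp add: \<alpha>_def)
qed (use a M.smult_closed M.smult_r_distr in \<open>auto simp: \<alpha>_def\<close>)

text \<open>On \<open>M\<close>, \<open>c\<close> acts as a multiple of 1 in \<open>A\<close>, and
  \<open>h\<close> is linear over \<open>A\<close>.\<close>

lemma \<alpha>_base:
  assumes c: "c \<in> k"
  shows "h \<in> carrier E \<Longrightarrow> m \<in> carrier M \<Longrightarrow> h (\<alpha> c m) = \<alpha> c (h m)"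
  using V.EndD(2)[of h m] V.EndD(4)[of h "c \<odot>\<^bsub>A\<^esub> \<one>\<^bsub>A\<^esub>" m] base_smult_closed[OF c, of "\<one>\<^bsub>A\<^esub>"]
  by (simp add: \<alpha>_def pure_base[OF c])

text \<open>The base field acts centrally through \<open>\<alpha>\<close> itself. The rank of an
  endomorphism is that of its image, which is a submodule over \<open>A\<close>.\<close>

sublocale galois_fitting E K k \<alpha> "\<lambda>h. \<rho> (h ` carrier V)"
proof -
  interpret FR: fitting_ring E "\<lambda>h. \<rho> (h ` carrier V)"
    by (rule V.fitting_End[OF rank])
  show "galois_fitting E K k \<alpha> (\<lambda>h. \<rho> (h ` carrier V))"
  proof (intro galois_fitting.intro galois_reps.intro field_reps.intro field_reps_axioms.intro
      galois_reps_axioms.intro FR.fitting_ring_axioms FR.ring_axioms K.field_axioms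
      subfield separable normal finite_extension)
    fix c assume c: "c \<in> k"
    show ac: "\<alpha> c \<in> carrier E" using \<alpha>_closed c base_subset by auto
    fix h assume h: "h \<in> carrier E"
    show "\<alpha> c \<otimes>\<^bsub>E\<^esub> h = h \<otimes>\<^bsub>E\<^esub> \<alpha> c"
      using \<alpha>_base[OF c h] V.EndD(2)[OF h]
      by (intro V.End_eqI FR.m_closed h ac) (simp_all add: compose_eq)
  qed
qed

lemma E_apply: "m \<in> carrier M \<Longrightarrow> (h \<otimes>\<^bsub>E\<^esub> h') m = h (h' m)"
  "m \<in> carrier M \<Longrightarrow> (h \<oplus>\<^bsub>E\<^esub> h') m = h m \<oplus>\<^bsub>M\<^esub> h' m"
  "m \<in> carrier M \<Longrightarrow> \<one>\<^bsub>E\<^esub> m = m" "m \<in> carrier M \<Longrightarrow> \<zero>\<^bsub>E\<^esub> m = \<zero>\<^bsub>M\<^esub>"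
  by (simp_all add: compose_eq)

lemma E_maps: "h \<in> carrier E \<Longrightarrow> m \<in> carrier M \<Longrightarrow> h m \<in> carrier M"
  using V.EndD(2) by simp

end

section \<open>Representations, projections and primitivity in the endomorphism ring\<close>

context isomorphic_over_algebra
begin

lemma E_eqI':
  assumes "h \<in> carrier E" "h' \<in> carrier E" and "\<And>m. m \<in> carrier M \<Longrightarrow> f (h m) = f (h' m)"
  shows "h = h'"
  using assms by (intro E_eqI) auto

lemma f_zero: "f \<zero>\<^bsub>M\<^esub> = \<zero>\<^bsub>N\<^esub>"
proof -
  have "f \<zero>\<^bsub>M\<^esub> \<oplus>\<^bsub>N\<^esub> f \<zero>\<^bsub>M\<^esub> = f \<zero>\<^bsub>M\<^esub>" using f_add[of "\<zero>\<^bsub>M\<^esub>" "\<zero>\<^bsub>M\<^esub>"] by simp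
  then show ?thesis using N.M.add.l_cancel_one f_closed by simp
qed

lemma rep_\<alpha>: "rep \<alpha>"
  unfolding rep_def
proof (intro conjI ballI)
  show "\<alpha> \<in> carrier K \<rightarrow> carrier E" using \<alpha>_closed by auto
next
  fix a b assume ab: "a \<in> carrier K" "b \<in> carrier K"
  have c: "\<alpha> a \<in> carrier E" "\<alpha> b \<in> carrier E" using \<alpha>_closed ab by auto
  show "\<alpha> (a \<oplus>\<^bsub>K\<^esub> b) = \<alpha> a \<oplus>\<^bsub>E\<^esub> \<alpha> b"
  proof (rule V.End_eqI)
    show "\<alpha> (a \<oplus>\<^bsub>K\<^esub> b) x = (\<alpha> a \<oplus>\<^bsub>E\<^esub> \<alpha> b) x" if "x \<in> carrier V" for x
      using that ab by (simp add: \<alpha>_def pure_add_left M.smult_l_distr)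
  qed (use ab c \<alpha>_closed V.ring_End ring.ring_simprules(1) in blast)+
  show "\<alpha> (a \<otimes>\<^bsub>K\<^esub> b) = \<alpha> a \<otimes>\<^bsub>E\<^esub> \<alpha> b"
  proof (rule V.End_eqI)
    show "\<alpha> (a \<otimes>\<^bsub>K\<^esub> b) x = (\<alpha> a \<otimes>\<^bsub>E\<^esub> \<alpha> b) x" if "x \<in> carrier V" for x
      using that ab pure_mult[of a b "\<one>\<^bsub>A\<^esub>" "\<one>\<^bsub>A\<^esub>"] M.smult_assoc1[of "pure a \<one>\<^bsub>A\<^esub>" "pure b \<one>\<^bsub>A\<^esub>" x]
      by (simp add: \<alpha>_def compose_eq M.smult_closed)
    show "\<alpha> (a \<otimes>\<^bsub>K\<^esub> b) \<in> carrier E" using ab \<alpha>_closed by simp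
    show "\<alpha> a \<otimes>\<^bsub>E\<^esub> \<alpha> b \<in> carrier E" using c V.End_mult_closed by simp
  qed
next
  fix c assume c: "c \<in> k"
  have cK: "c \<in> carrier K" using c base_subset by auto
  show "\<alpha> c = \<alpha> c \<otimes>\<^bsub>E\<^esub> \<alpha> \<one>\<^bsub>K\<^esub>"
  proof (rule V.End_eqI)
    show "\<alpha> c x = (\<alpha> c \<otimes>\<^bsub>E\<^esub> \<alpha> \<one>\<^bsub>K\<^esub>) x" if "x \<in> carrier V" for x
      using that by (simp add: \<alpha>_def compose_eq pure_one M.smult_one)
    show "\<alpha> c \<in> carrier E" using cK \<alpha>_closed by simp
    show "\<alpha> c \<otimes>\<^bsub>E\<^esub> \<alpha> \<one>\<^bsub>K\<^esub> \<in> carrier E" using cK \<alpha>_closed V.End_mult_closed by simp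
  qed
qed

lemma f_\<alpha>_base: "c \<in> k \<Longrightarrow> m \<in> carrier M \<Longrightarrow> f (\<alpha> c m) = pure c \<one>\<^bsub>A\<^esub> \<odot>\<^bsub>N\<^esub> f m"
  using f_smult[of "c \<odot>\<^bsub>A\<^esub> \<one>\<^bsub>A\<^esub>" m] base_smult_closed[of c "\<one>\<^bsub>A\<^esub>"] pure_base[of c] by (simp add: \<alpha>_def)

lemma rep_\<beta>: "rep \<beta>"
  unfolding rep_def
proof (intro conjI ballI)
  show "\<beta> \<in> carrier K \<rightarrow> carrier E" using \<beta>_closed by auto
next
  fix a b assume ab: "a \<in> carrier K" "b \<in> carrier K"
  have c: "\<beta> a \<in> carrier E" "\<beta> b \<in> carrier E" using \<beta>_closed ab by auto
  show "\<beta> (a \<oplus>\<^bsub>K\<^esub> b) = \<beta> a \<oplus>\<^bsub>E\<^esub> \<beta> b"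
  proof (rule E_eqI')
    show "f (\<beta> (a \<oplus>\<^bsub>K\<^esub> b) x) = f ((\<beta> a \<oplus>\<^bsub>E\<^esub> \<beta> b) x)" if x: "x \<in> carrier M" for x
      using x ab E_maps[OF c(1) x] E_maps[OF c(2) x]
      by (simp add: f_\<beta> f_add pure_add_left N.smult_l_distr f_closed)
  qed (use ab c \<beta>_closed V.ring_End ring.ring_simprules(1) in blast)+
  show "\<beta> (a \<otimes>\<^bsub>K\<^esub> b) = \<beta> a \<otimes>\<^bsub>E\<^esub> \<beta> b"
  proof (rule E_eqI')
    show "f (\<beta> (a \<otimes>\<^bsub>K\<^esub> b) x) = f ((\<beta> a \<otimes>\<^bsub>E\<^esub> \<beta> b) x)" if x: "x \<in> carrier M" for x
      using x ab E_maps[OF c(2) x] pure_mult[of a b "\<one>\<^bsub>A\<^esub>" "\<one>\<^bsub>A\<^esub>"]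
        N.smult_assoc1[of "pure a \<one>\<^bsub>A\<^esub>" "pure b \<one>\<^bsub>A\<^esub>" "f x"]
      by (simp add: f_\<beta> compose_eq f_closed)
    show "\<beta> (a \<otimes>\<^bsub>K\<^esub> b) \<in> carrier E" using ab \<beta>_closed by simp
    show "\<beta> a \<otimes>\<^bsub>E\<^esub> \<beta> b \<in> carrier E" using c V.End_mult_closed by simp
  qed
next
  fix c assume c: "c \<in> k"
  have cK: "c \<in> carrier K" using c base_subset by auto
  have b1: "\<beta> \<one>\<^bsub>K\<^esub> \<in> carrier E" using \<beta>_closed by simp
  show "\<beta> c = \<alpha> c \<otimes>\<^bsub>E\<^esub> \<beta> \<one>\<^bsub>K\<^esub>"
  proof (rule E_eqI')
    show "f (\<beta> c x) = f ((\<alpha> c \<otimes>\<^bsub>E\<^esub> \<beta> \<one>\<^bsub>K\<^esub>) x)" if x: "x \<in> carrier M" for x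
      using x c cK E_maps[OF b1 x] by (simp add: f_\<beta> f_\<alpha>_base compose_eq pure_one N.smult_one f_closed)
    show "\<beta> c \<in> carrier E" using cK \<beta>_closed by simp
    show "\<alpha> c \<otimes>\<^bsub>E\<^esub> \<beta> \<one>\<^bsub>K\<^esub> \<in> carrier E" using cK \<alpha>_closed \<beta>_closed V.End_mult_closed by simp
  qed
qed

lemma one_E_closed: "\<one>\<^bsub>E\<^esub> \<in> carrier E"
  using V.ring_End by (rule ring.ring_simprules(6))

lemma \<alpha>_one: "\<alpha> \<one>\<^bsub>K\<^esub> = \<one>\<^bsub>E\<^esub>"
proof (rule V.End_eqI[OF \<alpha>_closed one_E_closed])
  show "\<alpha> \<one>\<^bsub>K\<^esub> x = \<one>\<^bsub>E\<^esub> x" if "x \<in> carrier V" for x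
    using that by (simp add: \<alpha>_def pure_one M.smult_one)
qed simp

lemma \<beta>_one: "\<beta> \<one>\<^bsub>K\<^esub> = \<one>\<^bsub>E\<^esub>"
proof (rule E_eqI'[OF \<beta>_closed one_E_closed])
  show "f (\<beta> \<one>\<^bsub>K\<^esub> x) = f (\<one>\<^bsub>E\<^esub> x)" if "x \<in> carrier M" for x
    using that by (simp add: f_\<beta> pure_one N.smult_one f_closed)
qed simp

lemma e_mult: "e i \<otimes>\<^bsub>E\<^esub> e j = (if i = j then e i else \<zero>\<^bsub>E\<^esub>)"
proof (rule E_eqI)
  show "e i \<otimes>\<^bsub>E\<^esub> e j \<in> carrier E" using e_closed V.End_mult_closed by simp
  show "(if i = j then e i else \<zero>\<^bsub>E\<^esub>) \<in> carrier E"
    using e_closed ring.ring_simprules(2)[OF V.ring_End] by auto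
  fix m l assume "m \<in> carrier M" "l \<in> J"
  then show "f ((e i \<otimes>\<^bsub>E\<^esub> e j) m) l = f ((if i = j then e i else \<zero>\<^bsub>E\<^esub>) m) l"
    using E_maps[OF e_closed, of m j] by (auto simp: compose_eq f_e component_def f_zero N_sel)
qed

lemma e_\<beta>: "a \<in> carrier K \<Longrightarrow> e i \<otimes>\<^bsub>E\<^esub> \<beta> a = \<beta> a \<otimes>\<^bsub>E\<^esub> e i"
proof (rule E_eqI')
  assume a: "a \<in> carrier K"
  show "e i \<otimes>\<^bsub>E\<^esub> \<beta> a \<in> carrier E" "\<beta> a \<otimes>\<^bsub>E\<^esub> e i \<in> carrier E"
    using e_closed \<beta>_closed[OF a] V.End_mult_closed by auto
  show "f ((e i \<otimes>\<^bsub>E\<^esub> \<beta> a) m) = f ((\<beta> a \<otimes>\<^bsub>E\<^esub> e i) m)" if m: "m \<in> carrier M" for m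
    using m a E_maps[OF e_closed m] E_maps[OF \<beta>_closed[OF a] m]
    by (simp add: compose_eq f_e f_\<beta> component_smult f_closed)
qed

text \<open>Partial sums of the projections truncate coordinates, so the induction runs over finite
  index sets \<open>J'\<close>.\<close>

lemma sum_e: "(\<Oplus>\<^bsub>E\<^esub>i\<in>J. e i) = \<one>\<^bsub>E\<^esub>"
proof -
  have c: "(\<Oplus>\<^bsub>E\<^esub>i\<in>J'. e i) \<in> carrier E" for J' by (rule finsum_closed) (simp add: e_closed)
  have "f ((\<Oplus>\<^bsub>E\<^esub>i\<in>J'. e i) m) = (\<lambda>j\<in>J. if j \<in> J' then f m j else \<zero>\<^bsub>Ms j\<^esub>)"
    if "finite J'" and m: "m \<in> carrier M" for J' m
    using that(1)
  proof (induction J' rule: finite_induct)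
    case empty
    then show ?case using m by (auto simp: f_zero N_sel)
  next
    case (insert i J')
    have "(\<Oplus>\<^bsub>E\<^esub>i\<in>insert i J'. e i) = e i \<oplus>\<^bsub>E\<^esub> (\<Oplus>\<^bsub>E\<^esub>i\<in>J'. e i)"
      by (rule finsum_insert) (use insert e_closed in auto)
    then have "f ((\<Oplus>\<^bsub>E\<^esub>i\<in>insert i J'. e i) m) = component i (f m) \<oplus>\<^bsub>N\<^esub> f ((\<Oplus>\<^bsub>E\<^esub>i\<in>J'. e i) m)"
      using m E_maps[OF e_closed m] E_maps[OF c m] by (simp add: f_add f_e)
    also have "\<dots> = (\<lambda>j\<in>J. if j \<in> insert i J' then f m j else \<zero>\<^bsub>Ms j\<^esub>)"
    proof
      fix j
      show "(component i (f m) \<oplus>\<^bsub>N\<^esub> f ((\<Oplus>\<^bsub>E\<^esub>i\<in>J'. e i) m)) j = (\<lambda>j\<in>J. if j \<in> insert i J' then f m j else \<zero>\<^bsub>Ms j\<^esub>) j"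
      proof (cases "j \<in> J")
        case True
        interpret G: abelian_group "Ms j" by (rule Ms_group[OF True])
        have "f m j \<in> carrier (Ms j)" using N_component[OF f_closed[OF m] True] .
        then have "f m j \<oplus>\<^bsub>Ms j\<^esub> \<zero>\<^bsub>Ms j\<^esub> = f m j" by (rule G.r_zero)
        then show ?thesis
          using True insert \<open>f m j \<in> _\<close> by (cases "j = i") (auto simp: N_sel component_def)
      qed (simp add: N_sel)
    qed
    finally show ?case .
  qed
  then show ?thesis
    by (intro E_eqI c one_E_closed) (use J in auto)
qed

definition inclusion where "inclusion i x = (\<lambda>j\<in>J. if j = i then x else \<zero>\<^bsub>Ms j\<^esub>)"

text \<open>An idempotent of this corner is linear over \<open>A\<close> and over \<open>K\<close>,
  so it amounts to an idempotent endomorphism of \<open>Ms i\<close> over the tensor ring. Its image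
  and kernel are complementary submodules, and indecomposability makes one of them zero.\<close>

lemma primitive_e:
  assumes i: "i \<in> J"
  shows "primitive_idempotent (\<beta> ` carrier K) (e i)"
proof -
  interpret G: left_module T "Ms i" by (rule Ms[OF i])
  have inc: "inclusion i x \<in> carrier N" if "x \<in> carrier (Ms i)" for x
    using that Ms_zero_closed by (auto simp: N_mem inclusion_def)
  have inc_i [simp]: "inclusion i x i = x" for x using i by (simp add: inclusion_def)
  have component_inc: "component i n = inclusion i (n i)" for n by (auto simp: component_def inclusion_def)
  have inc_zero: "inclusion i \<zero>\<^bsub>Ms i\<^esub> = \<zero>\<^bsub>N\<^esub>" by (auto simp: inclusion_def N_sel)
  have id: "idempotent (e i)" using e_mult[of i i] e_closed by (simp add: idempotent_def)
  have cor: "in_corner (e i) (\<beta> ` carrier K) (e i)"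
    using e_mult[of i i] e_closed e_\<beta> by (auto simp: in_corner_def)
  have nz: "e i \<noteq> \<zero>\<^bsub>E\<^esub>"
  proof
    assume e0: "e i = \<zero>\<^bsub>E\<^esub>"
    obtain x where x: "x \<in> carrier (Ms i)" "x \<noteq> \<zero>\<^bsub>Ms i\<^esub>"
      using indecomposable[OF i] G.M.zero_closed unfolding indecomposable_module_def by blast
    have m: "g (inclusion i x) \<in> carrier M" using g_closed inc x by simp
    have "f (e i (g (inclusion i x))) i = x"
      using f_e[OF m, of i] f_g[OF inc[OF x(1)]] by (simp add: component_inc)
    moreover have "f (e i (g (inclusion i x))) i = \<zero>\<^bsub>Ms i\<^esub>"
      unfolding e0 using m i by (simp add: f_zero N_sel)
    ultimately show False using x by simp
  qed
  have "h = \<zero>\<^bsub>E\<^esub> \<or> h = e i" if h: "idempotent h" and hc: "in_corner (e i) (\<beta> ` carrier K) h" for h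
  proof -
    have hE: "h \<in> carrier E" using h by (simp add: idempotent_def)
    have hh: "h (h m) = h m" if "m \<in> carrier M" for m
      using h E_apply(1)[OF that, of h h] by (simp add: idempotent_def)
    have eh: "e i (h m) = h m" "h (e i m) = h m" if "m \<in> carrier M" for m
      using hc E_apply(1)[OF that, of "e i" h] E_apply(1)[OF that, of h "e i"] by (simp_all add: in_corner_def)
    have hb: "h (\<beta> a m) = \<beta> a (h m)" if "m \<in> carrier M" "a \<in> carrier K" for a m
      using hc E_apply(1)[OF that(1), of "\<beta> a" h] E_apply(1)[OF that(1), of h "\<beta> a"] that(2)
      by (auto simp: in_corner_def)
    note hm = E_maps[OF hE]
    \<comment> \<open>\<open>h\<close> read on the summand \<open>Ms i\<close>. As \<open>h\<close>
      begins and ends with \<open>e i\<close>, it can be recovered from this one component.\<close>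
    define h' where "h' x = f (h (g (inclusion i x))) i" for x
    have fh: "f (h m) = inclusion i (h' (f m i))" if m: "m \<in> carrier M" for m
    proof -
      have "e i m = g (component i (f m))" using m by (simp add: e_def conj_def)
      then have "h m = h (g (inclusion i (f m i)))" using eh(2)[OF m] by (simp add: component_inc)
      moreover have "f (h m) = inclusion i (f (h m) i)"
        using f_e[OF hm[OF m], of i] eh(1)[OF m] by (simp add: component_inc)
      ultimately show ?thesis by (simp add: h'_def)
    qed
    have gm: "g (inclusion i x) \<in> carrier M" "f (g (inclusion i x)) = inclusion i x" if "x \<in> carrier (Ms i)" for x
      using g_closed f_g inc that by auto
    have h'c: "h' x \<in> carrier (Ms i)" if "x \<in> carrier (Ms i)" for x
      unfolding h'_def by (rule N_component[OF f_closed[OF hm[OF gm(1)[OF that]]] i])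
    have h'h': "h' (h' x) = h' x" if x: "x \<in> carrier (Ms i)" for x
    proof -
      have "f (h (h (g (inclusion i x)))) i = h' (f (h (g (inclusion i x))) i)"
        using fh[OF hm[OF gm(1)[OF x]]] by simp
      then show ?thesis using hh[OF gm(1)[OF x]] by (simp add: h'_def)
    qed
    have h'_add: "h' (x \<oplus>\<^bsub>Ms i\<^esub> y) = h' x \<oplus>\<^bsub>Ms i\<^esub> h' y" if x: "x \<in> carrier (Ms i)" and y: "y \<in> carrier (Ms i)" for x y
    proof -
      have "f (g (inclusion i x) \<oplus>\<^bsub>M\<^esub> g (inclusion i y)) i = x \<oplus>\<^bsub>Ms i\<^esub> y"
        using gm x y i by (simp add: f_add N_sel)
      then have "h' (x \<oplus>\<^bsub>Ms i\<^esub> y) = f (h (g (inclusion i x) \<oplus>\<^bsub>M\<^esub> g (inclusion i y))) i"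
        using fh[of "g (inclusion i x) \<oplus>\<^bsub>M\<^esub> g (inclusion i y)"] gm x y by simp
      also have "\<dots> = h' x \<oplus>\<^bsub>Ms i\<^esub> h' y"
        using V.EndD(3)[OF hE, of "g (inclusion i x)" "g (inclusion i y)"] gm x y hm i
        by (simp add: f_add N_sel h'_def)
      finally show ?thesis .
    qed
    \<comment> \<open>A pure tensor acts as its \<open>K\<close>-factor after its
      \<open>A\<close>-factor: \<open>h\<close> commutes with the former because it commutes with
      \<open>\<beta> a\<close>, and with the latter because it is \<open>A\<close>-linear.\<close>
    have h'_pure: "h' (pure a t \<odot>\<^bsub>Ms i\<^esub> x) = pure a t \<odot>\<^bsub>Ms i\<^esub> h' x"
      if a: "a \<in> carrier K" and t: "t \<in> carrier A" and x: "x \<in> carrier (Ms i)" for a t x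
    proof -
      let ?m = "g (inclusion i x)"
      let ?m' = "\<beta> a (pure \<one>\<^bsub>K\<^esub> t \<odot>\<^bsub>M\<^esub> ?m)"
      have mc: "?m \<in> carrier M" "pure \<one>\<^bsub>K\<^esub> t \<odot>\<^bsub>M\<^esub> ?m \<in> carrier M" "?m' \<in> carrier M"
        using gm[OF x] t a M.smult_closed E_maps[OF \<beta>_closed[OF a]] by auto
      have "f ?m' i = pure a \<one>\<^bsub>A\<^esub> \<odot>\<^bsub>Ms i\<^esub> (pure \<one>\<^bsub>K\<^esub> t \<odot>\<^bsub>Ms i\<^esub> x)"
        using mc a t gm[OF x] i by (simp add: f_\<beta> f_smult N_sel)
      also have "\<dots> = pure a t \<odot>\<^bsub>Ms i\<^esub> x" using pure_smult(1)[OF Ms[OF i] a t x] by simp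
      finally have "h' (pure a t \<odot>\<^bsub>Ms i\<^esub> x) = f (h ?m') i" using fh[OF mc(3)] by simp
      also have "h ?m' = \<beta> a (pure \<one>\<^bsub>K\<^esub> t \<odot>\<^bsub>M\<^esub> h ?m)"
        using hb[OF mc(2) a] V.EndD(4)[OF hE t, of ?m] mc(1) by simp
      also have "f \<dots> i = pure a \<one>\<^bsub>A\<^esub> \<odot>\<^bsub>Ms i\<^esub> (pure \<one>\<^bsub>K\<^esub> t \<odot>\<^bsub>Ms i\<^esub> h' x)"
        using a t hm[OF mc(1)] M.smult_closed i by (simp add: f_\<beta> f_smult N_sel h'_def)
      also have "\<dots> = pure a t \<odot>\<^bsub>Ms i\<^esub> h' x" using pure_smult(1)[OF Ms[OF i] a t h'c[OF x]] by simp
      finally show ?thesis .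
    qed
    have h'_smult: "h' (C \<odot>\<^bsub>Ms i\<^esub> x) = C \<odot>\<^bsub>Ms i\<^esub> h' x" if "C \<in> carrier T" "x \<in> carrier (Ms i)" for C x
      by (rule tensor_semilinearI[OF Ms[OF i] Ms[OF i], of h' "\<lambda>C. C"]) (use h'c h'_add h'_pure that in auto)
    define H where "H = restrict h' (carrier (Ms i))"
    have H: "H \<in> carrier G.End"
      by (rule G.EndI) (use h'c h'_add h'_smult G.smult_closed in \<open>auto simp: H_def\<close>)
    let ?N1 = "H ` carrier (Ms i)" and ?N2 = "{x \<in> carrier (Ms i). H x = \<zero>\<^bsub>Ms i\<^esub>}"
    have sub: "submodule ?N1 T (Ms i)" "submodule ?N2 T (Ms i)"
      by (rule G.submodule_image[OF H], rule G.submodule_kernel[OF H])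
    note D1 = G.left_submoduleD[OF sub(1)] and D2 = G.left_submoduleD[OF sub(2)]
    have HH: "H (H x) = H x" if "x \<in> carrier (Ms i)" for x using that h'h' h'c by (simp add: H_def)
    have diff: "x \<oplus>\<^bsub>Ms i\<^esub> \<ominus>\<^bsub>Ms i\<^esub> H x \<in> ?N2" if x: "x \<in> carrier (Ms i)" for x
      using x G.EndD(2,3)[OF H] G.End_minus_apply[OF H] HH[OF x] by (simp add: G.M.r_neg)
    have "?N1 \<inter> ?N2 = {\<zero>\<^bsub>Ms i\<^esub>}"
    proof
      show "?N1 \<inter> ?N2 \<subseteq> {\<zero>\<^bsub>Ms i\<^esub>}" using HH by auto
      show "{\<zero>\<^bsub>Ms i\<^esub>} \<subseteq> ?N1 \<inter> ?N2" using D1(2) D2(2) by blast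
    qed
    moreover have "?N1 <+>\<^bsub>Ms i\<^esub> ?N2 = carrier (Ms i)"
    proof
      show "?N1 <+>\<^bsub>Ms i\<^esub> ?N2 \<subseteq> carrier (Ms i)" using D1(1) D2(1) by (auto simp: set_add_def')
      show "carrier (Ms i) \<subseteq> ?N1 <+>\<^bsub>Ms i\<^esub> ?N2"
      proof
        fix x assume x: "x \<in> carrier (Ms i)"
        have Hx: "H x \<in> carrier (Ms i)" using G.EndD(2)[OF H x] .
        have "x = H x \<oplus>\<^bsub>Ms i\<^esub> (x \<oplus>\<^bsub>Ms i\<^esub> \<ominus>\<^bsub>Ms i\<^esub> H x)"
          using x Hx by (simp add: G.M.a_lcomm G.M.r_neg)
        then show "x \<in> ?N1 <+>\<^bsub>Ms i\<^esub> ?N2" unfolding set_add_def' using diff[OF x] x by blast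
      qed
    qed
    ultimately consider "?N1 = {\<zero>\<^bsub>Ms i\<^esub>}" | "?N2 = {\<zero>\<^bsub>Ms i\<^esub>}"
      using indecomposable[OF i] sub unfolding indecomposable_module_def by blast
    then show ?thesis
    proof cases
      case 1
      have "h = \<zero>\<^bsub>E\<^esub>"
      proof (rule E_eqI'[OF hE ring.ring_simprules(2)[OF V.ring_End]])
        fix m assume m: "m \<in> carrier M"
        have "h' (f m i) = \<zero>\<^bsub>Ms i\<^esub>"
          using 1 N_component[OF f_closed[OF m] i] by (auto simp: H_def)
        then show "f (h m) = f (\<zero>\<^bsub>E\<^esub> m)" using fh[OF m] m by (simp add: inc_zero f_zero)
      qed
      then show ?thesis ..
    next
      \<comment> \<open>With trivial kernel, \<open>x - H x\<close>, which \<open>H\<close> kills,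
        must vanish, so \<open>H\<close> is the identity.\<close>
      case 2
      have "h = e i"
      proof (rule E_eqI'[OF hE e_closed])
        fix m assume m: "m \<in> carrier M"
        have x: "f m i \<in> carrier (Ms i)" using N_component[OF f_closed[OF m] i] .
        have Hx: "H (f m i) \<in> carrier (Ms i)" using G.EndD(2)[OF H x] .
        have "f m i \<oplus>\<^bsub>Ms i\<^esub> \<ominus>\<^bsub>Ms i\<^esub> H (f m i) = \<zero>\<^bsub>Ms i\<^esub>" using diff[OF x] 2 by blast
        then have "h' (f m i) = f m i"
          using G.M.minus_equality[of "f m i" "\<ominus>\<^bsub>Ms i\<^esub> H (f m i)"] x Hx by (simp add: H_def)
        then show "f (h m) = f (e i m)" using fh[OF m] f_e[OF m] by (simp add: component_inc)
      qed
      then show ?thesis ..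
    qed
  qed
  then show ?thesis using id cor nz by (simp add: primitive_idempotent_def)
qed

text \<open>Both actions of \<open>K\<close> are unital on \<open>M\<close>, so the identity is an
  equivalence to start from, and the improved equivalence \<open>u\<close> is a unit of
  \<open>E\<close>. The required isomorphism is \<open>f\<close> after \<open>u\<close>.\<close>

theorem twisted_isomorphism:
  "\<exists>\<phi>. (\<forall>i\<in>J. \<phi> i \<in> galois_group K k) \<and>
    module_isomorphic T M (direct_sum_module J (\<lambda>i. twist K k A (\<phi> i) (Ms i)))"
proof -
  have one: "\<one>\<^bsub>E\<^esub> \<otimes>\<^bsub>E\<^esub> h = h" "h \<otimes>\<^bsub>E\<^esub> \<one>\<^bsub>E\<^esub> = h" if "h \<in> carrier E" for h
    using that ring.ring_simprules(12)[OF V.ring_End] monoid.r_one[OF ring.is_monoid[OF V.ring_End]] by auto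
  have "idem_iso (\<alpha> \<one>\<^bsub>K\<^esub>) (\<beta> \<one>\<^bsub>K\<^esub>) \<one>\<^bsub>E\<^esub> \<one>\<^bsub>E\<^esub>"
    unfolding \<alpha>_one \<beta>_one idem_iso_def using one[OF one_E_closed] one_E_closed by simp
  then have "\<exists>\<phi> u v. (\<forall>i\<in>J. \<phi> i \<in> galois_group K k) \<and> idem_iso (\<alpha> \<one>\<^bsub>K\<^esub>) (\<beta> \<one>\<^bsub>K\<^esub>) u v \<and>
    (\<forall>i\<in>J. \<forall>a\<in>carrier K. e i \<otimes>\<^bsub>E\<^esub> u \<otimes>\<^bsub>E\<^esub> \<alpha> a = e i \<otimes>\<^bsub>E\<^esub> \<beta> (\<phi> i a) \<otimes>\<^bsub>E\<^esub> u)"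
  proof (rule twisted_idem_iso[OF J rep_\<alpha> rep_\<beta> _ primitive_e])
    show "e i \<otimes>\<^bsub>E\<^esub> e j = \<zero>\<^bsub>E\<^esub>" if "i \<noteq> j" for i j using e_mult[of i j] that by simp
    show "in_corner (\<beta> \<one>\<^bsub>K\<^esub>) {} (e i)" for i
      unfolding \<beta>_one in_corner_def using one[OF e_closed] e_closed by simp
    show "\<beta> \<one>\<^bsub>K\<^esub> = (\<Oplus>\<^bsub>E\<^esub>i\<in>J. e i)" unfolding \<beta>_one sum_e ..
  qed
  then obtain \<phi> u v where \<phi>': "\<forall>i\<in>J. \<phi> i \<in> galois_group K k" and uv: "idem_iso \<one>\<^bsub>E\<^esub> \<one>\<^bsub>E\<^esub> u v"
    and ua: "\<forall>i\<in>J. \<forall>a\<in>carrier K. e i \<otimes>\<^bsub>E\<^esub> u \<otimes>\<^bsub>E\<^esub> \<alpha> a = e i \<otimes>\<^bsub>E\<^esub> \<beta> (\<phi> i a) \<otimes>\<^bsub>E\<^esub> u"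
    unfolding \<alpha>_one \<beta>_one by (elim exE conjE) iprover
  note \<phi> = \<phi>'[rule_format]
  have uE: "u \<in> carrier E" "v \<in> carrier E" and inv: "u \<otimes>\<^bsub>E\<^esub> v = \<one>\<^bsub>E\<^esub>" "v \<otimes>\<^bsub>E\<^esub> u = \<one>\<^bsub>E\<^esub>"
    using uv unfolding idem_iso_def by blast+
  note um = E_maps[OF uE(1)]
  let ?N = "direct_sum_module J (\<lambda>i. twist K k A (\<phi> i) (Ms i))"
  have twisted: "carrier ?N = carrier N" "n \<oplus>\<^bsub>?N\<^esub> n' = n \<oplus>\<^bsub>N\<^esub> n'"
    "C \<odot>\<^bsub>?N\<^esub> n = (\<lambda>i\<in>J. tensor_map K k A (\<phi> i) C \<odot>\<^bsub>Ms i\<^esub> n i)" for n n' C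
    by (simp_all add: direct_sum_module_def twist_def restrict_scalars_def)
  have "v (u m) = m" "u (v m) = m" if "m \<in> carrier M" for m
    using E_apply(1)[OF that, of v u] E_apply(1)[OF that, of u v] E_apply(3)[OF that] inv by metis+
  then have "bij_betw u (carrier M) (carrier M)"
    using um E_maps[OF uE(2)] by (intro bij_betw_byWitness[of _ v]) auto
  then have bij: "bij_betw (\<lambda>m. f (u m)) (carrier M) (carrier ?N)"
    using bij_betw_trans[OF _ f_bij] unfolding twisted comp_def by blast
  have add: "f (u (x \<oplus>\<^bsub>M\<^esub> y)) = f (u x) \<oplus>\<^bsub>N\<^esub> f (u y)" if "x \<in> carrier M" "y \<in> carrier M" for x y
    using V.EndD(3)[OF uE(1), of x y] that um f_add by simp
  have smult: "f (u (C \<odot>\<^bsub>M\<^esub> m)) i = tensor_map K k A (\<phi> i) C \<odot>\<^bsub>Ms i\<^esub> f (u m) i"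
    if C: "C \<in> carrier T" and m: "m \<in> carrier M" and i: "i \<in> J" for C m i
  proof (rule tensor_semilinearI[OF M Ms[OF i], of "\<lambda>m. f (u m) i" "tensor_map K k A (\<phi> i)"])
    fix a x m assume a: "a \<in> carrier K" and x: "x \<in> carrier A" and m: "m \<in> carrier M"
    have pa: "\<phi> i a \<in> carrier K" by (rule galois_group_closed[OF \<phi>[OF i] a])
    have am: "\<alpha> a m \<in> carrier M" "\<beta> (\<phi> i a) (u m) \<in> carrier M"
      using E_maps[OF \<alpha>_closed[OF a] m] E_maps[OF \<beta>_closed[OF pa] um[OF m]] .
    have ci: "f (e i m') i = f m' i" if "m' \<in> carrier M" for m'
      using f_e[OF that] i by (simp add: component_def)
    have "f (u (pure a x \<odot>\<^bsub>M\<^esub> m)) = pure \<one>\<^bsub>K\<^esub> x \<odot>\<^bsub>N\<^esub> f (u (\<alpha> a m))"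
      using pure_smult(2)[OF M a x m] V.EndD(4)[OF uE(1) x, of "\<alpha> a m"] am(1) m f_smult[OF x um[OF am(1)]]
      by (simp add: \<alpha>_def)
    \<comment> \<open>Component \<open>i\<close> of the equation \<open>ua\<close>, read through
      \<open>f\<close>: the factor \<open>e i\<close> restricts the semilinearity of
      \<open>u\<close> to that component.\<close>
    moreover have "f (u (\<alpha> a m)) i = pure (\<phi> i a) \<one>\<^bsub>A\<^esub> \<odot>\<^bsub>Ms i\<^esub> f (u m) i"
    proof -
      have "e i (u (\<alpha> a m)) = e i (\<beta> (\<phi> i a) (u m))"
        using arg_cong[OF ua[rule_format, OF i a], of "\<lambda>h. h m"] m um[OF m] am by (simp add: compose_eq)
      then have "f (u (\<alpha> a m)) i = f (\<beta> (\<phi> i a) (u m)) i"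
        using ci[OF um[OF am(1)]] ci[OF am(2)] by simp
      then show ?thesis using f_\<beta>[OF pa um[OF m]] i by (simp add: N_sel)
    qed
    ultimately have "f (u (pure a x \<odot>\<^bsub>M\<^esub> m)) i = pure \<one>\<^bsub>K\<^esub> x \<odot>\<^bsub>Ms i\<^esub> (pure (\<phi> i a) \<one>\<^bsub>A\<^esub> \<odot>\<^bsub>Ms i\<^esub> f (u m) i)"
      using i by (simp add: N_sel)
    also have "\<dots> = pure (\<phi> i a) x \<odot>\<^bsub>Ms i\<^esub> f (u m) i"
      using pure_smult(2)[OF Ms[OF i] pa x N_component[OF f_closed[OF um[OF m]] i]] by simp
    finally show "f (u (pure a x \<odot>\<^bsub>M\<^esub> m)) i = tensor_map K k A (\<phi> i) (pure a x) \<odot>\<^bsub>Ms i\<^esub> f (u m) i"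
      unfolding tensor_map_pure[OF \<phi>[OF i] a x] .
  next
    show "f (u m) i \<in> carrier (Ms i)" if "m \<in> carrier M" for m
      using N_component[OF f_closed[OF um[OF that]] i] .
    show "f (u (m \<oplus>\<^bsub>M\<^esub> m')) i = f (u m) i \<oplus>\<^bsub>Ms i\<^esub> f (u m') i" if "m \<in> carrier M" "m' \<in> carrier M" for m m'
      using add[OF that] i by (simp add: N_sel)
  qed (use C m tensor_map_closed[OF \<phi>[OF i]] tensor_map_zero[OF \<phi>[OF i]] tensor_map_diff[OF \<phi>[OF i]] in auto)
  have "f (u (C \<odot>\<^bsub>M\<^esub> m)) = C \<odot>\<^bsub>?N\<^esub> f (u m)" if C: "C \<in> carrier T" and m: "m \<in> carrier M" for C m
  proof
    fix i
    show "f (u (C \<odot>\<^bsub>M\<^esub> m)) i = (C \<odot>\<^bsub>?N\<^esub> f (u m)) i"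
    proof (cases "i \<in> J")
      case True
      then show ?thesis using smult[OF C m True] by (simp add: twisted)
    next
      \<comment> \<open>Outside \<open>J\<close> both sides are undefined, as members of an
        extensional product.\<close>
      case False
      have "f (u (C \<odot>\<^bsub>M\<^esub> m)) \<in> carrier N" using C m M.smult_closed um f_closed by simp
      then show ?thesis using False by (auto simp: N_mem twisted PiE_def extensional_def)
    qed
  qed
  then have "module_isomorphic T M ?N"
    unfolding module_isomorphic_def using bij add by (intro exI[of _ "\<lambda>m. f (u m)"]) (simp add: twisted)
  then show ?thesis using \<phi>' by blast
qed

end

theorem corollary2:
  fixes K :: "'a ring" and k :: "'a set" and \<Lambda> :: "('a, 'l) module"
    and M :: "(('a \<times> 'l \<Rightarrow>\<^sub>0 int) set, 'm) module"
    and Ms :: "nat \<Rightarrow> (('a \<times> 'l \<Rightarrow>\<^sub>0 int) set, 'n) module"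
    and r :: nat
  assumes "field K" and "subfield k K"
    and "ring.finite_dimension K k (carrier K)"
    and "separable_extension K k" and "normal_extension K k"
    and "assoc_algebra (K\<lparr>carrier := k\<rparr>) \<Lambda>"
    and "left_module (tensor_ring K k \<Lambda>) M"
    and "finite_dimensional (K\<lparr>carrier := k\<rparr>) (as_left_factor_module K k \<Lambda> M)"
    and "\<And>i. i \<in> {1..r} \<Longrightarrow> left_module (tensor_ring K k \<Lambda>) (Ms i)"
    and "\<And>i. i \<in> {1..r} \<Longrightarrow>
      finite_dimensional (K\<lparr>carrier := k\<rparr>) (as_left_factor_module K k \<Lambda> (Ms i))"
    and "\<And>i. i \<in> {1..r} \<Longrightarrow> indecomposable_module (tensor_ring K k \<Lambda>) (Ms i)"
    and "module_isomorphic \<Lambda> (as_right_factor_module K k \<Lambda> M)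
      (as_right_factor_module K k \<Lambda> (direct_sum_module {1..r} Ms))"
  shows "\<exists>\<phi>. (\<forall>i\<in>{1..r}. \<phi> i \<in> galois_group K k) \<and>
    module_isomorphic (tensor_ring K k \<Lambda>) M
      (direct_sum_module {1..r} (\<lambda>i. twist K k \<Lambda> (\<phi> i) (Ms i)))"
proof -
  have tensor: "tensor_setting K k \<Lambda>"
    using assms(1,2,6) left_module.axioms(1)[OF assms(7)]
    by (intro tensor_setting.intro tensor_setting_axioms.intro)
  obtain \<rho> :: "'m set \<Rightarrow> nat" where \<rho>: "\<forall>U W. submodule U \<Lambda> (as_right_factor_module K k \<Lambda> M) \<longrightarrow>
      submodule W \<Lambda> (as_right_factor_module K k \<Lambda> M) \<longrightarrow> U \<subset> W \<longrightarrow> \<rho> U < \<rho> W"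
    by (rule exE[OF tensor_setting.right_factor_rank[OF tensor assms(7,8)]])
  obtain f where f: "bij_betw f (carrier M) (carrier (direct_sum_module {1..r} Ms))"
      "\<forall>x\<in>carrier M. \<forall>y\<in>carrier M. f (x \<oplus>\<^bsub>M\<^esub> y) = f x \<oplus>\<^bsub>direct_sum_module {1..r} Ms\<^esub> f y"
      "\<forall>a\<in>carrier \<Lambda>. \<forall>x\<in>carrier M. f (pure_tensor K k \<Lambda> \<one>\<^bsub>K\<^esub> a \<odot>\<^bsub>M\<^esub> x)
        = pure_tensor K k \<Lambda> \<one>\<^bsub>K\<^esub> a \<odot>\<^bsub>direct_sum_module {1..r} Ms\<^esub> f x"
    using assms(12) unfolding module_isomorphic_def as_right_factor_module_def restrict_scalars_def by auto
  interpret isomorphic_over_algebra K k \<Lambda> M "{1..r}" Ms f \<rho>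
    by (intro isomorphic_over_algebra.intro isomorphic_over_algebra_axioms.intro tensor)
      (use assms f \<rho> in auto)
  show ?thesis by (rule twisted_isomorphism)
qed

end
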